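(* Let $\mathscr{C}$ be a class of hypergraphs with VC-dimension bounded by some constant $d$, and let $k\ge 1$. Then there exists a polynomial-time algorithm that, given a hypergraph $H\in\mathscr{C}$ with $\mathrm{fhw}(H)\le k$, finds an FHD of $H$ of width $O(k\cdot\log k)$.
   Context: A hypergraph $H=(V(H),E(H))$ consists of a finite set $V(H)$ of vertices and a set $E(H)$ of non-empty subsets of $V(H)$ (edges), such that every vertex lies in at least one edge. For $\gamma:E(H)\to[0,1]$ let $B(\gamma)=\{v: \sum_{e\ni v}\gamma(e)\ge 1\}$ and $\mathrm{weight}(\gamma)=\sum_e\gamma(e)$. A tree decomposition (TD) of $H$ is a pair $\langle T,(B_u)_{u\in T}\rangle$ with $T$ a rooted tree and bags $B_u\subseteq V(H)$ such that (1) each $e\in E(H)$ satisfies $e\subseteq B_u$ for some node $u$, and (2) for each $v\in V(H)$ the set $\{u\in T: v\in B_u\}$ is connected in $T$. A fractional hypertree decomposition (FHD) is a TD together with functions $\gamma_u:E(H)\to[0,1]$ ($u\in T$) with $B_u\subseteq B(\gamma_u)$; its width is $\max_u\mathrm{weight}(\gamma_u)$, and $\mathrm{fhw}(H)$ is the minimum width over all FHDs of $H$. A set $X\subseteq V(H)$ is shattered if $\{X\cap e: e\in E(H)\}=2^X$; the VC-dimension of $H$ is the maximum cardinality of a shattered subset of $V(H)$. In the claim $k$ and $d$ are constants for the polynomial running time, and the bound $O(k\log k)$ is asymptotic in $k$ for fixed $d$: the width of the output is at most $g_d(k)$ for some function $g_d$, depending only on $d$, with $g_d(k)=O(k\log k)$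 as $k\to\infty$. *)

theory Defs
  imports Complex_Main
    "HOL-Library.Landau_Symbols"
    "HOL-Computational_Algebra.Polynomial"
begin

section \<open>Hypergraphs and fractional hypertree decompositions\<close>

record 'v hypergraph =
  verts :: "'v set"
  edges :: "'v set set"

definition hypergraph :: "'v hypergraph \<Rightarrow> bool" where
  "hypergraph H \<longleftrightarrow>
     finite (verts H) \<and>
     (\<forall>e\<in>edges H. e \<noteq> {} \<and> e \<subseteq> verts H) \<and>
     (\<forall>v\<in>verts H. \<exists>e\<in>edges H. v \<in> e)"

definition shattered :: "'v hypergraph \<Rightarrow> 'v set \<Rightarrow> bool" where
  "shattered H X \<longleftrightarrow> X \<subseteq> verts H \<and> (\<lambda>e. X \<inter> e) ` edges H = Pow X"

text \<open>The inserted \<open>0\<close> only matters for the hypergraph without edges, which shatters no set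
  at all; otherwise the empty set is shattered.\<close>

definition vc_dim :: "'v hypergraph \<Rightarrow> nat" where
  "vc_dim H = Max (insert 0 (card ` {X. shattered H X}))"

definition covered :: "'v hypergraph \<Rightarrow> ('v set \<Rightarrow> real) \<Rightarrow> 'v set" where
  "covered H \<gamma> = {v \<in> verts H. (\<Sum>e\<in>{e \<in> edges H. v \<in> e}. \<gamma> e) \<ge> 1}"

definition weight :: "'v hypergraph \<Rightarrow> ('v set \<Rightarrow> real) \<Rightarrow> real" where
  "weight H \<gamma> = (\<Sum>e\<in>edges H. \<gamma> e)"

text \<open>A finite rooted tree, given by its nodes, its root and its (parent, child) pairs.\<close>

definition rooted_tree :: "'n set \<Rightarrow> 'n \<Rightarrow> ('n \<times> 'n) set \<Rightarrow> bool" where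
  "rooted_tree N r A \<longleftrightarrow>
     finite N \<and> r \<in> N \<and> A \<subseteq> N \<times> N \<and>
     (\<forall>u. (u, r) \<notin> A) \<and>
     (\<forall>v\<in>N - {r}. \<exists>!u. (u, v) \<in> A) \<and>
     (\<forall>v\<in>N. (r, v) \<in> A\<^sup>*)"

definition connected_in :: "('n \<times> 'n) set \<Rightarrow> 'n set \<Rightarrow> bool" where
  "connected_in A S \<longleftrightarrow> (\<forall>u\<in>S. \<forall>v\<in>S. (u, v) \<in> ((A \<union> A\<inverse>) \<inter> S \<times> S)\<^sup>*)"

text \<open>Tree nodes are natural numbers, which is no restriction as trees are finite. The values of
  \<open>bag\<close> outside \<open>nodes\<close> and of \<open>cover\<close> outside \<open>nodes\<close> and the edges are irrelevant.\<close>

record 'v decomp =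
  nodes :: "nat set"
  root :: nat
  arcs :: "(nat \<times> nat) set"
  bag :: "nat \<Rightarrow> 'v set"
  cover :: "nat \<Rightarrow> 'v set \<Rightarrow> real"

definition tree_decomposition :: "'v hypergraph \<Rightarrow> 'v decomp \<Rightarrow> bool" where
  "tree_decomposition H D \<longleftrightarrow>
     rooted_tree (nodes D) (root D) (arcs D) \<and>
     (\<forall>u\<in>nodes D. bag D u \<subseteq> verts H) \<and>
     (\<forall>e\<in>edges H. \<exists>u\<in>nodes D. e \<subseteq> bag D u) \<and>
     (\<forall>v\<in>verts H. connected_in (arcs D) {u \<in> nodes D. v \<in> bag D u})"

definition fhd :: "'v hypergraph \<Rightarrow> 'v decomp \<Rightarrow> bool" where
  "fhd H D \<longleftrightarrow>
     tree_decomposition H D \<and>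
     (\<forall>u\<in>nodes D. (\<forall>e\<in>edges H. 0 \<le> cover D u e \<and> cover D u e \<le> 1) \<and>
        bag D u \<subseteq> covered H (cover D u))"

definition width :: "'v hypergraph \<Rightarrow> 'v decomp \<Rightarrow> real" where
  "width H D = Max ((\<lambda>u. weight H (cover D u)) ` nodes D)"

text \<open>The infimum is attained: up to the choice of the covers there are only finitely many
  relevant sets of bags, and an optimal cover of a bag is a solution of a linear program.
  So this is the minimum width.\<close>

definition fhw :: "'v hypergraph \<Rightarrow> real" where
  "fhw H = Inf {width H D | D. fhd H D}"


section \<open>Polynomial-time algorithms\<close>

text \<open>The machine model is the imperative WHILE language of N. D. Jones (Computability and
  Complexity from a Programming Perspective) over binary trees, with a time measure that charges
  for every operation the size of the values it handles. With that charge a program and a Turing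
  machine simulate each other with polynomial overhead.\<close>

datatype data = Atom | Pair data data

fun dsize :: "data \<Rightarrow> nat" where
  "dsize Atom = 1"
| "dsize (Pair a b) = dsize a + dsize b + 1"

fun dfst :: "data \<Rightarrow> data" where
  "dfst Atom = Atom"
| "dfst (Pair a b) = a"

fun dsnd :: "data \<Rightarrow> data" where
  "dsnd Atom = Atom"
| "dsnd (Pair a b) = b"

text \<open>\<open>Atom\<close> represents false, every other value is read as true.\<close>

definition dbool :: "bool \<Rightarrow> data" where
  "dbool b = (if b then Pair Atom Atom else Atom)"

datatype exp =
    EVar nat
  | EAtom
  | EPair exp exp
  | EFst exp
  | ESnd exp
  | EEq exp exp

type_synonym store = "nat \<Rightarrow> data"

fun eval :: "exp \<Rightarrow> store \<Rightarrow> data" where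
  "eval (EVar i) s = s i"
| "eval EAtom s = Atom"
| "eval (EPair a b) s = Pair (eval a s) (eval b s)"
| "eval (EFst a) s = dfst (eval a s)"
| "eval (ESnd a) s = dsnd (eval a s)"
| "eval (EEq a b) s = dbool (eval a s = eval b s)"

fun ecost :: "exp \<Rightarrow> store \<Rightarrow> nat" where
  "ecost (EVar i) s = dsize (s i)"
| "ecost EAtom s = 1"
| "ecost (EPair a b) s = ecost a s + ecost b s + dsize (eval (EPair a b) s)"
| "ecost (EFst a) s = ecost a s + dsize (eval (EFst a) s)"
| "ecost (ESnd a) s = ecost a s + dsize (eval (ESnd a) s)"
| "ecost (EEq a b) s = ecost a s + ecost b s + dsize (eval (EEq a b) s)"

datatype com =
    Skip
  | Assign nat exp
  | Seq com com
  | If exp com com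
  | While exp com

text \<open>\<open>exec c s t s'\<close>: started in store \<open>s\<close>, the program \<open>c\<close> halts in store \<open>s'\<close> after time \<open>t\<close>.\<close>

inductive exec :: "com \<Rightarrow> store \<Rightarrow> nat \<Rightarrow> store \<Rightarrow> bool" where
  exec_Skip: "exec Skip s 1 s"
| exec_Assign: "exec (Assign i e) s (ecost e s + 1) (s(i := eval e s))"
| exec_Seq: "exec c1 s t1 s1 \<Longrightarrow> exec c2 s1 t2 s2 \<Longrightarrow> exec (Seq c1 c2) s (t1 + t2 + 1) s2"
| exec_IfTrue: "eval e s \<noteq> Atom \<Longrightarrow> exec c1 s t s' \<Longrightarrow>
    exec (If e c1 c2) s (ecost e s + t + 1) s'"
| exec_IfFalse: "eval e s = Atom \<Longrightarrow> exec c2 s t s' \<Longrightarrow>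
    exec (If e c1 c2) s (ecost e s + t + 1) s'"
| exec_WhileTrue: "eval e s \<noteq> Atom \<Longrightarrow> exec c s t1 s1 \<Longrightarrow> exec (While e c) s1 t2 s2 \<Longrightarrow>
    exec (While e c) s (ecost e s + t1 + t2 + 1) s2"
| exec_WhileFalse: "eval e s = Atom \<Longrightarrow> exec (While e c) s (ecost e s + 1) s"

text \<open>Variable \<open>0\<close> holds the input and, at the end, the output. The time bound is required on
  every input, so a problem with a promise on its inputs constrains only the output of \<open>f\<close>.\<close>

definition polytime :: "(data \<Rightarrow> data) \<Rightarrow> bool" where
  "polytime f \<longleftrightarrow>
     (\<exists>(c :: com) (p :: nat poly). \<forall>x. \<exists>t s.
        exec c ((\<lambda>_. Atom)(0 := x)) t s \<and> s 0 = f x \<and> t \<le> poly p (dsize x))"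


section \<open>Representation of hypergraphs and decompositions as data\<close>

text \<open>Binary representation, least significant bit first.\<close>

fun enc_nat :: "nat \<Rightarrow> data" where
  "enc_nat n = (if n = 0 then Atom else Pair (dbool (odd n)) (enc_nat (n div 2)))"

declare enc_nat.simps [simp del]

fun enc_list :: "data list \<Rightarrow> data" where
  "enc_list [] = Atom"
| "enc_list (x # xs) = Pair x (enc_list xs)"

text \<open>\<open>repr_\<dots> a x\<close> means that \<open>x\<close> represents \<open>a\<close>. A finite set is listed without repetition in an
  arbitrary order, so it has several representations. A function is represented by its graph
  on a finite set.\<close>

definition repr_nat :: "nat \<Rightarrow> data \<Rightarrow> bool" where
  "repr_nat n x \<longleftrightarrow> x = enc_nat n"

definition repr_pair ::
    "('a \<Rightarrow> data \<Rightarrow> bool) \<Rightarrow> ('b \<Rightarrow> data \<Rightarrow> bool) \<Rightarrow> 'a \<times> 'b \<Rightarrow> data \<Rightarrow> bool" where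
  "repr_pair R Q p x \<longleftrightarrow> (\<exists>a b. x = Pair a b \<and> R (fst p) a \<and> Q (snd p) b)"

definition repr_set :: "('a \<Rightarrow> data \<Rightarrow> bool) \<Rightarrow> 'a set \<Rightarrow> data \<Rightarrow> bool" where
  "repr_set R S x \<longleftrightarrow>
     (\<exists>xs ys. distinct xs \<and> set xs = S \<and> list_all2 R xs ys \<and> x = enc_list ys)"

definition repr_map ::
    "('a \<Rightarrow> data \<Rightarrow> bool) \<Rightarrow> ('b \<Rightarrow> data \<Rightarrow> bool) \<Rightarrow> 'a set \<Rightarrow> ('a \<Rightarrow> 'b) \<Rightarrow> data \<Rightarrow> bool" where
  "repr_map R Q S f = repr_set (\<lambda>a. repr_pair R Q (a, f a)) S"

definition repr_fraction :: "real \<Rightarrow> data \<Rightarrow> bool" where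
  "repr_fraction q x \<longleftrightarrow>
     (\<exists>m n :: nat. n > 0 \<and> q = real m / real n \<and> repr_pair repr_nat repr_nat (m, n) x)"

definition repr_hypergraph :: "nat hypergraph \<Rightarrow> data \<Rightarrow> bool" where
  "repr_hypergraph H =
     repr_pair (repr_set repr_nat) (repr_set (repr_set repr_nat)) (verts H, edges H)"

text \<open>The weights of the covers are tabulated on all edges of \<open>H\<close>.\<close>

definition repr_decomp :: "nat hypergraph \<Rightarrow> nat decomp \<Rightarrow> data \<Rightarrow> bool" where
  "repr_decomp H D x \<longleftrightarrow>
     (\<exists>ns r as bs cs.
        x = enc_list [ns, r, as, bs, cs] \<and>
        repr_set repr_nat (nodes D) ns \<and>
        repr_nat (root D) r \<and>
        repr_set (repr_pair repr_nat repr_nat) (arcs D) as \<and>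
        repr_map repr_nat (repr_set repr_nat) (nodes D) (bag D) bs \<and>
        repr_map repr_nat (repr_map (repr_set repr_nat) repr_fraction (edges H))
          (nodes D) (cover D) cs)"

end

theory Submission
  imports Defs "HOL-Real_Asymp.Real_Asymp"
begin

text \<open>A bound on the VC-dimension of \<open>H\<close> bounds the VC-dimension of the dual set system, so by the
  \<open>\<epsilon>\<close>-net theorem every fractional edge cover of weight \<open>q\<close> can be replaced by an integral one of
  size \<open>K = O(q log q)\<close>. Hence \<open>fhw H \<le> k\<close> yields a tree decomposition all of whose bags are unions of
  parts of at most \<open>K\<close> edges. Such a decomposition contains, for every set \<open>W\<close> of at most \<open>2K + 1\<close> edges,
  a bag that separates \<open>W\<close> evenly; thus \<open>K\<close> edges suffice for a balanced separator and, \<open>K\<close> being constant,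
  one can be found by exhaustive search. Splitting recursively, with the boundary of each part covered by at most
  \<open>2K\<close> edges, gives a decomposition whose bags are covered by \<open>3K + 1\<close> edges. Each step puts a new
  vertex into a bag, so at most \<open>|V|\<close> steps are needed, and the nodes can be named after these
  vertices.\<close>

section \<open>Shatter functions and the dual VC-dimension\<close>

text \<open>The VC-dimension enters only through existence: it guarantees that small separators
  exist, while the program merely searches and knows nothing but K. The separator that it finds need
  not come from a bag of the witnessing decomposition; only its balance is used. The counts close up
  because a boundary of 2K edges and one edge at a new vertex form a set of 2K + 1 edges: balance
  leaves at most K of them at each part, and the K edges of the separator bring the boundary back to
  2K.

  K is computed from k + 1 instead of k. As \<open>fhw\<close> is an infimum,
  \<open>fhw H \<le> k\<close> yields a decomposition of width below k + 1, whether or not the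
  infimum is attained; moreover ln (k + 1) stays away from 0 at k = 1.

  On the machine side the time bound must hold on every input, including trees that represent no
  hypergraph and hypergraphs that break the promise. Hence every operation is total, and the growth
  of the data is controlled without any appeal to correctness.\<close>

definition traces_all :: "'a set set \<Rightarrow> 'a set \<Rightarrow> bool" where
  "traces_all F S \<longleftrightarrow> (\<inter>) S ` F = Pow S"

text \<open>Pajor's form of the Sauer-Shelah lemma, by splitting at a point x: \<open>F0\<close>
  holds the members without x, \<open>F1\<close> those with x after its removal, and card F is card
  (F0 \<union> F1) + card (F0 \<inter> F1). A set shattered by the union is shattered by F, and one
  shattered by the intersection remains so after x is added to it. Arbitrary families are treated
  because the application is to the dual system, whose points are edges.\<close>

lemma card_le_card_shattered:
  assumes "finite X" "F \<subseteq> Pow X"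
  shows "card F \<le> card {S. S \<subseteq> X \<and> traces_all F S}"
  using assms
proof (induction X arbitrary: F rule: finite_induct)
  case empty
  then consider "F = {}" | "F = {{}}" by auto
  then show ?case
  proof cases
    case 2
    then have "{} \<in> {S. S \<subseteq> {} \<and> traces_all F S}" by (simp add: traces_all_def)
    moreover have "finite {S. S \<subseteq> {} \<and> traces_all F S}" by simp
    ultimately have "0 < card {S. S \<subseteq> {} \<and> traces_all F S}" using card_gt_0_iff by blast
    then show ?thesis using 2 by simp
  qed simp
next
  case (insert x X)
  define F0 where "F0 = {A \<in> F. x \<notin> A}"
  define F1 where "F1 = (\<lambda>A. A - {x}) ` {A \<in> F. x \<in> A}"
  let ?P = "{S. S \<subseteq> X \<and> traces_all (F0 \<union> F1) S}"
  let ?Q = "{S. S \<subseteq> X \<and> traces_all (F0 \<inter> F1) S}"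
  have fin: "finite F" using insert.hyps insert.prems by (meson finite_Pow_iff finite_insert finite_subset)
  have F0: "F0 \<subseteq> Pow X" "F1 \<subseteq> Pow X" using insert.prems unfolding F0_def F1_def by auto
  have finF: "finite F0" "finite F1" using fin unfolding F0_def F1_def by auto
  have inj: "inj_on (\<lambda>A. A - {x}) {A \<in> F. x \<in> A}" by (rule inj_onI) blast
  have "F = F0 \<union> {A \<in> F. x \<in> A}" unfolding F0_def by blast
  then have "card F = card (F0 \<union> {A \<in> F. x \<in> A})" by (rule arg_cong)
  also have "\<dots> = card F0 + card {A \<in> F. x \<in> A}"
    using fin unfolding F0_def by (intro card_Un_disjoint) auto
  also have "\<dots> = card F0 + card F1"
    unfolding F1_def by (simp add: card_image inj)
  also have "\<dots> = card (F0 \<union> F1) + card (F0 \<inter> F1)"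
    using finF by (rule card_Un_Int)
  also have "\<dots> \<le> card ?P + card ?Q"
    using F0 by (intro add_mono insert.IH) auto
  finally have 1: "card F \<le> card ?P + card ?Q" .
  have 2: "card ?Q = card (Set.insert x ` ?Q)"
  proof (intro card_image[symmetric] inj_onI)
    fix S T assume "S \<in> ?Q" "T \<in> ?Q" and eq: "Set.insert x S = Set.insert x T"
    then have "x \<notin> S" "x \<notin> T" using insert.hyps by auto
    then show "S = T" using eq by (simp add: insert_ident)
  qed
  have 3: "card ?P + card (Set.insert x ` ?Q) = card (?P \<union> Set.insert x ` ?Q)"
    using insert.hyps by (intro card_Un_disjoint[symmetric]) auto
  have 4: "card (?P \<union> Set.insert x ` ?Q) \<le> card {S. S \<subseteq> Set.insert x X \<and> traces_all F S}"
  proof (rule card_mono)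
    show "finite {S. S \<subseteq> Set.insert x X \<and> traces_all F S}" using insert.hyps by simp
    have "traces_all F S" if S: "S \<subseteq> X" "traces_all (F0 \<union> F1) S" for S
    proof -
      have xS: "x \<notin> S" using S insert.hyps by blast
      have "(\<inter>) S ` F1 = (\<inter>) S ` {A \<in> F. x \<in> A}"
        unfolding F1_def image_image using xS by (intro image_cong) auto
      then have "(\<inter>) S ` (F0 \<union> F1) = (\<inter>) S ` F" unfolding image_Un F0_def by blast
      then show ?thesis using S unfolding traces_all_def by simp
    qed
    moreover have "traces_all F (Set.insert x S)" if S: "S \<subseteq> X" "traces_all (F0 \<inter> F1) S" for S
      unfolding traces_all_def
    proof
      show "(\<inter>) (Set.insert x S) ` F \<subseteq> Pow (Set.insert x S)" by blast
      show "Pow (Set.insert x S) \<subseteq> (\<inter>) (Set.insert x S) ` F"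
      proof
        fix T assume T: "T \<in> Pow (Set.insert x S)"
        have xS: "x \<notin> S" using S insert.hyps by blast
        have "T - {x} \<in> (\<inter>) S ` (F0 \<inter> F1)" using S T unfolding traces_all_def by blast
        then obtain A where A: "A \<in> F0" "A \<in> F1" "S \<inter> A = T - {x}" by blast
        obtain B where B: "B \<in> F" "x \<in> B" "A = B - {x}" using A unfolding F1_def by blast
        show "T \<in> (\<inter>) (Set.insert x S) ` F"
        proof (cases "x \<in> T")
          case True
          then have "T = Set.insert x S \<inter> B" using A B by blast
          then show ?thesis using B by blast
        next
          case False
          then have "T = Set.insert x S \<inter> A" using A(1,3) unfolding F0_def by blast
          then show ?thesis using A unfolding F0_def by blast
        qed
      qed
    qed
    ultimately show "?P \<union> Set.insert x ` ?Q \<subseteq> {S. S \<subseteq> Set.insert x X \<and> traces_all F S}"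
      by (intro Un_least subsetI) auto
  qed
  show ?case using 1 2 3 4 by linarith
qed

text \<open>Padding with \<open>None\<close> turns a small subset into a list of length exactly D,
  so counting lists suffices. The crude bound replaces the usual sum of binomials, since only its
  being polynomial with exponent D matters later.\<close>

lemma card_small_subsets_le:
  assumes "finite X"
  shows "card {S. S \<subseteq> X \<and> card S \<le> D} \<le> (card X + 1) ^ D"
proof -
  let ?Y = "insert None (Some ` X)"
  let ?L = "{xs. set xs \<subseteq> ?Y \<and> length xs = D}"
  have cY: "card ?Y = card X + 1"
    using assms by (subst card_insert_disjoint) (auto simp: card_image)
  have "{S. S \<subseteq> X \<and> card S \<le> D} \<subseteq> (\<lambda>xs. {a. Some a \<in> set xs}) ` ?L"
  proof
    fix S assume "S \<in> {S. S \<subseteq> X \<and> card S \<le> D}"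
    then have S: "S \<subseteq> X" "card S \<le> D" by auto
    then have "finite S" using assms finite_subset by blast
    then obtain ys where ys: "set ys = S" "distinct ys" using finite_distinct_list by blast
    then have l: "length ys \<le> D" using S distinct_card by metis
    let ?xs = "map Some ys @ replicate (D - length ys) None"
    have "?xs \<in> ?L" using ys S l by auto
    moreover have "S = {a. Some a \<in> set ?xs}" using ys by auto
    ultimately show "S \<in> (\<lambda>xs. {a. Some a \<in> set xs}) ` ?L" by blast
  qed
  moreover have fin: "finite ?L" using assms by (intro finite_lists_length_eq) simp
  ultimately have "card {S. S \<subseteq> X \<and> card S \<le> D} \<le> card ?L"
    by (meson card_image_le card_mono finite_imageI le_trans)
  also have "\<dots> = (card X + 1) ^ D"
    using card_lists_length_eq[of ?Y D] assms cY by simp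
  finally show ?thesis .
qed

lemma sauer_shelah:
  assumes "finite X" "F \<subseteq> Pow X" "\<And>S. S \<subseteq> X \<Longrightarrow> traces_all F S \<Longrightarrow> card S \<le> D"
  shows "card F \<le> (card X + 1) ^ D"
proof -
  have "card F \<le> card {S. S \<subseteq> X \<and> traces_all F S}"
    using assms(1,2) by (rule card_le_card_shattered)
  also have "\<dots> \<le> card {S. S \<subseteq> X \<and> card S \<le> D}"
    using assms by (intro card_mono) auto
  also have "\<dots> \<le> (card X + 1) ^ D" using assms(1) by (rule card_small_subsets_le)
  finally show ?thesis .
qed

lemma shattered_card_le_vc_dim:
  assumes "hypergraph H" "shattered H X"
  shows "card X \<le> vc_dim H"
proof -
  have "{X. shattered H X} \<subseteq> Pow (verts H)" unfolding shattered_def by blast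
  then have "finite {X. shattered H X}"
    using assms(1) unfolding hypergraph_def by (meson finite_Pow_iff finite_subset)
  then show ?thesis unfolding vc_dim_def using assms(2) by (intro Max_ge) auto
qed

lemma hypergraph_finite_edges:
  assumes "hypergraph H"
  shows "finite (edges H)"
proof -
  have "edges H \<subseteq> Pow (verts H)" using assms unfolding hypergraph_def by blast
  then show ?thesis using assms unfolding hypergraph_def by (meson finite_Pow_iff finite_subset)
qed

text \<open>Assouad's bound: a set of \<open>2 ^ n\<close> edges that is shattered by the vertices can be indexed
  by the subsets of an \<open>n\<close>-set, and the vertices selected by membership are shattered.\<close>

lemma dual_shattered_card_less:
  assumes H: "hypergraph H" and d: "vc_dim H \<le> d"
    and S: "S \<subseteq> edges H" "traces_all ((\<lambda>v. {e \<in> S. v \<in> e}) ` verts H) S"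
  shows "card S < 2 ^ Suc d"
proof (rule ccontr)
  assume "\<not> card S < 2 ^ Suc d"
  \<comment> \<open>The index set \<open>{..d}\<close> has d + 1 elements, so shattering its image
    under an injection contradicts VC-dimension at most d.\<close>
  then have "card (Pow {..d}) \<le> card S" by (simp add: card_Pow)
  moreover have "finite S" using S(1) hypergraph_finite_edges[OF H] finite_subset by blast
  ultimately obtain f where f: "inj_on f (Pow {..d})" "f ` Pow {..d} \<subseteq> S"
    using card_le_inj[of "Pow {..d}" S] by auto
  have "\<exists>v\<in>verts H. {e \<in> S. v \<in> e} = f ` {J \<in> Pow {..d}. i \<in> J}" for i
  proof -
    have "f ` {J \<in> Pow {..d}. i \<in> J} \<in> Pow S" using f(2) by blast
    then have "f ` {J \<in> Pow {..d}. i \<in> J} \<in> (\<inter>) S ` (\<lambda>v. {e \<in> S. v \<in> e}) ` verts H"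
      using S(2) unfolding traces_all_def by simp
    then show ?thesis by auto
  qed
  then obtain v where v: "\<And>i. v i \<in> verts H" "\<And>i. {e \<in> S. v i \<in> e} = f ` {J \<in> Pow {..d}. i \<in> J}"
    by metis
  have mem: "v i \<in> f J \<longleftrightarrow> i \<in> J" if "J \<subseteq> {..d}" for i J
  proof -
    have "f J \<in> S" using f(2) that by blast
    then have "v i \<in> f J \<longleftrightarrow> f J \<in> f ` {J \<in> Pow {..d}. i \<in> J}" using v(2)[of i] by blast
    also have "\<dots> \<longleftrightarrow> J \<in> {J \<in> Pow {..d}. i \<in> J}"
      using that by (intro inj_on_image_mem_iff[OF f(1)]) auto
    also have "\<dots> \<longleftrightarrow> i \<in> J" using that by simp
    finally show ?thesis .
  qed
  have inj: "inj_on v {..d}"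
  proof (rule inj_onI)
    fix i j assume ij: "i \<in> {..d}" "j \<in> {..d}" "v i = v j"
    have "{i} \<subseteq> {..d}" using ij(1) by blast
    from mem[OF this, of i] mem[OF this, of j] ij(3) show "i = j" by (metis singletonD singletonI)
  qed
  have "shattered H (v ` {..d})" unfolding shattered_def
  proof (intro conjI equalityI subsetI)
    fix x assume "x \<in> v ` {..d}" then show "x \<in> verts H" using v(1) by blast
  next
    fix T assume "T \<in> (\<lambda>e. v ` {..d} \<inter> e) ` edges H" then show "T \<in> Pow (v ` {..d})" by blast
  next
    fix T assume "T \<in> Pow (v ` {..d})"
    then obtain J where J: "J \<subseteq> {..d}" "T = v ` J" by (meson PowD subset_imageE)
    have "T = v ` {..d} \<inter> f J" using mem[OF J(1)] J by blast
    moreover have "f J \<in> edges H" using f(2) S(1) J by blast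
    ultimately show "T \<in> (\<lambda>e. v ` {..d} \<inter> e) ` edges H" by blast
  qed
  then have "card (v ` {..d}) \<le> vc_dim H" using shattered_card_le_vc_dim H by blast
  then show False using d inj by (simp add: card_image)
qed

text \<open>In the net argument the points are edges and the ranges are the sets of edges through a
  vertex. This is the growth function of that dual system: polynomial, with an exponent that depends
  on d alone.\<close>

lemma card_vertex_traces_le:
  assumes H: "hypergraph H" and d: "vc_dim H \<le> d" and X: "X \<subseteq> edges H"
  shows "card ((\<lambda>v. {e \<in> X. v \<in> e}) ` verts H) \<le> (card X + 1) ^ (2 ^ Suc d)"
proof (rule sauer_shelah)
  show "finite X" using X hypergraph_finite_edges[OF H] finite_subset by blast
  fix S assume S: "S \<subseteq> X" "traces_all ((\<lambda>v. {e \<in> X. v \<in> e}) ` verts H) S"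
  have "(\<inter>) S ` (\<lambda>v. {e \<in> S. v \<in> e}) ` verts H = (\<inter>) S ` (\<lambda>v. {e \<in> X. v \<in> e}) ` verts H"
    unfolding image_image using S(1) by (intro image_cong) auto
  then have "traces_all ((\<lambda>v. {e \<in> S. v \<in> e}) ` verts H) S"
    using S(2) unfolding traces_all_def by simp
  from dual_shattered_card_less[OF H d _ this] show "card S \<le> 2 ^ Suc d"
    using S(1) X by (meson less_imp_le subset_trans)
qed auto

section \<open>Epsilon-nets and integral covers\<close>

abbreviation lists_of :: "'a set \<Rightarrow> nat \<Rightarrow> 'a list set" where
  "lists_of E m \<equiv> {xs. set xs \<subseteq> E \<and> length xs = m}"

text \<open>Probability is replaced by finite weighted sums: a sample of m independent points is a
  list of length m, and its probability is the product of the weights. The identity gives the total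
  mass as well as the exponential moments.\<close>

lemma sum_prod_list_lists_of:
  fixes f :: "'a \<Rightarrow> real"
  assumes "finite E"
  shows "(\<Sum>xs\<in>lists_of E m. prod_list (map f xs)) = (\<Sum>e\<in>E. f e) ^ m"
proof (induction m)
  case 0
  have "lists_of E 0 = {[]}" by auto
  then show ?case by simp
next
  case (Suc m)
  have "(\<Sum>xs\<in>lists_of E (Suc m). prod_list (map f xs))
      = (\<Sum>p\<in>lists_of E m \<times> E. f (snd p) * prod_list (map f (fst p)))"
    unfolding lists_length_Suc_eq
    by (subst sum.reindex) (auto simp: inj_on_def case_prod_unfold)
  also have "\<dots> = (\<Sum>xs\<in>lists_of E m. \<Sum>e\<in>E. f e * prod_list (map f xs))"
    by (simp add: sum.cartesian_product case_prod_unfold)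
  also have "\<dots> = (\<Sum>xs\<in>lists_of E m. prod_list (map f xs)) * (\<Sum>e\<in>E. f e)"
    unfolding sum_product by (simp add: mult.commute)
  finally show ?case using Suc.IH by simp
qed

lemma prod_list_map_nonneg:
  fixes f :: "'a \<Rightarrow> real"
  assumes "\<And>e. e \<in> set xs \<Longrightarrow> 0 \<le> f e"
  shows "0 \<le> prod_list (map f xs)"
  using assms by (induction xs) auto

lemma prod_list_map_half:
  fixes f :: "'a \<Rightarrow> real"
  shows "prod_list (map (\<lambda>e. f e * (if e \<in> R then 1/2 else 1)) xs) =
    prod_list (map f xs) * (1/2) ^ length (filter (\<lambda>e. e \<in> R) xs)"
  by (induction xs) auto

text \<open>The expression is (2/e)^y, which decreases and equals 8/e^3 < 1/2 at y = 3. This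
  explains the constant 6 in the requirement on \<epsilon> m: the tail bound uses y = \<epsilon> m /
  2.\<close>

lemma two_powr_exp_le_half:
  fixes y :: real
  assumes "3 \<le> y"
  shows "2 powr y * exp (- y) \<le> 1/2"
proof -
  \<comment> \<open>Already 1 + 3/4 + 9/32 exceeds 2. The resulting ln 2 \<le> 3/4 is exactly what
    ln 2 \<le> 3 (1 - ln 2) demands.\<close>
  have "2 \<le> exp (3/4 :: real)"
    using exp_lower_Taylor_quadratic[of "3/4 :: real"] by (simp add: power2_eq_square)
  then have l: "ln 2 \<le> (3/4 :: real)" using ln_le_cancel_iff[of 2 "exp (3/4 :: real)"] by simp
  have "3 * (1 - ln 2) \<le> y * (1 - ln 2 :: real)" using assms l by (intro mult_right_mono) auto
  moreover have "ln 2 \<le> 3 * (1 - ln 2 :: real)" using l by simp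
  ultimately have "ln 2 \<le> y * (1 - ln 2 :: real)" by (rule order_trans[rotated])
  then have "exp (y * ln 2 - y) \<le> exp (- ln 2 :: real)" by (simp add: algebra_simps)
  then show ?thesis by (simp add: powr_def exp_diff exp_minus field_simps)
qed

text \<open>The lower tail is bounded by the exponential moment with base \<open>1/2\<close>, which factorises over
  the independent samples.\<close>

lemma sample_hits_often:
  fixes \<mu> :: "'e \<Rightarrow> real"
  assumes E: "finite E" and nn: "\<And>e. e \<in> E \<Longrightarrow> 0 \<le> \<mu> e" and one: "sum \<mu> E = 1"
    and eps: "\<epsilon> \<le> sum \<mu> (E \<inter> R)" and m: "6 \<le> \<epsilon> * real m"
  shows "1/2 \<le> (\<Sum>ys\<in>lists_of E m. prod_list (map \<mu> ys) *
    of_bool (\<epsilon> * real m / 2 \<le> real (length (filter (\<lambda>e. e \<in> R) ys))))"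
    (is "_ \<le> (\<Sum>ys\<in>?L. ?W ys * of_bool (?P ys))")
proof -
  let ?t = "\<epsilon> * real m / 2"
  let ?c = "\<lambda>ys. length (filter (\<lambda>e. e \<in> R) ys)"
  have nW: "0 \<le> ?W ys" if "ys \<in> ?L" for ys
    using that nn by (intro prod_list_map_nonneg) auto
  have e1: "\<epsilon> \<le> 1"
    using eps one sum_mono2[OF E, of "E \<inter> R" \<mu>] nn by auto
  have "(\<Sum>ys\<in>?L. ?W ys * of_bool (\<not> ?P ys)) \<le> (\<Sum>ys\<in>?L. 2 powr ?t * (?W ys * (1/2) ^ ?c ys))"
  proof (rule sum_mono)
    fix ys assume ys: "ys \<in> ?L"
    have "of_bool (\<not> ?P ys) \<le> 2 powr ?t * (1/2 :: real) ^ ?c ys"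
    proof (cases "?P ys")
      case False
      \<comment> \<open>Markov's inequality in pointwise form: with fewer than t hits the exponent
        is positive, so the power dominates the indicator.\<close>
      have "1 \<le> (2::real) powr (?t - real (?c ys))" using False by (intro ge_one_powr_ge_zero) auto
      also have "\<dots> = 2 powr ?t * (1/2) ^ ?c ys"
        by (simp add: powr_diff powr_realpow power_divide)
      finally show ?thesis using False by simp
    qed simp
    then have "?W ys * of_bool (\<not> ?P ys) \<le> ?W ys * (2 powr ?t * (1/2 :: real) ^ ?c ys)"
      using nW[OF ys] by (rule mult_left_mono)
    then show "?W ys * of_bool (\<not> ?P ys) \<le> 2 powr ?t * (?W ys * (1/2) ^ ?c ys)"
      by (simp add: mult.left_commute)
  qed
  also have "\<dots> = 2 powr ?t * (\<Sum>e\<in>E. \<mu> e * (if e \<in> R then 1/2 else 1)) ^ m"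
    by (simp add: sum_distrib_left[symmetric] prod_list_map_half[symmetric] sum_prod_list_lists_of[OF E])
  also have "(\<Sum>e\<in>E. \<mu> e * (if e \<in> R then 1/2 else 1)) = (\<Sum>e\<in>E. \<mu> e - (if e \<in> R then \<mu> e else 0) / 2)"
    by (intro sum.cong) auto
  also have "\<dots> = 1 - sum \<mu> (E \<inter> R) / 2"
    using E one by (simp add: sum_subtractf sum_divide_distrib[symmetric] sum.inter_restrict)
  also have "2 powr ?t * (1 - sum \<mu> (E \<inter> R) / 2) ^ m \<le> 2 powr ?t * exp (- \<epsilon> / 2) ^ m"
  proof (intro mult_left_mono power_mono)
    have "1 - sum \<mu> (E \<inter> R) / 2 \<le> 1 + (- \<epsilon> / 2)" using eps by simp
    also have "\<dots> \<le> exp (- \<epsilon> / 2)" by (rule exp_ge_add_one_self)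
    finally show "1 - sum \<mu> (E \<inter> R) / 2 \<le> exp (- \<epsilon> / 2)" .
    have "sum \<mu> (E \<inter> R) \<le> 1" using one sum_mono2[OF E, of "E \<inter> R" \<mu>] nn by auto
    then show "0 \<le> 1 - sum \<mu> (E \<inter> R) / 2" by simp
  qed simp
  also have "exp (- \<epsilon> / 2) ^ m = exp (- ?t)" by (simp add: exp_of_nat_mult[symmetric] mult.commute)
  also have "2 powr ?t * exp (- ?t) \<le> 1/2" using m by (intro two_powr_exp_le_half) simp
  finally have "(\<Sum>ys\<in>?L. ?W ys * of_bool (\<not> ?P ys)) \<le> 1/2" .
  moreover have "(\<Sum>ys\<in>?L. ?W ys * of_bool (\<not> ?P ys)) + (\<Sum>ys\<in>?L. ?W ys * of_bool (?P ys)) = (\<Sum>ys\<in>?L. ?W ys)"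
    unfolding sum.distrib[symmetric] by (intro sum.cong) auto
  moreover have "(\<Sum>ys\<in>?L. ?W ys) = 1" using sum_prod_list_lists_of[OF E, of \<mu> m] one by simp
  ultimately show ?thesis by linarith
qed

section \<open>Symmetrisation: exchanging two samples coordinate by coordinate\<close>

definition swap_along :: "bool list \<Rightarrow> ('a \<times> 'a) list \<Rightarrow> ('a \<times> 'a) list" where
  "swap_along s zs = map2 (\<lambda>b z. if b then prod.swap z else z) s zs"

lemma swap_along_Cons [simp]:
  "swap_along (b # s) (z # zs) = (if b then prod.swap z else z) # swap_along s zs"
  by (simp add: swap_along_def)

lemma swap_along_Nil [simp]: "swap_along [] zs = []" "swap_along s [] = []"
  by (auto simp: swap_along_def)

text \<open>Each swap pattern is a weight-preserving involution on pairs of samples, so a sum over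
  all pairs may be reindexed along it.\<close>

lemma swap_along_props:
  assumes "length s = length zs"
  shows "length (swap_along s zs) = length zs"
    and "swap_along s (swap_along s zs) = zs"
    and "set zs \<subseteq> E \<times> E \<Longrightarrow> set (swap_along s zs) \<subseteq> E \<times> E"
    and "prod_list (map (\<lambda>z. f (fst z) * f (snd z)) (swap_along s zs))
       = prod_list (map (\<lambda>z. f (fst z) * f (snd z :: 'a) :: real) zs)"
  using assms by (induction s zs rule: list_induct2) (auto split: if_splits)

text \<open>Swapping brings in no new points, so whatever happens under any pattern depends on a
  range only through its trace on the two original samples.\<close>

lemma set_swap_along:
  assumes "length s = length zs" "z \<in> set (swap_along s zs)"
  shows "fst z \<in> fst ` set zs \<union> snd ` set zs" "snd z \<in> fst ` set zs \<union> snd ` set zs"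
  using assms by (induction s zs rule: list_induct2) (auto split: if_splits)

text \<open>A pair with exactly one entry in \<open>T\<close> must be oriented, and one with both entries in \<open>T\<close>
  excludes the event.\<close>

lemma sum_swaps_le:
  fixes zs :: "('a \<times> 'a) list"
  shows "(\<Sum>s\<in>lists_of UNIV (length zs).
      if \<forall>z\<in>set (swap_along s zs). fst z \<notin> T
      then 2 ^ length (filter (\<lambda>z. snd z \<in> T) (swap_along s zs)) else (0::real)) \<le> 2 ^ length zs"
proof (induction zs)
  case Nil
  have "lists_of (UNIV :: bool set) (length ([] :: ('a \<times> 'a) list)) = {[]}" by auto
  then show ?case by simp
next
  case (Cons z zs)
  let ?g = "\<lambda>s zs. if \<forall>z\<in>set (swap_along s zs). fst z \<notin> T
      then 2 ^ length (filter (\<lambda>z. snd z \<in> T) (swap_along s zs)) else (0::real)"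
  \<comment> \<open>The factor of one oriented pair: 0 if it violates the event, 2 if it adds a hit,
    1 otherwise.\<close>
  let ?h = "\<lambda>z. if fst z \<in> T then 0 else if snd z \<in> T then 2 else (1::real)"
  have "(\<Sum>s\<in>lists_of UNIV (length (z # zs)). ?g s (z # zs))
      = (\<Sum>p\<in>lists_of UNIV (length zs) \<times> UNIV. ?g (snd p # fst p) (z # zs))"
    unfolding length_Cons lists_length_Suc_eq
    by (subst sum.reindex) (auto simp: inj_on_def case_prod_unfold)
  also have "\<dots> = (\<Sum>p\<in>lists_of UNIV (length zs) \<times> UNIV. ?g (fst p) zs * ?h (if snd p then prod.swap z else z))"
    by (intro sum.cong refl) auto
  also have "\<dots> = (\<Sum>s\<in>lists_of UNIV (length zs). \<Sum>b\<in>UNIV. ?g s zs * ?h (if b then prod.swap z else z))"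
    by (simp only: sum.cartesian_product case_prod_unfold)
  also have "\<dots> = (\<Sum>s\<in>lists_of UNIV (length zs). ?g s zs * (?h (prod.swap z) + ?h z))"
    by (intro sum.cong refl) (simp add: UNIV_bool distrib_left)
  \<comment> \<open>The two orientations together contribute 0 + 0, 0 + 2 or 1 + 1, according to
    whether two, one or none of the entries lie in \<open>T\<close>.\<close>
  also have "\<dots> \<le> (\<Sum>s\<in>lists_of UNIV (length zs). ?g s zs * 2)"
    by (intro sum_mono mult_left_mono) auto
  also have "\<dots> \<le> 2 ^ length (z # zs)"
    using Cons.IH by (simp add: sum_distrib_right[symmetric])
  finally show ?case .
qed

text \<open>If every sample missed some \<open>R v\<close>, then with probability at least one half a second sample
  would hit the missed set about as often as expected; swapping the samples coordinatewise shows
  that this is too unlikely, as only the traces on the two samples matter.\<close>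

theorem epsilon_net:
  fixes \<mu> :: "'e \<Rightarrow> real" and R :: "'v \<Rightarrow> 'e set"
  assumes E: "finite E" and nn: "\<And>e. e \<in> E \<Longrightarrow> 0 \<le> \<mu> e" and one: "sum \<mu> E = 1"
    and eps: "\<And>v. v \<in> B \<Longrightarrow> \<epsilon> \<le> sum \<mu> (E \<inter> R v)" and m: "6 \<le> \<epsilon> * real m"
    and tr: "\<And>X. X \<subseteq> E \<Longrightarrow> card X \<le> 2 * m \<Longrightarrow> real (card ((\<lambda>v. X \<inter> R v) ` B)) \<le> \<Phi>"
    and \<Phi>: "2 * \<Phi> < 2 powr (\<epsilon> * real m / 2)"
  shows "\<exists>xs\<in>lists_of E m. \<forall>v\<in>B. set xs \<inter> R v \<noteq> {}"
proof (rule ccontr)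
  assume "\<not> ?thesis"
  then have "\<forall>xs\<in>lists_of E m. \<exists>v. v \<in> B \<and> set xs \<inter> R v = {}" by blast
  then obtain miss where "\<forall>xs\<in>lists_of E m. miss xs \<in> B \<and> set xs \<inter> R (miss xs) = {}"
    using bchoice[of "lists_of E m" "\<lambda>xs v. v \<in> B \<and> set xs \<inter> R v = {}"] by blast
  then have miss: "miss xs \<in> B" "set xs \<inter> R (miss xs) = {}" if "xs \<in> lists_of E m" for xs
    using that by simp_all
  let ?t = "\<epsilon> * real m / 2"
  let ?L = "lists_of E m" let ?L2 = "lists_of (E \<times> E) m" let ?S = "lists_of (UNIV :: bool set) m"
  let ?W = "\<lambda>xs. prod_list (map \<mu> xs)"
  let ?W2 = "\<lambda>zs. prod_list (map (\<lambda>z. \<mu> (fst z) * \<mu> (snd z)) zs)"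
  \<comment> \<open>The double sampling event, phrased for a list of pairs so that swap patterns can
    act on it.\<close>
  define bad where "bad zs \<longleftrightarrow> (\<exists>v\<in>B. (\<forall>z\<in>set zs. fst z \<notin> R v) \<and>
      ?t \<le> real (length (filter (\<lambda>z. snd z \<in> R v) zs)))" for zs
  have nW: "0 \<le> ?W xs" if "xs \<in> ?L" for xs
    using that nn by (intro prod_list_map_nonneg) auto
  have nW2: "0 \<le> ?W2 zs" if "zs \<in> ?L2" for zs
    using that nn by (intro prod_list_map_nonneg) (auto intro!: mult_nonneg_nonneg)
  have W1: "(\<Sum>xs\<in>?L. ?W xs) = 1" using sum_prod_list_lists_of[OF E, of \<mu> m] one by simp
  have W2: "(\<Sum>zs\<in>?L2. ?W2 zs) = 1"
  proof -
    have "(\<Sum>z\<in>E \<times> E. \<mu> (fst z) * \<mu> (snd z)) = 1"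
      using one sum_product[of \<mu> E \<mu> E] by (simp add: sum.cartesian_product case_prod_unfold)
    then show ?thesis using sum_prod_list_lists_of[of "E \<times> E" "\<lambda>z. \<mu> (fst z) * \<mu> (snd z)" m] E by simp
  qed
  have Wzip: "?W2 (zip xs ys) = ?W xs * ?W ys" if "length xs = length ys" for xs ys
    using that by (induction xs ys rule: list_induct2) auto
  \<comment> \<open>Once the first sample is fixed, so is the range that it misses; an independent
    second sample hits this range often with probability at least 1/2.\<close>
  have "1/2 = (\<Sum>xs\<in>?L. ?W xs * (1/2))" using W1 by (simp add: sum_divide_distrib[symmetric])
  also have "\<dots> \<le> (\<Sum>xs\<in>?L. ?W xs * (\<Sum>ys\<in>?L. ?W ys *
      of_bool (?t \<le> real (length (filter (\<lambda>e. e \<in> R (miss xs)) ys)))))"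
    using sample_hits_often[OF E nn one eps m] miss(1) nW by (intro sum_mono mult_left_mono) auto
  also have "\<dots> \<le> (\<Sum>xs\<in>?L. \<Sum>ys\<in>?L. ?W2 (zip xs ys) * of_bool (bad (zip xs ys)))"
    unfolding sum_distrib_left
  proof (intro sum_mono)
    fix xs ys assume xy: "xs \<in> ?L" "ys \<in> ?L"
    have len: "length (filter (\<lambda>z. snd z \<in> A) (zip xs ys)) = length (filter (\<lambda>e. e \<in> A) ys)" for A
    proof -
      have "filter (\<lambda>e. e \<in> A) ys = filter (\<lambda>e. e \<in> A) (map snd (zip xs ys))" using xy by simp
      then show ?thesis by (simp add: filter_map o_def)
    qed
    have "of_bool (?t \<le> real (length (filter (\<lambda>e. e \<in> R (miss xs)) ys))) \<le> (of_bool (bad (zip xs ys)) :: real)"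
      unfolding bad_def using miss[OF xy(1)] len
      by (auto simp: of_bool_def dest!: set_zip_leftD intro!: bexI[of _ "miss xs"])
    then have "?W2 (zip xs ys) * of_bool (?t \<le> real (length (filter (\<lambda>e. e \<in> R (miss xs)) ys)))
      \<le> ?W2 (zip xs ys) * of_bool (bad (zip xs ys))"
      using Wzip[of xs ys] xy nW by (intro mult_left_mono) auto
    then show "?W xs * (?W ys * of_bool (?t \<le> real (length (filter (\<lambda>e. e \<in> R (miss xs)) ys))))
      \<le> ?W2 (zip xs ys) * of_bool (bad (zip xs ys))"
      using Wzip[of xs ys] xy by (simp add: mult.assoc)
  qed
  also have "\<dots> = (\<Sum>p\<in>?L \<times> ?L. ?W2 (zip (fst p) (snd p)) * of_bool (bad (zip (fst p) (snd p))))"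
    by (simp only: sum.cartesian_product case_prod_unfold)
  also have "\<dots> = (\<Sum>zs\<in>?L2. ?W2 zs * of_bool (bad zs))"
    by (rule sum.reindex_bij_witness[where i = "\<lambda>zs. (map fst zs, map snd zs)" and j = "\<lambda>p. zip (fst p) (snd p)"])
      (auto simp: zip_map_fst_snd, (meson set_zip_leftD set_zip_rightD subsetD)+)
  finally have half: "1/2 \<le> (\<Sum>zs\<in>?L2. ?W2 zs * of_bool (bad zs))" .
  have cS: "card ?S = 2 ^ m" using card_lists_length_eq[of "UNIV :: bool set" m] by simp
  \<comment> \<open>Every pattern leaves the total weight of the event unchanged, so the event can
    be averaged over all \<open>2 ^ m\<close> patterns. Exchanging the sums then fixes the pairs and
    makes the pattern the random object.\<close>
  have "2 ^ m * (1/2) \<le> (\<Sum>s\<in>?S. \<Sum>zs\<in>?L2. ?W2 zs * of_bool (bad zs))"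
    using half cS by (simp add: mult_left_mono)
  also have "\<dots> = (\<Sum>s\<in>?S. \<Sum>zs\<in>?L2. ?W2 zs * of_bool (bad (swap_along s zs)))"
  proof (rule sum.cong[OF refl])
    fix s assume s: "s \<in> ?S"
    show "(\<Sum>zs\<in>?L2. ?W2 zs * of_bool (bad zs)) = (\<Sum>zs\<in>?L2. ?W2 zs * of_bool (bad (swap_along s zs)))"
    proof (rule sum.reindex_bij_witness[where i = "swap_along s" and j = "swap_along s"])
      fix zs assume zs: "zs \<in> ?L2"
      then have l: "length s = length zs" using s by simp
      show "swap_along s (swap_along s zs) = zs" "swap_along s (swap_along s zs) = zs"
        "swap_along s zs \<in> ?L2" "swap_along s zs \<in> ?L2"
        using swap_along_props[OF l] zs by auto
      show "?W2 (swap_along s zs) * of_bool (bad (swap_along s (swap_along s zs))) = ?W2 zs * of_bool (bad zs)"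
        using swap_along_props[OF l] zs by simp
    qed
  qed
  also have "\<dots> = (\<Sum>zs\<in>?L2. ?W2 zs * (\<Sum>s\<in>?S. of_bool (bad (swap_along s zs))))"
    by (subst sum.swap) (simp add: sum_distrib_left)
  also have "\<dots> \<le> (\<Sum>zs\<in>?L2. ?W2 zs * (\<Phi> * 2 ^ m * 2 powr (- ?t)))"
  proof (intro sum_mono mult_left_mono)
    fix zs assume zs: "zs \<in> ?L2"
    show "0 \<le> ?W2 zs" using nW2[OF zs] .
    let ?X = "fst ` set zs \<union> snd ` set zs"
    let ?g = "\<lambda>T s. if \<forall>z\<in>set (swap_along s zs). fst z \<notin> T
      then 2 ^ length (filter (\<lambda>z. snd z \<in> T) (swap_along s zs)) else (0::real)"
    have cX: "card ?X \<le> 2 * m"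
    proof -
      have "card ?X \<le> card (fst ` set zs) + card (snd ` set zs)" by (rule card_Un_le)
      also have "\<dots> \<le> length zs + length zs"
        by (intro add_mono) (metis card_length length_map list.set_map)+
      finally show ?thesis using zs by simp
    qed
    let ?F = "(\<lambda>v. ?X \<inter> R v) ` B"
    have finF: "finite ?F" by (rule finite_subset[of _ "Pow ?X"]) auto
    \<comment> \<open>Union bound over the traces on the fixed pair of samples. For one trace T the
      indicator of "T is missed first and hit t times afterwards" is at most
      \<open>?g T s * 2 powr (- ?t)\<close>, and \<open>sum_swaps_le\<close> bounds the sum over the
      patterns by \<open>2 ^ m\<close>.\<close>
    have "(\<Sum>s\<in>?S. of_bool (bad (swap_along s zs))) \<le> (\<Sum>s\<in>?S. \<Sum>T\<in>?F. ?g T s * 2 powr (- ?t))"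
    proof (rule sum_mono)
      fix s assume s: "s \<in> ?S"
      then have l: "length s = length zs" using zs by simp
      have nng: "0 \<le> ?g T s * 2 powr (- ?t)" for T by simp
      show "of_bool (bad (swap_along s zs)) \<le> (\<Sum>T\<in>?F. ?g T s * 2 powr (- ?t))"
      proof (cases "bad (swap_along s zs)")
        case True
        then obtain v where v: "v \<in> B" "\<forall>z\<in>set (swap_along s zs). fst z \<notin> R v"
          "?t \<le> real (length (filter (\<lambda>z. snd z \<in> R v) (swap_along s zs)))" unfolding bad_def by blast
        have "filter (\<lambda>z. snd z \<in> ?X \<inter> R v) (swap_along s zs) = filter (\<lambda>z. snd z \<in> R v) (swap_along s zs)"
          using set_swap_along[OF l] by (intro filter_cong) auto
        then have "?g (?X \<inter> R v) s = 2 ^ length (filter (\<lambda>z. snd z \<in> R v) (swap_along s zs))"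
          using v(2) by simp
        also have "\<dots> = 2 powr real (length (filter (\<lambda>z. snd z \<in> R v) (swap_along s zs)))"
          by (simp add: powr_realpow)
        also have "\<dots> * 2 powr (- ?t) \<ge> 1"
          unfolding powr_add[symmetric] using v(3) by (intro ge_one_powr_ge_zero) auto
        finally have "1 \<le> ?g (?X \<inter> R v) s * 2 powr (- ?t)" .
        also have "\<dots> \<le> (\<Sum>T\<in>?F. ?g T s * 2 powr (- ?t))"
          using v(1) finF nng by (intro member_le_sum) auto
        finally show ?thesis using True by simp
      next
        case False then show ?thesis using nng by (simp add: sum_nonneg)
      qed
    qed
    also have "\<dots> = (\<Sum>T\<in>?F. (\<Sum>s\<in>?S. ?g T s) * 2 powr (- ?t))"
      by (subst sum.swap) (simp add: sum_distrib_right)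
    also have "\<dots> \<le> (\<Sum>T\<in>?F. 2 ^ m * 2 powr (- ?t))"
      using sum_swaps_le[of zs] zs by (intro sum_mono mult_right_mono) auto
    also have "\<dots> = real (card ?F) * (2 ^ m * 2 powr (- ?t))" by simp
    also have "\<dots> \<le> \<Phi> * (2 ^ m * 2 powr (- ?t))"
      using zs cX by (intro mult_right_mono tr) auto
    finally show "(\<Sum>s\<in>?S. of_bool (bad (swap_along s zs))) \<le> \<Phi> * 2 ^ m * 2 powr (- ?t)"
      by (simp add: mult.assoc)
  qed
  also have "\<dots> = \<Phi> * 2 ^ m * 2 powr (- ?t)" using W2 by (simp add: sum_distrib_right[symmetric])
  finally have "1/2 \<le> \<Phi> * 2 powr (- ?t)" by (simp add: mult.assoc mult.left_commute[of _ "2 ^ m"])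
  then have "2 powr ?t \<le> 2 * \<Phi>" by (simp add: powr_minus field_simps)
  then show False using \<Phi> by linarith
qed

text \<open>Divided by its weight, \<gamma> becomes a probability distribution on the edges under
  which every covered vertex has mass at least 1/q. An integral cover is therefore a 1/q-net for the
  dual system.\<close>

lemma integral_cover_of_fractional_cover:
  assumes H: "hypergraph H" and d: "vc_dim H \<le> d"
    and \<gamma>: "\<And>e. e \<in> edges H \<Longrightarrow> 0 \<le> \<gamma> e" and w: "weight H \<gamma> \<le> q"
    and B: "B \<subseteq> covered H \<gamma>"
    and m: "6 * q \<le> real m"
    and \<Phi>: "2 * (2 * real m + 1) ^ (2 ^ Suc d) < 2 powr (real m / (2 * q))"
  shows "\<exists>S. S \<subseteq> edges H \<and> card S \<le> m \<and> B \<subseteq> \<Union>S"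
proof (cases "B = {}")
  case True
  then show ?thesis by (intro exI[of _ "{}"]) auto
next
  case False
  have E: "finite (edges H)" using hypergraph_finite_edges[OF H] .
  have ge: "1 \<le> (\<Sum>e\<in>{e \<in> edges H. v \<in> e}. \<gamma> e)" if "v \<in> B" for v
    using that B unfolding covered_def by auto
  obtain v where v: "v \<in> B" using False by blast
  \<comment> \<open>One covered vertex already forces weight at least 1, which justifies the
    normalisation; the empty bag was treated apart for this reason.\<close>
  have "1 \<le> weight H \<gamma>"
    using ge[OF v] sum_mono2[OF E, of "{e \<in> edges H. v \<in> e}" \<gamma>] \<gamma> unfolding weight_def by auto
  then have w1: "1 \<le> weight H \<gamma>" "1 \<le> q" using w by auto
  define \<mu> where "\<mu> e = \<gamma> e / weight H \<gamma>" for e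
  have "\<exists>xs\<in>lists_of (edges H) m. \<forall>v\<in>B. set xs \<inter> {e. v \<in> e} \<noteq> {}"
  proof (rule epsilon_net[where \<mu> = \<mu> and \<epsilon> = "1 / q" and \<Phi> = "(2 * real m + 1) ^ (2 ^ Suc d)"])
    show "finite (edges H)" by fact
    show "0 \<le> \<mu> e" if "e \<in> edges H" for e using \<gamma>[OF that] w1 unfolding \<mu>_def by simp
    show "sum \<mu> (edges H) = 1"
      using w1 unfolding \<mu>_def by (simp add: sum_divide_distrib[symmetric] weight_def)
    show "1 / q \<le> sum \<mu> (edges H \<inter> {e. v \<in> e})" if "v \<in> B" for v
    proof -
      have "1 / q \<le> 1 / weight H \<gamma>" using w w1 by (simp add: frac_le)
      also have "\<dots> \<le> (\<Sum>e\<in>{e \<in> edges H. v \<in> e}. \<gamma> e) / weight H \<gamma>"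
        using ge[OF that] w1 by (simp add: divide_right_mono)
      also have "\<dots> = sum \<mu> (edges H \<inter> {e. v \<in> e})"
        unfolding \<mu>_def sum_divide_distrib by (intro sum.cong) auto
      finally show ?thesis .
    qed
    show "6 \<le> 1 / q * real m" using m w1 by (simp add: field_simps)
    show "2 * (2 * real m + 1) ^ 2 ^ Suc d < 2 powr (1 / q * real m / 2)"
      using \<Phi> by (simp add: mult.commute)
    fix X assume X: "X \<subseteq> edges H" "card X \<le> 2 * m"
    have "finite (verts H)" using H unfolding hypergraph_def by blast
    moreover have "(\<lambda>v. X \<inter> {e. v \<in> e}) ` B \<subseteq> (\<lambda>v. {e \<in> X. v \<in> e}) ` verts H"
      using B unfolding covered_def by auto
    ultimately have "card ((\<lambda>v. X \<inter> {e. v \<in> e}) ` B) \<le> card ((\<lambda>v. {e \<in> X. v \<in> e}) ` verts H)"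
      by (intro card_mono) auto
    also have "\<dots> \<le> (card X + 1) ^ (2 ^ Suc d)" by (rule card_vertex_traces_le[OF H d X(1)])
    also have "\<dots> \<le> (2 * m + 1) ^ (2 ^ Suc d)" using X(2) by (intro power_mono) auto
    finally have "real (card ((\<lambda>v. X \<inter> {e. v \<in> e}) ` B)) \<le> real ((2 * m + 1) ^ (2 ^ Suc d))"
      using of_nat_le_iff by blast
    then show "real (card ((\<lambda>v. X \<inter> {e. v \<in> e}) ` B)) \<le> (2 * real m + 1) ^ 2 ^ Suc d" by (simp add: add.commute)
  qed
  then obtain xs where xs: "set xs \<subseteq> edges H" "length xs = m" "\<forall>v\<in>B. set xs \<inter> {e. v \<in> e} \<noteq> {}" by blast
  then show ?thesis using card_length[of xs] by (intro exI[of _ "set xs"]) auto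
qed

section \<open>The choice of the sample size\<close>

definition net_size :: "real \<Rightarrow> real \<Rightarrow> nat" where
  "net_size c k = nat \<lceil>c * ((k + 1) * ln (k + 1))\<rceil>"

text \<open>With q = k + 1 and m about c q ln q, the exponent m / (2 q) is about (c/2) ln q, so the
  right side is at least the power c/4 of q. The left side is polynomial in q of degree 2 D with
  coefficients polynomial in c, hence a large constant c wins uniformly in q \<ge> 2.\<close>

lemma net_size_sufficient:
  fixes D :: nat
  shows "\<exists>c::real. 0 < c \<and> (\<forall>k\<ge>1. 6 * (k + 1) \<le> real (net_size c k) \<and>
    2 * (2 * real (net_size c k) + 1) ^ D < 2 powr (real (net_size c k) / (2 * (k + 1))))"
proof -
  \<comment> \<open>In logarithms the goal is ln 2 + D ln (2 c) + 2 D L < (c/4) L with L = ln q. As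
    L \<ge> 1/2, the difference (c/4 - 2 D) L is at least c/8 - D, which leaves this condition on
    c.\<close>
  have "eventually (\<lambda>c::real. 1 + real D + real D * ln (2 * c) < c / 8) at_top" by real_asymp
  \<comment> \<open>Since ln q \<ge> 1/2, the value 12 makes c q ln q at least 6 q.\<close>
  moreover have "eventually (\<lambda>c::real. 12 \<le> c) at_top" by (rule eventually_ge_at_top)
  ultimately have "eventually (\<lambda>c::real. 1 + real D + real D * ln (2 * c) < c / 8 \<and> 12 \<le> c) at_top"
    by (rule eventually_conj)
  then obtain c :: real where c: "1 + real D + real D * ln (2 * c) < c / 8" "12 \<le> c"
    using eventually_happens'[OF trivial_limit_at_top_linorder] by blast
  have ln2: "1/2 \<le> ln (2::real)"
  proof -
    have "exp (1/2 :: real) ^ 2 \<le> 2 ^ 2" using exp_le by (simp add: power2_eq_square exp_add[symmetric])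
    then have "exp (1/2 :: real) \<le> 2" by (rule power2_le_imp_le) simp
    then show ?thesis by (subst ln_ge_iff) auto
  qed
  have main: "6 * q \<le> real m \<and> 2 * (2 * real m + 1) ^ D < 2 powr (real m / (2 * q))"
    if q: "2 \<le> q" and m: "m = nat \<lceil>c * (q * ln q)\<rceil>" for q :: real and m :: nat
  proof
    let ?L = "ln q"
    have L: "1/2 \<le> ?L" "?L \<le> q - 1"
      using ln2 q ln_le_cancel_iff[of 2 q] ln_le_minus_one[of q] by linarith+
    have pos: "0 \<le> c * (q * ?L)" using c q L by simp
    have m1: "c * (q * ?L) \<le> real m" "real m \<le> c * (q * ?L) + 1"
      using pos unfolding m by linarith+
    have "12 * (q * (1/2)) \<le> c * (q * ?L)"
      using c(2) q L by (intro mult_mono) auto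
    then show "6 * q \<le> real m" using m1 by linarith
    \<comment> \<open>The bound ln q \<le> q - 1 removes the logarithm from m, so that the left side
      becomes the exponential of a linear function of ln q.\<close>
    have "c * (q * ?L) \<le> c * (q * (q - 1))" using c(2) q L by (intro mult_left_mono) auto
    then have "2 * real m + 1 \<le> 2 * (c * (q * (q - 1))) + 3" using m1 by linarith
    also have "\<dots> = 2 * c * q ^ 2 - 2 * (c * q) + 3" by (simp add: power2_eq_square algebra_simps)
    also have "\<dots> \<le> 2 * c * q ^ 2"
      using mult_mono[OF c(2) q] c(2) by simp
    finally have "2 * (2 * real m + 1) ^ D \<le> 2 * (2 * c * q ^ 2) ^ D"
      by (intro mult_left_mono power_mono) auto
    also have "\<dots> = exp (ln 2 + real D * (ln (2 * c) + 2 * ?L))"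
      using c q by (simp add: exp_add exp_of_nat_mult exp_double)
    also have "\<dots> < exp (c / 4 * ?L)"
    proof -
      have "0 \<le> real D * ln (2 * c)" using c by simp
      then have "0 \<le> c / 4 - 2 * real D" using c by linarith
      then have "(c / 4 - 2 * real D) * (1/2) \<le> (c / 4 - 2 * real D) * ?L"
        using L by (intro mult_left_mono) auto
      moreover have "ln 2 \<le> (1::real)" using ln_le_minus_one[of "2::real"] by simp
      ultimately have "ln 2 + real D * (ln (2 * c) + 2 * ?L) < c / 4 * ?L"
        using c(1) by (simp add: algebra_simps)
      then show ?thesis by simp
    qed
    also have "\<dots> \<le> exp (real m / (2 * q) * ln 2)"
    proof -
      have "c / 4 * ?L = (c * (q * ?L)) / (2 * q) * (1/2)" using q by (simp add: field_simps)
      also have "\<dots> \<le> real m / (2 * q) * ln 2"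
        using m1 q ln2 pos by (intro mult_mono divide_right_mono) auto
      finally show ?thesis by simp
    qed
    also have "\<dots> = 2 powr (real m / (2 * q))" by (simp add: powr_def)
    finally show "2 * (2 * real m + 1) ^ D < 2 powr (real m / (2 * q))" .
  qed
  have "6 * (k + 1) \<le> real (net_size c k) \<and>
    2 * (2 * real (net_size c k) + 1) ^ D < 2 powr (real (net_size c k) / (2 * (k + 1)))" if "1 \<le> k" for k
    by (rule main) (use that in \<open>simp_all add: net_size_def\<close>)
  then show ?thesis using c(2) by (intro exI[of _ c]) auto
qed

lemma net_size_bigo:
  assumes "0 < c"
  shows "(\<lambda>k. 3 * real (net_size c k) + 1) \<in> O(\<lambda>k. k * ln k)"
proof (rule landau_o.big_trans)
  show "(\<lambda>k. 3 * real (net_size c k) + 1) \<in> O(\<lambda>k::real. 3 * (c * ((k + 1) * ln (k + 1)) + 1) + 1)"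
  proof (rule landau_o.big_mono)
    show "\<forall>\<^sub>F k in at_top. norm (3 * real (net_size c k) + 1)
        \<le> norm (3 * (c * ((k + 1) * ln (k + 1)) + 1) + 1)"
      using eventually_ge_at_top[of "1::real"]
    proof eventually_elim
      case (elim k)
      have "0 \<le> c * ((k + 1) * ln (k + 1))" using elim assms by simp
      then have "real (net_size c k) \<le> c * ((k + 1) * ln (k + 1)) + 1"
        unfolding net_size_def by linarith
      then show ?case by simp
    qed
  qed
  show "(\<lambda>k::real. 3 * (c * ((k + 1) * ln (k + 1)) + 1) + 1) \<in> O(\<lambda>k. k * ln k)"
    using assms by real_asymp
qed

text \<open>The infimum in \<open>fhw\<close> says something only about a non-empty set of widths. A
  single bag suffices, with weight 1 on all edges because every vertex lies in some edge.\<close>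

lemma ex_fhd:
  fixes H :: "'v hypergraph"
  assumes H: "hypergraph H"
  shows "\<exists>D. fhd H D"
proof
  let ?D = "\<lparr>nodes = {0}, root = 0, arcs = {}, bag = \<lambda>_. verts H, cover = \<lambda>_ _. 1\<rparr> :: 'v decomp"
  have "verts H \<subseteq> covered H (\<lambda>_. 1)"
  proof
    fix v assume v: "v \<in> verts H"
    have "{e \<in> edges H. v \<in> e} \<noteq> {}" using H v unfolding hypergraph_def by blast
    moreover have "finite {e \<in> edges H. v \<in> e}" using hypergraph_finite_edges[OF H] by simp
    ultimately have "card {e \<in> edges H. v \<in> e} \<ge> 1" by (metis One_nat_def Suc_leI card_gt_0_iff)
    then show "v \<in> covered H (\<lambda>_. 1)" using v unfolding covered_def by simp
  qed
  then show "fhd H ?D"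
    using H unfolding fhd_def tree_decomposition_def rooted_tree_def connected_in_def hypergraph_def
    by auto
qed

text \<open>Below k + 1 there is always an actual decomposition, even if the infimum were not
  attained. Each of its bags is treated by the net argument separately, so the tree and the bags
  stay as they are.\<close>

lemma tree_decomposition_with_small_covers:
  assumes H: "hypergraph H" and d: "vc_dim H \<le> d" and k: "fhw H \<le> k"
    and m: "6 * (k + 1) \<le> real m"
    and \<Phi>: "2 * (2 * real m + 1) ^ (2 ^ Suc d) < 2 powr (real m / (2 * (k + 1)))"
  shows "\<exists>D. tree_decomposition H D \<and>
    (\<forall>u\<in>nodes D. \<exists>S. S \<subseteq> edges H \<and> card S \<le> m \<and> bag D u \<subseteq> \<Union>S)"
proof -
  have "{width H D | D. fhd H D} \<noteq> {}" using ex_fhd[OF H] by blast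
  moreover have "Inf {width H D | D. fhd H D} < k + 1" using k unfolding fhw_def by simp
  ultimately obtain D where D: "fhd H D" "width H D < k + 1"
    using cInf_lessD[of "{width H D | D. fhd H D}" "k + 1"] by auto
  have fin: "finite (nodes D)"
    using D(1) unfolding fhd_def tree_decomposition_def rooted_tree_def by blast
  have "\<exists>S. S \<subseteq> edges H \<and> card S \<le> m \<and> bag D u \<subseteq> \<Union>S" if u: "u \<in> nodes D" for u
  proof (rule integral_cover_of_fractional_cover[OF H d _ _ _ m \<Phi>])
    show "0 \<le> cover D u e" if "e \<in> edges H" for e using D u that unfolding fhd_def by blast
    have "weight H (cover D u) \<le> width H D" unfolding width_def using fin u by simp
    then show "weight H (cover D u) \<le> k + 1" using D by simp
    show "bag D u \<subseteq> covered H (cover D u)" using D u unfolding fhd_def by blast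
  qed
  then show ?thesis using D unfolding fhd_def by blast
qed

section \<open>Balanced separators\<close>

definition subtree :: "('n \<times> 'n) set \<Rightarrow> 'n \<Rightarrow> 'n set" where
  "subtree A c = {t. (c, t) \<in> A\<^sup>*}"

lemma rooted_tree_parent_unique:
  assumes "rooted_tree N r A" "(u, v) \<in> A" "(u', v) \<in> A"
  shows "u = u'"
proof -
  have "v \<in> N - {r}" using assms unfolding rooted_tree_def by blast
  then show ?thesis using assms unfolding rooted_tree_def by blast
qed

text \<open>A cycle through a node passes through its unique parent, so it could be pushed up to the
  root, which has no incoming arc.\<close>

lemma rooted_tree_acyclic:
  assumes T: "rooted_tree N r A" and v: "v \<in> N"
  shows "(v, v) \<notin> A\<^sup>+"
proof -
  have "(r, v) \<in> A\<^sup>*" using T v unfolding rooted_tree_def by blast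
  then show ?thesis
  proof (induction rule: rtrancl_induct)
    case base
    show ?case
    proof
      assume "(r, r) \<in> A\<^sup>+"
      then obtain u where "(u, r) \<in> A" by (meson tranclD2)
      then show False using T unfolding rooted_tree_def by blast
    qed
  next
    case (step y z)
    show ?case
    proof
      assume "(z, z) \<in> A\<^sup>+"
      then obtain u where u: "(z, u) \<in> A\<^sup>*" "(u, z) \<in> A" by (meson tranclD2)
      then have "u = y" using rooted_tree_parent_unique[OF T _ step.hyps(2)] by blast
      then have "(y, y) \<in> A\<^sup>+" using u step.hyps(2) by (meson rtrancl_into_trancl2)
      then show False using step.IH by blast
    qed
  qed
qed

text \<open>The arc into \<open>c\<close> is the only arc between the subtree of \<open>c\<close> and the rest of the tree.\<close>

lemma connected_in_subtree:
  assumes T: "rooted_tree N r A" and uc: "(u, c) \<in> A"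
    and S: "connected_in A S" "u \<notin> S" "s \<in> S" "t \<in> S" and s: "s \<in> subtree A c"
  shows "t \<in> subtree A c"
proof -
  have "(s, t) \<in> ((A \<union> A\<inverse>) \<inter> S \<times> S)\<^sup>*" using S unfolding connected_in_def by blast
  then show ?thesis
  proof (induction rule: rtrancl_induct)
    case base then show ?case using s .
  next
    case (step y z)
    then consider "(y, z) \<in> A" | "(z, y) \<in> A" "z \<in> S" by blast
    then show ?case
    proof cases
      case 1 then show ?thesis using step.IH unfolding subtree_def by auto
    next
      case 2
      \<comment> \<open>An upward arc ends in the unique parent of y. For y = c this is u, which S
        avoids; otherwise the parent is still below c.\<close>
      have "(c, y) \<in> A\<^sup>*" using step.IH unfolding subtree_def by auto
      then show ?thesis
      proof (cases rule: rtranclE)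
        case base
        then have "z = u" using rooted_tree_parent_unique[OF T _ uc] 2 by blast
        then show ?thesis using 2 S by blast
      next
        case (step x)
        then have "x = z" using rooted_tree_parent_unique[OF T _ 2(1)] by blast
        then show ?thesis using step unfolding subtree_def by auto
      qed
    qed
  qed
qed

lemma subtree_subset:
  assumes "rooted_tree N r A" "c \<in> N"
  shows "subtree A c \<subseteq> N"
proof
  fix t assume "t \<in> subtree A c"
  then have "(c, t) \<in> A\<^sup>*" unfolding subtree_def by simp
  then show "t \<in> N"
    using assms by (induction rule: rtrancl_induct) (auto simp: rooted_tree_def)
qed

lemma subtree_child_psubset:
  assumes T: "rooted_tree N r A" and uc: "(u, c) \<in> A"
  shows "subtree A c \<subset> subtree A u"
proof -
  have "u \<in> N" using T uc unfolding rooted_tree_def by blast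
  then have "(c, u) \<notin> A\<^sup>*" using rooted_tree_acyclic[OF T] uc by (meson rtrancl_into_trancl2)
  moreover have "subtree A c \<subseteq> subtree A u"
    using uc unfolding subtree_def by (auto intro: converse_rtrancl_into_rtrancl)
  ultimately show ?thesis unfolding subtree_def by blast
qed

text \<open>A node whose subtree is minimal among those that carry more than K elements of W has
  only light children, and outside its subtree at most (2 K + 1) - (K + 1) = K elements
  remain.\<close>

lemma tree_centroid:
  assumes T: "rooted_tree N r A" and W: "finite W" "\<And>w. w \<in> W \<Longrightarrow> f w \<in> N"
    and K: "card W \<le> 2 * K + 1"
  shows "\<exists>u\<in>N. (\<forall>c. (u, c) \<in> A \<longrightarrow> card {w \<in> W. f w \<in> subtree A c} \<le> K) \<and>
    card {w \<in> W. f w \<notin> subtree A u} \<le> K"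
proof (cases "card W \<le> K")
  case True
  then have *: "card {w \<in> W. P w} \<le> K" for P
    using card_mono[OF W(1), of "{w \<in> W. P w}"] by auto
  have "r \<in> N" using T unfolding rooted_tree_def by blast
  then show ?thesis using * by (intro bexI[of _ r]) auto
next
  case False
  let ?heavy = "\<lambda>u. u \<in> N \<and> K < card {w \<in> W. f w \<in> subtree A u}"
  have finN: "finite N" using T unfolding rooted_tree_def by blast
  have "{w \<in> W. f w \<in> subtree A r} = W"
    using T W unfolding rooted_tree_def subtree_def by auto
  then have "?heavy r" using False T unfolding rooted_tree_def by auto
  \<comment> \<open>The size of the subtree serves as the depth measure: it drops strictly from a
    node to its child.\<close>
  then obtain u where u: "?heavy u" and min: "\<And>v. card (subtree A v) < card (subtree A u) \<Longrightarrow> \<not> ?heavy v"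
    using exists_least_iff[of "\<lambda>n. \<exists>u. ?heavy u \<and> card (subtree A u) = n"] by blast
  have "card {w \<in> W. f w \<in> subtree A c} \<le> K" if c: "(u, c) \<in> A" for c
  proof -
    have "finite (subtree A u)" using subtree_subset[OF T] u finN finite_subset by blast
    then have "card (subtree A c) < card (subtree A u)"
      using subtree_child_psubset[OF T c] by (rule psubset_card_mono)
    moreover have "c \<in> N" using T c unfolding rooted_tree_def by blast
    ultimately show ?thesis using min by (meson not_less)
  qed
  moreover have "card {w \<in> W. f w \<notin> subtree A u} \<le> K"
  proof -
    have "W = {w \<in> W. f w \<in> subtree A u} \<union> {w \<in> W. f w \<notin> subtree A u}" by blast
    then have "card W = card ({w \<in> W. f w \<in> subtree A u} \<union> {w \<in> W. f w \<notin> subtree A u})"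
      by (rule arg_cong)
    also have "\<dots> = card {w \<in> W. f w \<in> subtree A u} + card {w \<in> W. f w \<notin> subtree A u}"
      using W(1) by (intro card_Un_disjoint) auto
    finally have eq: "card W = \<dots>" .
    show ?thesis using eq u K by linarith
  qed
  ultimately show ?thesis using u by blast
qed

text \<open>\<open>unsplit H R Z\<close>: \<open>Z\<close> lies within one connected component of \<open>H\<close> restricted to \<open>R\<close>.\<close>

definition unsplit :: "'v hypergraph \<Rightarrow> 'v set \<Rightarrow> 'v set \<Rightarrow> bool" where
  "unsplit H R Z \<longleftrightarrow> (\<forall>A\<subseteq>R. (\<forall>e\<in>edges H. e \<inter> R \<subseteq> A \<or> e \<inter> A = {}) \<longrightarrow> Z \<subseteq> A \<or> Z \<inter> A = {})"

text \<open>Assign to each edge a node whose bag contains it, and take a centroid u of these nodes.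
  A vertex outside the bag of u has all its bags in one branch at u, so the vertices below a given
  child form a set that no edge leaves within R. An unsplit Z is therefore confined to one branch,
  and the edges that meet Z are assigned to nodes of that branch.\<close>

lemma balanced_separator:
  assumes H: "hypergraph H" and D: "tree_decomposition H D"
    and W: "finite W" "W \<subseteq> edges H" "card W \<le> 2 * K + 1"
  shows "\<exists>u\<in>nodes D. \<forall>Z R. R \<subseteq> verts H \<longrightarrow> R \<inter> bag D u = {} \<longrightarrow> Z \<subseteq> R \<longrightarrow> unsplit H R Z \<longrightarrow>
    card {w \<in> W. w \<inter> Z \<noteq> {}} \<le> K"
proof -
  let ?A = "arcs D"
  have T: "rooted_tree (nodes D) (root D) ?A"
    and con: "\<And>v. v \<in> verts H \<Longrightarrow> connected_in ?A {u \<in> nodes D. v \<in> bag D u}"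
    using D unfolding tree_decomposition_def by auto
  obtain f where f: "\<And>e. e \<in> edges H \<Longrightarrow> f e \<in> nodes D" "\<And>e. e \<in> edges H \<Longrightarrow> e \<subseteq> bag D (f e)"
    using D unfolding tree_decomposition_def by metis
  obtain u where u: "u \<in> nodes D" "\<And>c. (u, c) \<in> ?A \<Longrightarrow> card {w \<in> W. f w \<in> subtree ?A c} \<le> K"
    "card {w \<in> W. f w \<notin> subtree ?A u} \<le> K"
    using tree_centroid[OF T W(1), of f K] W f(1) by blast
  show ?thesis
  proof (intro bexI[OF _ u(1)] allI impI)
    fix Z R assume R: "R \<subseteq> verts H" "R \<inter> bag D u = {}" and Z: "Z \<subseteq> R" "unsplit H R Z"
    define below where "below c = {v \<in> R. \<exists>t\<in>nodes D. v \<in> bag D t \<and> t \<in> subtree ?A c}" for c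
    have all_below: "t \<in> subtree ?A c"
      if c: "(u, c) \<in> ?A" and v: "v \<in> below c" and t: "t \<in> nodes D" "v \<in> bag D t" for c v t
    proof -
      obtain s where s: "s \<in> nodes D" "v \<in> bag D s" "s \<in> subtree ?A c" "v \<in> R"
        using v unfolding below_def by blast
      show ?thesis
        by (rule connected_in_subtree[OF T c con[of v], where s = s]) (use s t R in auto)
    qed
    have dich: "Z \<subseteq> below c \<or> Z \<inter> below c = {}" if c: "(u, c) \<in> ?A" for c
    proof -
      have "e \<inter> R \<subseteq> below c \<or> e \<inter> below c = {}" if e: "e \<in> edges H" for e
      proof (cases "f e \<in> subtree ?A c")
        case True
        then have "e \<inter> R \<subseteq> below c" using f[OF e] unfolding below_def by blast
        then show ?thesis ..
      next
        case False
        then have "e \<inter> below c = {}" using f[OF e] all_below[OF c] by blast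
        then show ?thesis ..
      qed
      moreover have "below c \<subseteq> R" unfolding below_def by blast
      ultimately show ?thesis using Z(2) unfolding unsplit_def by blast
    qed
    show "card {w \<in> W. w \<inter> Z \<noteq> {}} \<le> K"
    proof (cases "\<exists>c. (u, c) \<in> ?A \<and> Z \<subseteq> below c")
      case True
      then obtain c where c: "(u, c) \<in> ?A" "Z \<subseteq> below c" by blast
      have "{w \<in> W. w \<inter> Z \<noteq> {}} \<subseteq> {w \<in> W. f w \<in> subtree ?A c}"
        using all_below[OF c(1)] c(2) f W(2) by blast
      then have "card {w \<in> W. w \<inter> Z \<noteq> {}} \<le> card {w \<in> W. f w \<in> subtree ?A c}"
        using W(1) by (intro card_mono) auto
      then show ?thesis using u(2)[OF c(1)] by linarith
    next
      case False
      \<comment> \<open>Here Z avoids everything below the children of u, so it belongs to the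
        branch towards the root.\<close>
      have "f w \<notin> subtree ?A u" if w: "w \<in> W" "w \<inter> Z \<noteq> {}" for w
      proof
        assume fw: "f w \<in> subtree ?A u"
        obtain z where z: "z \<in> w" "z \<in> Z" using w by blast
        have wH: "w \<in> edges H" using w W by blast
        then have "f w \<noteq> u" using f(2)[OF wH] z Z(1) R by blast
        then obtain c where c: "(u, c) \<in> ?A" "f w \<in> subtree ?A c"
          using fw unfolding subtree_def by (auto elim: converse_rtranclE)
        then have "z \<in> below c" using f[OF wH] z Z(1) unfolding below_def by blast
        then show False using dich[OF c(1)] False c(1) z by blast
      qed
      then have "{w \<in> W. w \<inter> Z \<noteq> {}} \<subseteq> {w \<in> W. f w \<notin> subtree ?A u}" by blast
      then have "card {w \<in> W. w \<inter> Z \<noteq> {}} \<le> card {w \<in> W. f w \<notin> subtree ?A u}"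
        using W(1) by (intro card_mono) auto
      then show ?thesis using u(3) by linarith
    qed
  qed
qed

section \<open>Adding a leaf to a tree and to a connected set of nodes\<close>

lemma rooted_tree_add_leaf:
  assumes T: "rooted_tree N r A" and u: "u \<notin> N" "p \<in> N"
  shows "rooted_tree (insert u N) r (insert (p, u) A)"
proof -
  have A: "A \<subseteq> N \<times> N" and par: "\<forall>v\<in>N - {r}. \<exists>!w. (w, v) \<in> A" and r: "r \<in> N" "\<forall>w. (w, r) \<notin> A"
    and reach: "\<And>v. v \<in> N \<Longrightarrow> (r, v) \<in> A\<^sup>*" and fin: "finite N"
    using T unfolding rooted_tree_def by auto
  have reach': "(r, v) \<in> (insert (p, u) A)\<^sup>*" if "v \<in> N" for v
    using reach[OF that] rtrancl_mono[of A "insert (p, u) A"] by blast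
  then have "(r, u) \<in> (insert (p, u) A)\<^sup>*"
    using u(2) by (meson insertI1 rtrancl.rtrancl_into_rtrancl)
  moreover have "\<exists>!w. (w, v) \<in> insert (p, u) A" if "v \<in> insert u N - {r}" for v
  proof (cases "v = u")
    case True
    then show ?thesis using A u by blast
  next
    case False
    then have "(w, v) \<in> insert (p, u) A \<longleftrightarrow> (w, v) \<in> A" for w by blast
    then show ?thesis using par that False by auto
  qed
  moreover have "u \<noteq> r" using u r by blast
  ultimately show ?thesis unfolding rooted_tree_def using A u r fin reach'
    by (intro conjI ballI allI) auto
qed

lemma connected_in_mono:
  assumes "connected_in A S" "A \<subseteq> A'"
  shows "connected_in A' S"
proof -
  have "((A \<union> A\<inverse>) \<inter> S \<times> S)\<^sup>* \<subseteq> ((A' \<union> A'\<inverse>) \<inter> S \<times> S)\<^sup>*"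
    using assms(2) by (intro rtrancl_mono) blast
  then show ?thesis using assms(1) unfolding connected_in_def by blast
qed

lemma connected_in_insert:
  assumes S: "connected_in A S" and p: "p \<in> S" "(p, u) \<in> A"
  shows "connected_in A (insert u S)"
proof -
  let ?R = "(A \<union> A\<inverse>) \<inter> insert u S \<times> insert u S"
  have "((A \<union> A\<inverse>) \<inter> S \<times> S)\<^sup>* \<subseteq> ?R\<^sup>*" by (intro rtrancl_mono) blast
  then have 1: "(x, y) \<in> ?R\<^sup>*" if "x \<in> S" "y \<in> S" for x y
    using S that unfolding connected_in_def by blast
  have pu: "(p, u) \<in> ?R" "(u, p) \<in> ?R" using p by auto
  have 2: "(x, u) \<in> ?R\<^sup>*" if "x \<in> S" for x
    using 1[OF that p(1)] pu(1) by (rule rtrancl.rtrancl_into_rtrancl)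
  have 3: "(u, x) \<in> ?R\<^sup>*" if "x \<in> S" for x
    using pu(2) 1[OF p(1) that] by (rule converse_rtrancl_into_rtrancl)
  show ?thesis unfolding connected_in_def using 1 2 3 by blast
qed

lemma connected_in_singleton: "connected_in A {u}"
  unfolding connected_in_def by blast

section \<open>Growing a tree decomposition\<close>

text \<open>The closed neighbourhood: as no vertex of a hypergraph is isolated, it contains C
  whenever C consists of vertices. Then \<open>nbhd H C - C\<close> is the boundary by which the
  part C is attached to the rest.\<close>

definition nbhd :: "'v hypergraph \<Rightarrow> 'v set \<Rightarrow> 'v set" where
  "nbhd H C = \<Union>{e \<in> edges H. e \<inter> C \<noteq> {}}"

lemma nbhd_edge: "e \<in> edges H \<Longrightarrow> e \<inter> C \<noteq> {} \<Longrightarrow> e \<subseteq> nbhd H C"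
  unfolding nbhd_def by auto

type_synonym 'v task = "nat \<times> 'v set \<times> 'v set set"

text \<open>All of S is inherited, but only those edges of W that reach Z. Balance bounds the latter
  by K, which restores the bound 2 K on the boundary edges.\<close>

definition subtask_sets :: "nat \<Rightarrow> 'v set \<Rightarrow> 'v set set \<Rightarrow> 'v set set \<Rightarrow> 'v set \<Rightarrow> 'v set \<Rightarrow> 'v task" where
  "subtask_sets v C W S B Z = (v, C \<inter> Z - B, S \<union> {w \<in> W. w \<inter> Z \<noteq> {}})"

text \<open>The members of \<open>Zs\<close> are unions of components of \<open>H\<close> minus the vertices of the
  separator \<open>S\<close>, which is balanced with respect to the edges in \<open>W\<close>.\<close>

definition balanced_split :: "'v hypergraph \<Rightarrow> nat \<Rightarrow> 'v set set \<Rightarrow> 'v set set \<Rightarrow> 'v set list \<Rightarrow> bool" where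
  "balanced_split H K W S Zs \<longleftrightarrow>
     S \<subseteq> edges H \<and> card S \<le> K \<and>
     verts H - \<Union>S \<subseteq> \<Union>(set Zs) \<and>
     (\<forall>e\<in>edges H. \<exists>Z\<in>set Zs. e - \<Union>S \<subseteq> Z) \<and>
     sorted_wrt (\<lambda>Z Z'. Z \<inter> Z' = {}) Zs \<and>
     (\<forall>Z\<in>set Zs. card {w \<in> W. w \<inter> Z \<noteq> {}} \<le> K)"

lemma sorted_wrt_disjoint_unique:
  assumes "sorted_wrt (\<lambda>Z Z'. Z \<inter> Z' = {}) Zs" "Z \<in> set Zs" "Z' \<in> set Zs" "x \<in> Z" "x \<in> Z'"
  shows "Z = Z'"
  using assms by (induction Zs) auto

text \<open>One refinement step in isolation. The bag is cut down to \<open>nbhd H C\<close>,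
  although L may cover more, because a vertex of another part in it would destroy
  connectedness.\<close>

locale task_split =
  fixes H :: "'v hypergraph" and K :: nat and C :: "'v set" and W :: "'v set set" and S Zs
    and L :: "'v set set" and B :: "'v set"
  assumes H: "hypergraph H" and C: "C \<subseteq> verts H" and W: "W \<subseteq> edges H"
    and split: "balanced_split H K W S Zs"
    and bnd: "nbhd H C - C \<subseteq> \<Union>W"
    and L: "L = W \<union> S" and B: "B = nbhd H C \<inter> \<Union>L"
begin

lemma sub_W: "S \<subseteq> edges H" "S \<union> {w \<in> W. w \<inter> Z \<noteq> {}} \<subseteq> edges H"
  using split W unfolding balanced_split_def by auto

lemma sub_card:
  assumes "Z \<in> set Zs"
  shows "card (S \<union> {w \<in> W. w \<inter> Z \<noteq> {}}) \<le> 2 * K"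
proof -
  have "card (S \<union> {w \<in> W. w \<inter> Z \<noteq> {}}) \<le> card S + card {w \<in> W. w \<inter> Z \<noteq> {}}" by (rule card_Un_le)
  then show ?thesis using split assms unfolding balanced_split_def by fastforce
qed

text \<open>A boundary vertex x of the new part shares an edge with some y in Z outside the bag.
  That edge, apart from vertices of S, stays inside Z. So either S covers x, or x is in Z; in the
  latter case x belongs to the bag through an edge of W, and this edge meets Z in x itself. The
  first claim allows children to be attached to the new node, the second one passes on the cover of
  the boundary.\<close>

lemma sub_boundary:
  assumes Z: "Z \<in> set Zs"
  shows "nbhd H (C \<inter> Z - B) - (C \<inter> Z - B) \<subseteq> B"
    and "nbhd H (C \<inter> Z - B) - (C \<inter> Z - B) \<subseteq> \<Union>(S \<union> {w \<in> W. w \<inter> Z \<noteq> {}})"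
proof -
  have *: "x \<in> B \<and> x \<in> \<Union>(S \<union> {w \<in> W. w \<inter> Z \<noteq> {}})" if x: "x \<in> nbhd H (C \<inter> Z - B) - (C \<inter> Z - B)" for x
  proof -
    obtain e y where e: "e \<in> edges H" "y \<in> e" "x \<in> e" "y \<in> C" "y \<in> Z" "y \<notin> B"
      using x unfolding nbhd_def by blast
    have eC: "e \<subseteq> nbhd H C" by (rule nbhd_edge) (use e in auto)
    then have xC: "x \<in> nbhd H C" "y \<in> nbhd H C" using e by auto
    have yL: "y \<notin> \<Union>L" using xC(2) e unfolding B by blast
    obtain Z' where Z': "Z' \<in> set Zs" "e - \<Union>S \<subseteq> Z'"
      using split e unfolding balanced_split_def by blast
    have yS: "y \<notin> \<Union>S" using yL unfolding L Union_Un_distrib by simp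
    have yZ': "y \<in> Z'" using Z'(2) e(2) yS by auto
    have "sorted_wrt (\<lambda>Z Z'. Z \<inter> Z' = {}) Zs" using split unfolding balanced_split_def by simp
    then have ZZ: "Z' = Z" by (rule sorted_wrt_disjoint_unique[OF _ Z'(1) Z yZ' e(5)])
    show ?thesis
    proof (cases "x \<in> \<Union>S")
      case True
      then show ?thesis using xC unfolding B L by blast
    next
      case False
      then have xZ: "x \<in> Z" using Z'(2) ZZ e(3) by auto
      have xB: "x \<in> B"
      proof (cases "x \<in> C")
        case True then show ?thesis using x xZ by blast
      next
        case False
        then show ?thesis using xC bnd unfolding B L by blast
      qed
      then obtain w where "w \<in> W" "x \<in> w" using False unfolding B L by blast
      then show ?thesis using xB xZ by blast
    qed
  qed
  then show "nbhd H (C \<inter> Z - B) - (C \<inter> Z - B) \<subseteq> B" by blast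
  from * show "nbhd H (C \<inter> Z - B) - (C \<inter> Z - B) \<subseteq> \<Union>(S \<union> {w \<in> W. w \<inter> Z \<noteq> {}})" by blast
qed

text \<open>Vertices of C not covered by L survive in some block, and boundary vertices are covered
  by W. Thus no edge is lost: it is settled by the new bag or still touches a subtask.\<close>

lemma edge_cases:
  assumes e: "e \<in> edges H" "e \<inter> C \<noteq> {}"
  shows "e \<subseteq> B \<or> (\<exists>Z\<in>set Zs. e \<inter> (C \<inter> Z - B) \<noteq> {})"
proof (rule disjCI)
  assume "\<not> (\<exists>Z\<in>set Zs. e \<inter> (C \<inter> Z - B) \<noteq> {})"
  then have no: "x \<notin> e \<or> x \<notin> C \<or> x \<in> B" if "Z \<in> set Zs" "x \<in> Z" for x Z using that by blast
  show "e \<subseteq> B"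
  proof
    fix x assume x: "x \<in> e"
    have xC: "x \<in> nbhd H C" using nbhd_edge[OF e] x by blast
    show "x \<in> B"
    proof (cases "x \<in> \<Union>L")
      case True then show ?thesis using xC unfolding B by blast
    next
      case False
      then have "x \<in> C" using xC bnd unfolding L by blast
      moreover from this have "x \<in> verts H - \<Union>S" using C False unfolding L by blast
      then obtain Z where "Z \<in> set Zs" "x \<in> Z" using split unfolding balanced_split_def by blast
      ultimately show ?thesis using no x by blast
    qed
  qed
qed

lemma bag_props:
  assumes "card W \<le> 2 * K + 1"
  shows "B \<subseteq> verts H" "B \<subseteq> \<Union>L" "L \<subseteq> edges H" "card L \<le> 3 * K + 1"
proof -
  show "B \<subseteq> verts H" using H unfolding B nbhd_def hypergraph_def by blast
  show "B \<subseteq> \<Union>L" unfolding B by blast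
  show "L \<subseteq> edges H" using W sub_W unfolding L by blast
  have "card L \<le> card W + card S" unfolding L by (rule card_Un_le)
  then show "card L \<le> 3 * K + 1" using assms split unfolding balanced_split_def by linarith
qed

end

section \<open>The invariant of the growing decomposition\<close>

definition edge_indicator :: "'v set set \<Rightarrow> 'v set \<Rightarrow> real" where
  "edge_indicator L e = (if e \<in> L then 1 else 0)"

text \<open>The condition \<open>u \<in> bag D u\<close> makes node names fresh: a vertex of a
  pending part lies in no bag yet, so it cannot already be a node.\<close>

definition partial_decomp :: "nat hypergraph \<Rightarrow> nat \<Rightarrow> nat decomp \<Rightarrow> bool" where
  "partial_decomp H K D \<longleftrightarrow>
     rooted_tree (nodes D) (root D) (arcs D) \<and>
     (\<forall>u\<in>nodes D. u \<in> bag D u \<and> bag D u \<subseteq> verts H \<and>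
       (\<exists>L\<subseteq>edges H. card L \<le> 3 * K + 1 \<and> bag D u \<subseteq> \<Union>L \<and> cover D u = edge_indicator L)) \<and>
     (\<forall>v\<in>verts H. connected_in (arcs D) {u \<in> nodes D. v \<in> bag D u})"

text \<open>The node p is where the next bag will hang. Its bag holds the whole boundary, while the
  vertices of C occur in no bag so far; these two facts give connectedness after the
  extension.\<close>

fun pending :: "nat hypergraph \<Rightarrow> nat \<Rightarrow> nat decomp \<Rightarrow> nat task \<Rightarrow> bool" where
  "pending H K D (p, C, W) \<longleftrightarrow>
     p \<in> nodes D \<and> C \<noteq> {} \<and> C \<subseteq> verts H \<and> W \<subseteq> edges H \<and> card W \<le> 2 * K \<and>
     nbhd H C - C \<subseteq> \<Union>W \<and> nbhd H C - C \<subseteq> bag D p \<and> (\<forall>u\<in>nodes D. bag D u \<inter> C = {})"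

abbreviation task_verts :: "'v task \<Rightarrow> 'v set" where
  "task_verts t \<equiv> fst (snd t)"

text \<open>Disjointness lets one task be processed without disturbing the others, and the last
  conjunct turns into the edge condition of a tree decomposition once no task is left.\<close>

definition decomp_inv :: "nat hypergraph \<Rightarrow> nat \<Rightarrow> nat task list \<Rightarrow> nat decomp \<Rightarrow> bool" where
  "decomp_inv H K ts D \<longleftrightarrow>
     partial_decomp H K D \<and>
     (\<forall>t\<in>set ts. pending H K D t) \<and>
     sorted_wrt (\<lambda>t t'. task_verts t \<inter> task_verts t' = {}) ts \<and>
     (\<forall>e\<in>edges H. (\<exists>u\<in>nodes D. e \<subseteq> bag D u) \<or> (\<exists>t\<in>set ts. e \<inter> task_verts t \<noteq> {}))"

definition subtask_list where
  "subtask_list v C W S B Zs = filter (\<lambda>t. task_verts t \<noteq> {}) (map (subtask_sets v C W S B) Zs)"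

lemma (in task_split) sorted_subtasks:
  "sorted_wrt (\<lambda>t t'. task_verts t \<inter> task_verts t' = {}) (subtask_list v C W S B Zs)"
proof -
  have "sorted_wrt (\<lambda>Z Z'. Z \<inter> Z' = {}) Zs" using split unfolding balanced_split_def by blast
  then have "sorted_wrt (\<lambda>Z Z'. task_verts (subtask_sets v C W S B Z) \<inter> task_verts (subtask_sets v C W S B Z') = {}) Zs"
    by (rule sorted_wrt_mono_rel[rotated]) (auto simp: subtask_sets_def)
  then show ?thesis unfolding subtask_list_def by (intro sorted_wrt_filter) (simp add: sorted_wrt_map)
qed

lemma (in task_split) subtask_list_memE:
  assumes "t \<in> set (subtask_list v C W S B Zs)"
  obtains Z where "Z \<in> set Zs" "t = (v, C \<inter> Z - B, S \<union> {w \<in> W. w \<inter> Z \<noteq> {}})" "C \<inter> Z - B \<noteq> {}"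
proof -
  obtain Z where "Z \<in> set Zs" "t = subtask_sets v C W S B Z" "task_verts t \<noteq> {}"
    using assms unfolding subtask_list_def by auto
  then show ?thesis using that[of Z] unfolding subtask_sets_def by simp
qed

lemma (in task_split) edge_subtask:
  assumes "e \<in> edges H" "e \<inter> C \<noteq> {}"
  shows "e \<subseteq> B \<or> (\<exists>t\<in>set (subtask_list v C W S B Zs). e \<inter> task_verts t \<noteq> {})"
proof -
  have "\<exists>t\<in>set (subtask_list v C W S B Zs). e \<inter> task_verts t \<noteq> {}"
    if "Z \<in> set Zs" "e \<inter> (C \<inter> Z - B) \<noteq> {}" for Z
    using that unfolding subtask_list_def subtask_sets_def
    by (intro bexI[of _ "subtask_sets v C W S B Z"]) (auto simp: subtask_sets_def)
  then show ?thesis using edge_cases[OF assms] by blast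
qed

definition extend :: "nat decomp \<Rightarrow> nat \<Rightarrow> nat \<Rightarrow> nat set \<Rightarrow> nat set set \<Rightarrow> nat decomp" where
  "extend D p v B L = \<lparr>nodes = insert v (nodes D), root = root D, arcs = insert (p, v) (arcs D),
     bag = (bag D)(v := B), cover = (cover D)(v := edge_indicator L)\<rparr>"

text \<open>A vertex of the new bag is either in C, and then the new node is the only one that holds
  it, or on the boundary, and then p holds it and the new node is adjacent to p. Progress comes from
  v: the edge e0 forces it into the new bag, and no earlier bag contains it.\<close>

lemma decomp_inv_extend:
  assumes inv: "decomp_inv H K ((p, C, W0) # ts) D" and H: "hypergraph H"
    and e0: "e0 \<in> edges H" "v \<in> e0" and v: "v \<in> C"
    and W: "W = insert e0 W0" and split: "balanced_split H K W S Zs"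
    and L: "L = W \<union> S" and B: "B = nbhd H C \<inter> \<Union>L"
  shows "decomp_inv H K (subtask_list v C W S B Zs @ ts) (extend D p v B L)"
    and "verts H - \<Union>(bag (extend D p v B L) ` nodes (extend D p v B L)) \<subset> verts H - \<Union>(bag D ` nodes D)"
    and "v \<notin> nodes D" "p \<noteq> v"
proof -
  let ?D = "extend D p v B L"
  have pd: "partial_decomp H K D" and pend: "pending H K D (p, C, W0)"
    and pts: "\<And>t. t \<in> set ts \<Longrightarrow> pending H K D t"
    and dts: "\<And>t. t \<in> set ts \<Longrightarrow> C \<inter> task_verts t = {}"
    and srt: "sorted_wrt (\<lambda>t t'. task_verts t \<inter> task_verts t' = {}) ts"
    and cov: "\<And>e. e \<in> edges H \<Longrightarrow> (\<exists>u\<in>nodes D. e \<subseteq> bag D u) \<or> e \<inter> C \<noteq> {} \<or> (\<exists>t\<in>set ts. e \<inter> task_verts t \<noteq> {})"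
    using inv unfolding decomp_inv_def by auto
  have p: "p \<in> nodes D" and C: "C \<subseteq> verts H" and W0: "W0 \<subseteq> edges H" "card W0 \<le> 2 * K"
    and bnd: "nbhd H C - C \<subseteq> \<Union>W0" "nbhd H C - C \<subseteq> bag D p"
    and dis: "\<And>u. u \<in> nodes D \<Longrightarrow> bag D u \<inter> C = {}"
    using pend by auto
  have T: "rooted_tree (nodes D) (root D) (arcs D)"
    and nd: "\<And>u. u \<in> nodes D \<Longrightarrow> u \<in> bag D u \<and> bag D u \<subseteq> verts H \<and>
       (\<exists>L\<subseteq>edges H. card L \<le> 3 * K + 1 \<and> bag D u \<subseteq> \<Union>L \<and> cover D u = edge_indicator L)"
    and con: "\<And>v. v \<in> verts H \<Longrightarrow> connected_in (arcs D) {u \<in> nodes D. v \<in> bag D u}"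
    using pd unfolding partial_decomp_def by auto
  have WE: "W \<subseteq> edges H" using W0 e0 unfolding W by blast
  have "card W \<le> Suc (card W0)" unfolding W by (rule card_insert_le_m1) auto
  then have cW: "card W \<le> 2 * K + 1" using W0 by linarith
  have bW: "nbhd H C - C \<subseteq> \<Union>W" using bnd(1) unfolding W by blast
  interpret sp: task_split H K C W S Zs L B
    by unfold_locales (fact H C WE split bW L B)+
  have vB: "v \<in> B"
  proof -
    have "e0 \<subseteq> nbhd H C" by (rule nbhd_edge) (use e0 v in auto)
    then show ?thesis using e0 unfolding B L W by blast
  qed
  show vN: "v \<notin> nodes D" using nd dis v by blast
  then show "p \<noteq> v" using p by blast
  have Dv: "bag ?D v = B" "cover ?D v = edge_indicator L" and Du: "\<And>u. u \<noteq> v \<Longrightarrow> bag ?D u = bag D u \<and> cover ?D u = cover D u"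
    and Dn: "nodes ?D = insert v (nodes D)" "arcs ?D = insert (p, v) (arcs D)" "root ?D = root D"
    unfolding extend_def by auto
  have Bnb: "B \<subseteq> nbhd H C" unfolding B by blast
  have neq: "u \<noteq> v" if "u \<in> nodes D" for u using that vN by blast
  show "verts H - \<Union>(bag ?D ` nodes ?D) \<subset> verts H - \<Union>(bag D ` nodes D)"
  proof -
    let ?U = "\<Union>(bag D ` nodes D)"
    have "bag ?D ` nodes ?D = insert B (bag D ` nodes D)"
      unfolding Dn(1) image_insert Dv(1) using Du neq by (metis (no_types, lifting) image_cong)
    then have eq: "\<Union>(bag ?D ` nodes ?D) = B \<union> ?U" by simp
    have vV: "v \<in> verts H - ?U" using v C dis by blast
    show ?thesis unfolding eq
    proof (rule psubsetI)
      show "verts H - (B \<union> ?U) \<subseteq> verts H - ?U" by (rule Diff_mono) auto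
      have "v \<notin> verts H - (B \<union> ?U)" using vB by simp
      then show "verts H - (B \<union> ?U) \<noteq> verts H - ?U" using vV by metis
    qed
  qed
  have "partial_decomp H K ?D" unfolding partial_decomp_def
  proof (intro conjI ballI)
    show "rooted_tree (nodes ?D) (root ?D) (arcs ?D)"
      unfolding Dn by (rule rooted_tree_add_leaf[OF T vN p])
  next
    fix u assume u: "u \<in> nodes ?D"
    have "u \<in> bag ?D u \<and> bag ?D u \<subseteq> verts H \<and>
      (\<exists>L\<subseteq>edges H. card L \<le> 3 * K + 1 \<and> bag ?D u \<subseteq> \<Union>L \<and> cover ?D u = edge_indicator L)"
    proof (cases "u = v")
      case True
      show ?thesis unfolding True Dv using vB sp.bag_props[OF cW] by (intro conjI exI[of _ L]) auto
    next
      case False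
      then have "u \<in> nodes D" using u Dn by auto
      from nd[OF this] show ?thesis using Du[OF False] by simp
    qed
    then show "u \<in> bag ?D u" "bag ?D u \<subseteq> verts H"
      "\<exists>L\<subseteq>edges H. card L \<le> 3 * K + 1 \<and> bag ?D u \<subseteq> \<Union>L \<and> cover ?D u = edge_indicator L"
      by auto
  next
    fix x assume x: "x \<in> verts H"
    let ?S = "{u \<in> nodes D. x \<in> bag D u}"
    have sub: "arcs D \<subseteq> arcs ?D" unfolding Dn by blast
    show "connected_in (arcs ?D) {u \<in> nodes ?D. x \<in> bag ?D u}"
    proof (cases "x \<in> B")
      case False
      then have "{u \<in> nodes ?D. x \<in> bag ?D u} = ?S" using Dn(1) Dv Du neq by auto
      then show ?thesis using connected_in_mono[OF con[OF x] sub] by simp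
    next
      case True
      then have eq: "{u \<in> nodes ?D. x \<in> bag ?D u} = insert v ?S" using Dn(1) Dv Du neq by auto
      show ?thesis
      proof (cases "x \<in> C")
        case True
        then have S: "?S = {}" using dis by blast
        show ?thesis unfolding eq S by (rule connected_in_singleton)
      next
        case False
        then have "p \<in> ?S" using True Bnb bnd(2) p by blast
        then show ?thesis unfolding eq
          by (intro connected_in_insert[OF connected_in_mono[OF con[OF x] sub]]) (auto simp: Dn)
      qed
    qed
  qed
  moreover have "pending H K ?D t" if t: "t \<in> set (subtask_list v C W S B Zs @ ts)" for t
  proof (cases "t \<in> set ts")
    case True
    obtain p' C' W' where t': "t = (p', C', W')" by (cases t)
    have pt: "pending H K D (p', C', W')" using pts[OF True] t' by simp
    then have p': "p' \<in> nodes D" by simp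
    \<comment> \<open>The new bag lies in C \<union> bag D p, and both of these avoid the parts of
      the other tasks.\<close>
    have "C \<inter> C' = {}" using dts[OF True] t' by simp
    moreover have "bag D p \<inter> C' = {}" using pt p by simp
    then have "(nbhd H C - C) \<inter> C' = {}" using bnd(2) by blast
    ultimately have "B \<inter> C' = {}" using Bnb by blast
    then show ?thesis using pt Du[OF neq[OF p']] Dv Du neq unfolding t' pending.simps Dn by auto
  next
    case False
    then have "t \<in> set (subtask_list v C W S B Zs)" using t by simp
    then obtain Z where Z: "Z \<in> set Zs" and t': "t = (v, C \<inter> Z - B, S \<union> {w \<in> W. w \<inter> Z \<noteq> {}})"
      and ne: "C \<inter> Z - B \<noteq> {}" by (rule sp.subtask_list_memE)
    have "bag ?D u \<inter> (C \<inter> Z - B) = {}" if "u \<in> nodes ?D" for u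
      using that dis Dn(1) Dv Du by (cases "u = v") auto
    then show ?thesis unfolding t' pending.simps
      using ne C sp.sub_W(2) sp.sub_card[OF Z] sp.sub_boundary[OF Z] Dv(1) Dn(1)
      by (intro conjI) auto
  qed
  moreover have "sorted_wrt (\<lambda>t t'. task_verts t \<inter> task_verts t' = {}) (subtask_list v C W S B Zs @ ts)"
    unfolding sorted_wrt_append
  proof (intro conjI ballI)
    show "sorted_wrt (\<lambda>t t'. task_verts t \<inter> task_verts t' = {}) (subtask_list v C W S B Zs)" by (rule sp.sorted_subtasks)
    show "sorted_wrt (\<lambda>t t'. task_verts t \<inter> task_verts t' = {}) ts" by (rule srt)
    fix t t' assume t: "t \<in> set (subtask_list v C W S B Zs)" and t': "t' \<in> set ts"
    from t obtain Z where "t = (v, C \<inter> Z - B, S \<union> {w \<in> W. w \<inter> Z \<noteq> {}})"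
      by (rule sp.subtask_list_memE)
    then show "task_verts t \<inter> task_verts t' = {}" using dts[OF t'] by auto
  qed
  moreover have "(\<exists>u\<in>nodes ?D. e \<subseteq> bag ?D u) \<or> (\<exists>t\<in>set (subtask_list v C W S B Zs @ ts). e \<inter> task_verts t \<noteq> {})"
    if e: "e \<in> edges H" for e
  proof -
    consider "\<exists>u\<in>nodes D. e \<subseteq> bag D u" | "e \<inter> C \<noteq> {}" | "\<exists>t\<in>set ts. e \<inter> task_verts t \<noteq> {}"
      using cov[OF e] by blast
    then show ?thesis
    proof cases
      case 1
      then obtain u where "u \<in> nodes D" "e \<subseteq> bag D u" by blast
      then show ?thesis using Du[OF neq] Dn(1) by auto
    next
      case 2
      from sp.edge_subtask[OF e this, of v] show ?thesis using Dv(1) Dn(1) by auto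
    next
      case 3
      then show ?thesis by auto
    qed
  qed
  ultimately show "decomp_inv H K (subtask_list v C W S B Zs @ ts) ?D"
    unfolding decomp_inv_def by blast
qed

text \<open>The first node has no parent to hang from, so it is treated separately; its part is the
  whole vertex set, whose boundary is empty.\<close>

lemma decomp_inv_init:
  assumes H: "hypergraph H" and e0: "e0 \<in> edges H" "v \<in> e0" and v: "v \<in> verts H"
    and W: "W = {e0}" and split: "balanced_split H K W S Zs"
    and L: "L = W \<union> S" and B: "B = nbhd H (verts H) \<inter> \<Union>L"
    and D: "nodes D = {v}" "root D = v" "arcs D = {}" "bag D v = B" "cover D v = edge_indicator L"
  shows "decomp_inv H K (subtask_list v (verts H) W S B Zs) D"
    and "card (verts H - \<Union>(bag D ` nodes D)) < card (verts H)"
proof -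
  let ?C = "verts H"
  have nb: "nbhd H ?C - ?C = {}" using H unfolding nbhd_def hypergraph_def by blast
  have WE: "W \<subseteq> edges H" "card W \<le> 2 * K + 1" using e0 unfolding W by auto
  interpret sp: task_split H K ?C W S Zs L B
    by unfold_locales (use H WE split nb L B in auto)
  have vB: "v \<in> B"
  proof -
    have "e0 \<subseteq> nbhd H ?C" by (rule nbhd_edge) (use e0 v in auto)
    then show ?thesis using e0 unfolding B L W by blast
  qed
  have "verts H - \<Union>(bag D ` nodes D) \<subset> verts H" using v vB D by auto
  moreover have fin: "finite (verts H)" using H unfolding hypergraph_def by blast
  ultimately show "card (verts H - \<Union>(bag D ` nodes D)) < card (verts H)" by (rule psubset_card_mono[rotated])
  have "partial_decomp H K D" unfolding partial_decomp_def
  proof (intro conjI ballI)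
    show "rooted_tree (nodes D) (root D) (arcs D)" unfolding rooted_tree_def D by auto
  next
    fix u assume "u \<in> nodes D"
    then have u: "u = v" using D by simp
    show "u \<in> bag D u" "bag D u \<subseteq> verts H"
      "\<exists>L\<subseteq>edges H. card L \<le> 3 * K + 1 \<and> bag D u \<subseteq> \<Union>L \<and> cover D u = edge_indicator L"
      unfolding u D using vB sp.bag_props[OF WE(2)] by auto
  next
    fix x
    show "connected_in (arcs D) {u \<in> nodes D. x \<in> bag D u}" unfolding connected_in_def D by auto
  qed
  moreover have "pending H K D t" if t: "t \<in> set (subtask_list v ?C W S B Zs)" for t
  proof -
    from t obtain Z where Z: "Z \<in> set Zs" and t': "t = (v, ?C \<inter> Z - B, S \<union> {w \<in> W. w \<inter> Z \<noteq> {}})"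
      and ne: "?C \<inter> Z - B \<noteq> {}" by (rule sp.subtask_list_memE)
    show ?thesis unfolding t' pending.simps
      using ne sp.sub_W(2) sp.sub_card[OF Z] sp.sub_boundary[OF Z] D by (intro conjI) auto
  qed
  moreover have "(\<exists>u\<in>nodes D. e \<subseteq> bag D u) \<or> (\<exists>t\<in>set (subtask_list v ?C W S B Zs). e \<inter> task_verts t \<noteq> {})"
    if e: "e \<in> edges H" for e
  proof -
    have "e \<inter> ?C \<noteq> {}" using H e unfolding hypergraph_def by blast
    from sp.edge_subtask[OF e this, of v] show ?thesis using D by auto
  qed
  ultimately show "decomp_inv H K (subtask_list v ?C W S B Zs) D"
    unfolding decomp_inv_def using sp.sorted_subtasks by blast
qed

section \<open>From the invariant without tasks to a decomposition of bounded width\<close>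

lemma weight_edge_indicator:
  assumes "finite (edges H)" "L \<subseteq> edges H"
  shows "weight H (edge_indicator L) = real (card L)"
proof -
  have "weight H (edge_indicator L) = (\<Sum>e\<in>edges H \<inter> L. 1)"
    unfolding weight_def edge_indicator_def using assms(1) by (subst sum.inter_restrict) auto
  then show ?thesis using assms(2) by (simp add: Int_absorb1)
qed

lemma covered_edge_indicator:
  assumes "finite (edges H)" "L \<subseteq> edges H" "B \<subseteq> verts H" "B \<subseteq> \<Union>L"
  shows "B \<subseteq> covered H (edge_indicator L)"
proof
  fix v assume v: "v \<in> B"
  then obtain e where e: "e \<in> L" "v \<in> e" using assms by blast
  have "edge_indicator L e \<le> (\<Sum>e\<in>{e \<in> edges H. v \<in> e}. edge_indicator L e)"
    using assms e by (intro member_le_sum) (auto simp: edge_indicator_def)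
  then show "v \<in> covered H (edge_indicator L)"
    using v e assms(3) unfolding covered_def by (auto simp: edge_indicator_def)
qed

lemma decomp_inv_final:
  assumes inv: "decomp_inv H K [] D" and E: "finite (edges H)"
  shows "fhd H D" "width H D \<le> 3 * real K + 1"
proof -
  have T: "rooted_tree (nodes D) (root D) (arcs D)"
    and nd: "\<And>u. u \<in> nodes D \<Longrightarrow> u \<in> bag D u \<and> bag D u \<subseteq> verts H \<and>
       (\<exists>L\<subseteq>edges H. card L \<le> 3 * K + 1 \<and> bag D u \<subseteq> \<Union>L \<and> cover D u = edge_indicator L)"
    and con: "\<And>v. v \<in> verts H \<Longrightarrow> connected_in (arcs D) {u \<in> nodes D. v \<in> bag D u}"
    and cov: "\<And>e. e \<in> edges H \<Longrightarrow> \<exists>u\<in>nodes D. e \<subseteq> bag D u"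
    using inv unfolding decomp_inv_def partial_decomp_def by auto
  show "fhd H D" unfolding fhd_def tree_decomposition_def
  proof (intro conjI ballI T con cov)
    fix u assume u: "u \<in> nodes D"
    obtain L where L: "L \<subseteq> edges H" "bag D u \<subseteq> \<Union>L" "cover D u = edge_indicator L"
      using nd[OF u] by blast
    show "bag D u \<subseteq> verts H" using nd[OF u] by blast
    show "bag D u \<subseteq> covered H (cover D u)"
      unfolding L(3) using nd[OF u] L E by (intro covered_edge_indicator) auto
    show "0 \<le> cover D u e" "cover D u e \<le> 1" for e unfolding L(3) edge_indicator_def by auto
  qed
  have "weight H (cover D u) \<le> 3 * real K + 1" if u: "u \<in> nodes D" for u
  proof -
    obtain L where L: "L \<subseteq> edges H" "card L \<le> 3 * K + 1" "cover D u = edge_indicator L"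
      using nd[OF u] by blast
    then show ?thesis using weight_edge_indicator[OF E L(1)] by simp
  qed
  moreover have "finite (nodes D)" "nodes D \<noteq> {}" using T unfolding rooted_tree_def by auto
  ultimately show "width H D \<le> 3 * real K + 1" unfolding width_def by (subst Max_le_iff) auto
qed

section \<open>Closure properties of polynomial time\<close>

lemma poly_nat_mono: "x \<le> y \<Longrightarrow> poly (p :: nat poly) x \<le> poly p y"
  by (induction p) (auto intro!: add_mono mult_mono)

lemma dsize_pos [simp]: "0 < dsize x"
  by (cases x) auto

text \<open>Every tree, read along its right spine, encodes exactly one list. List operations are
  thereby total and meaningful on all inputs, with no notion of well-formed data.\<close>

fun dlist :: "data \<Rightarrow> data list" where
  "dlist Atom = []"
| "dlist (Pair a b) = a # dlist b"

lemma enc_list_dlist [simp]: "enc_list (dlist x) = x"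
  by (induction x) auto

lemma dlist_enc_list [simp]: "dlist (enc_list xs) = xs"
  by (induction xs) auto

lemma dlist_eq_Nil_iff [simp]: "dlist x = [] \<longleftrightarrow> x = Atom"
  by (cases x) auto

lemma dsize_dlist: "dsize x = Suc (\<Sum>a\<leftarrow>dlist x. Suc (dsize a))"
  by (induction x) auto

lemma dsize_elem_le: "a \<in> set (dlist x) \<Longrightarrow> dsize a \<le> dsize x"
  by (induction x) auto

lemma length_dlist_le: "length (dlist x) \<le> dsize x"
  by (induction x) auto

lemma dbool_eq_Atom_iff [simp]: "dbool b = Atom \<longleftrightarrow> \<not> b"
  by (simp add: dbool_def)

lemma dsize_eval_le: "dsize (eval e s) \<le> ecost e s"
  by (induction e) auto

text \<open>An assignment costs at least the size of the value that it stores, so time limits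
  growth. A polynomial time bound thus yields a polynomial bound on the output, which composition
  relies on.\<close>

lemma exec_dsize_le: "exec c s t s' \<Longrightarrow> dsize (s' i) \<le> dsize (s i) + t"
proof (induction arbitrary: i rule: exec.induct)
  case (exec_Assign j e s)
  then show ?case using dsize_eval_le[of e s] by simp
next
  case (exec_Seq c1 s t1 s1 c2 t2 s2)
  from exec_Seq.IH(1)[of i] exec_Seq.IH(2)[of i] show ?case by linarith
next
  case (exec_IfTrue e s c1 t s' c2)
  from exec_IfTrue.IH[of i] show ?case by linarith
next
  case (exec_IfFalse e s c1 t s' c2)
  from exec_IfFalse.IH[of i] show ?case by linarith
next
  case (exec_WhileTrue e s c t1 s1 t2 s2)
  from exec_WhileTrue.IH(1)[of i] exec_WhileTrue.IH(2)[of i] show ?case by linarith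
qed simp_all

text \<open>A program for \<open>f\<close> is required at every offset \<open>n\<close>, leaving the variables below \<open>n\<close> alone and
  not relying on the values of those above, so that programs can be nested. The time bound does
  not depend on the offset.\<close>

definition runs :: "nat \<Rightarrow> com \<Rightarrow> (data \<Rightarrow> data) \<Rightarrow> nat poly \<Rightarrow> bool" where
  "runs n c f p \<longleftrightarrow> (\<forall>s. \<exists>t s'. exec c s t s' \<and> s' n = f (s n) \<and> (\<forall>i<n. s' i = s i) \<and>
     t \<le> poly p (dsize (s n)))"

definition ptime :: "(data \<Rightarrow> data) \<Rightarrow> bool" where
  "ptime f \<longleftrightarrow> (\<exists>p. \<forall>n. \<exists>c. runs n c f p)"

lemma runsE:
  assumes "runs n c f p"
  obtains t s' where "exec c s t s'" "s' n = f (s n)" "\<And>i. i < n \<Longrightarrow> s' i = s i"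
    "t \<le> poly p (dsize (s n))"
  using assms unfolding runs_def by metis

lemma ptime_imp_polytime: "ptime f \<Longrightarrow> polytime f"
  unfolding ptime_def polytime_def runs_def
  by (metis fun_upd_same)

lemma runs_dsize_le:
  assumes "runs n c f p"
  shows "dsize (f x) \<le> dsize x + poly p (dsize x)"
proof -
  obtain t s' where "exec c (\<lambda>_. x) t s'" "s' n = f x" "t \<le> poly p (dsize x)"
    using assms by (rule runsE[where s = "\<lambda>_. x"])
  then show ?thesis using exec_dsize_le[of c "\<lambda>_. x" t s' n] by simp
qed

lemma ptime_dsize_le:
  assumes "ptime f"
  obtains q :: "nat poly" where "\<And>x. dsize (f x) \<le> poly q (dsize x)"
proof -
  obtain p c where "runs 0 c f p" using assms unfolding ptime_def by metis
  then have "dsize (f x) \<le> poly ([:0, 1:] + p) (dsize x)" for x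
    using runs_dsize_le by simp
  then show ?thesis using that by blast
qed

lemma ptimeI:
  assumes "\<And>n. \<exists>c. \<forall>s. \<exists>t s'. exec c s t s' \<and> s' n = f (s n) \<and> (\<forall>i<n. s' i = s i) \<and>
     t \<le> poly p (dsize (s n))"
  shows "ptime f"
  using assms unfolding ptime_def runs_def by blast

lemma runs_witness:
  assumes "exec c s t s'" "s' n = v" "\<And>i. i < n \<Longrightarrow> s' i = s i" "t \<le> b"
  shows "\<exists>t s'. exec c s t s' \<and> s' n = v \<and> (\<forall>i<n. s' i = s i) \<and> t \<le> b"
  using assms by blast

lemma ptime_Assign:
  assumes "\<And>n s. eval (e n) s = f (s n)" "\<And>n s. ecost (e n) s + 1 \<le> poly p (dsize (s n))"
  shows "ptime f"
proof (rule ptimeI)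
  fix n
  show "\<exists>c. \<forall>s. \<exists>t s'. exec c s t s' \<and> s' n = f (s n) \<and> (\<forall>i<n. s' i = s i) \<and>
     t \<le> poly p (dsize (s n))"
  proof (intro exI[of _ "Assign n (e n)"] allI)
    fix s :: store
    show "\<exists>t s'. exec (Assign n (e n)) s t s' \<and> s' n = f (s n) \<and> (\<forall>i<n. s' i = s i) \<and>
      t \<le> poly p (dsize (s n))"
      by (rule runs_witness[OF exec_Assign]) (use assms in auto)
  qed
qed

text \<open>With these rules as introduction rules, the proof that a function is computable in
  polynomial time follows the shape of its definition.\<close>

named_theorems pt

section \<open>Constants, composition, pairing, tests and loops\<close>

lemma ptime_id [pt]: "ptime (\<lambda>x. x)"
  by (rule ptime_Assign[where e = EVar and p = "[:1, 1:]"]) auto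

fun const_exp :: "data \<Rightarrow> exp" where
  "const_exp Atom = EAtom"
| "const_exp (Pair a b) = EPair (const_exp a) (const_exp b)"

lemma eval_const_exp: "eval (const_exp a) s = a"
  by (induction a) auto

lemma ecost_const_exp: "ecost (const_exp a) s = ecost (const_exp a) s'"
  by (induction a) (auto simp: eval_const_exp)

lemma ptime_const [pt]: "ptime (\<lambda>_. a)"
  by (rule ptime_Assign[where e = "\<lambda>_. const_exp a" and p = "[:ecost (const_exp a) (\<lambda>_. Atom) + 1:]"])
    (auto simp: eval_const_exp intro: ecost_const_exp eq_imp_le)

lemma ptime_comp:
  assumes "ptime f" "ptime g"
  shows "ptime (\<lambda>x. g (f x))"
proof -
  obtain p where p: "\<And>n. \<exists>c. runs n c f p" using assms(1) unfolding ptime_def by blast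
  obtain q where q: "\<And>n. \<exists>c. runs n c g q" using assms(2) unfolding ptime_def by blast
  obtain r where r: "\<And>x. dsize (f x) \<le> poly r (dsize x)" using ptime_dsize_le[OF assms(1)] by blast
  show ?thesis
  proof (rule ptimeI[where p = "p + pcompose q r + 1"])
    fix n
    obtain c1 c2 where c1: "runs n c1 f p" and c2: "runs n c2 g q" using p q by metis
    show "\<exists>c. \<forall>s. \<exists>t s'. exec c s t s' \<and> s' n = g (f (s n)) \<and> (\<forall>i<n. s' i = s i) \<and>
     t \<le> poly (p + pcompose q r + 1) (dsize (s n))"
    proof (intro exI[of _ "Seq c1 c2"] allI)
      fix s :: store
      obtain t1 s1 where 1: "exec c1 s t1 s1" "s1 n = f (s n)" "\<And>i. i < n \<Longrightarrow> s1 i = s i"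
        "t1 \<le> poly p (dsize (s n))" using runsE[OF c1] by blast
      obtain t2 s2 where 2: "exec c2 s1 t2 s2" "s2 n = g (s1 n)" "\<And>i. i < n \<Longrightarrow> s2 i = s1 i"
        "t2 \<le> poly q (dsize (s1 n))" using runsE[OF c2] by blast
      have "t2 \<le> poly q (poly r (dsize (s n)))"
        using 1(2) 2(4) r poly_nat_mono by (metis le_trans)
      then have "t1 + t2 + 1 \<le> poly (p + pcompose q r + 1) (dsize (s n))"
        using 1(4) by (simp add: poly_pcompose)
      then show "\<exists>t s'. exec (Seq c1 c2) s t s' \<and> s' n = g (f (s n)) \<and> (\<forall>i<n. s' i = s i) \<and>
        t \<le> poly (p + pcompose q r + 1) (dsize (s n))"
        using exec_Seq[OF 1(1) 2(1)] 1 2 by (intro exI[of _ "t1 + t2 + 1"] exI[of _ s2]) auto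
    qed
  qed
qed

lemma dsize_dfst_le: "dsize (dfst x) \<le> dsize x" and dsize_dsnd_le: "dsize (dsnd x) \<le> dsize x"
  by (cases x; simp)+

lemma ptime_dfst [pt]: "ptime f \<Longrightarrow> ptime (\<lambda>x. dfst (f x))"
proof (rule ptime_comp[of f dfst], assumption)
  show "ptime dfst"
    by (rule ptime_Assign[where e = "\<lambda>n. EFst (EVar n)" and p = "[:1, 2:]"])
      (auto simp: dsize_dfst_le)
qed

lemma ptime_dsnd [pt]: "ptime f \<Longrightarrow> ptime (\<lambda>x. dsnd (f x))"
proof (rule ptime_comp[of f dsnd], assumption)
  show "ptime dsnd"
    by (rule ptime_Assign[where e = "\<lambda>n. ESnd (EVar n)" and p = "[:1, 2:]"])
      (auto simp: dsize_dsnd_le)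
qed

lemma ptime_Pair [pt]:
  assumes "ptime f" "ptime g"
  shows "ptime (\<lambda>x. Pair (f x) (g x))"
proof -
  obtain p where p: "\<And>n. \<exists>c. runs n c f p" using assms(1) unfolding ptime_def by blast
  obtain q where q: "\<And>n. \<exists>c. runs n c g q" using assms(2) unfolding ptime_def by blast
  let ?r = "smult 3 p + smult 3 q + [:8, 6:]"
  show ?thesis
  proof (rule ptimeI[where p = ?r])
    fix n
    obtain c1 c2 where c1: "runs (n + 1) c1 f p" and c2: "runs (n + 2) c2 g q" using p q by metis
    \<comment> \<open>Register n keeps the input. Running f at offset n + 1 protects it, and running
      g at offset n + 2 protects the result of f as well.\<close>
    let ?c = "Seq (Assign (n + 1) (EVar n)) (Seq c1 (Seq (Assign (n + 2) (EVar n)) (Seq c2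
      (Assign n (EPair (EVar (n + 1)) (EVar (n + 2)))))))"
    show "\<exists>c. \<forall>s. \<exists>t s'. exec c s t s' \<and> s' n = Pair (f (s n)) (g (s n)) \<and> (\<forall>i<n. s' i = s i) \<and>
     t \<le> poly ?r (dsize (s n))"
    proof (intro exI[of _ ?c] allI)
      fix s :: store
      let ?s1 = "s(n + 1 := s n)"
      obtain t2 s2 where 2: "exec c1 ?s1 t2 s2" "s2 (n + 1) = f (?s1 (n + 1))"
        "\<And>i. i < n + 1 \<Longrightarrow> s2 i = ?s1 i" "t2 \<le> poly p (dsize (?s1 (n + 1)))" using runsE[OF c1] by blast
      let ?s3 = "s2(n + 2 := s2 n)"
      obtain t4 s4 where 4: "exec c2 ?s3 t4 s4" "s4 (n + 2) = g (?s3 (n + 2))"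
        "\<And>i. i < n + 2 \<Longrightarrow> s4 i = ?s3 i" "t4 \<le> poly q (dsize (?s3 (n + 2)))" using runsE[OF c2] by blast
      have s2: "s2 n = s n" using 2(3)[of n] by simp
      have s4: "s4 (n + 1) = f (s n)" "s4 (n + 2) = g (s n)" "\<And>i. i < n \<Longrightarrow> s4 i = s i"
        using 2 4 s2 by auto
      let ?e = "EPair (EVar (n + 1)) (EVar (n + 2))"
      let ?s5 = "s4(n := eval ?e s4)"
      have ex: "exec ?c s (ecost (EVar n) s + 1 + (t2 + (ecost (EVar n) s2 + 1 + (t4 + (ecost ?e s4 + 1) + 1) + 1) + 1) + 1) ?s5"
        using exec_Assign[of "n + 1" "EVar n" s] exec_Assign[of "n + 2" "EVar n" s2]
          exec_Assign[of n ?e s4] 2(1) 4(1)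
        by (intro exec_Seq) simp_all
      have le: "ecost (EVar n) s + 1 + (t2 + (ecost (EVar n) s2 + 1 + (t4 + (ecost ?e s4 + 1) + 1) + 1) + 1) + 1
        \<le> poly ?r (dsize (s n))"
        using 2(4) 4(4) s2 s4 runs_dsize_le[OF c1, of "s n"] runs_dsize_le[OF c2, of "s n"] by simp
      show "\<exists>t s'. exec ?c s t s' \<and> s' n = Pair (f (s n)) (g (s n)) \<and> (\<forall>i<n. s' i = s i) \<and>
        t \<le> poly ?r (dsize (s n))"
        by (rule runs_witness[OF ex _ _ le]) (use s4 in auto)
    qed
  qed
qed

lemma ptime_eq [pt]:
  assumes "ptime f" "ptime g"
  shows "ptime (\<lambda>x. dbool (f x = g x))"
proof -
  have "ptime (\<lambda>x. dbool (dfst x = dsnd x))"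
  proof (rule ptime_Assign[where e = "\<lambda>n. EEq (EFst (EVar n)) (ESnd (EVar n))" and p = "[:4, 6:]"])
    fix n and s :: store
    have "dsize (dbool b) \<le> 3" for b by (simp add: dbool_def)
    from this[of "dfst (s n) = dsnd (s n)"] show "ecost (EEq (EFst (EVar n)) (ESnd (EVar n))) s + 1 \<le> poly [:4, 6:] (dsize (s n))"
      using dsize_dfst_le[of "s n"] dsize_dsnd_le[of "s n"] by simp
  qed simp
  from ptime_comp[OF ptime_Pair[OF assms] this] show ?thesis by simp
qed

lemma ptime_If [pt]:
  assumes "ptime (\<lambda>x. dbool (P x))" "ptime f" "ptime g"
  shows "ptime (\<lambda>x. if P x then f x else g x)"
proof -
  obtain o' where o': "\<And>n. \<exists>c. runs n c (\<lambda>x. dbool (P x)) o'" using assms(1) unfolding ptime_def by blast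
  obtain p where p: "\<And>n. \<exists>c. runs n c f p" using assms(2) unfolding ptime_def by blast
  obtain q where q: "\<And>n. \<exists>c. runs n c g q" using assms(3) unfolding ptime_def by blast
  let ?r = "o' + p + q + [:7, 1:]"
  show ?thesis
  proof (rule ptimeI[where p = ?r])
    fix n
    obtain c0 where c0: "runs (n + 1) c0 (\<lambda>x. dbool (P x)) o'" using o' by blast
    obtain c1 c2 where c1: "runs n c1 f p" and c2: "runs n c2 g q" using p q by metis
    let ?c = "Seq (Assign (n + 1) (EVar n)) (Seq c0 (If (EVar (n + 1)) c1 c2))"
    show "\<exists>c. \<forall>s. \<exists>t s'. exec c s t s' \<and> s' n = (if P (s n) then f (s n) else g (s n)) \<and> (\<forall>i<n. s' i = s i) \<and>
     t \<le> poly ?r (dsize (s n))"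
    proof (intro exI[of _ ?c] allI)
      fix s :: store
      let ?s1 = "s(n + 1 := s n)"
      obtain t2 s2 where 2: "exec c0 ?s1 t2 s2" "s2 (n + 1) = dbool (P (?s1 (n + 1)))"
        "\<And>i. i < n + 1 \<Longrightarrow> s2 i = ?s1 i" "t2 \<le> poly o' (dsize (?s1 (n + 1)))" using runsE[OF c0] by blast
      have s2: "s2 n = s n" "s2 (n + 1) = dbool (P (s n))" using 2(2) 2(3)[of n] by simp_all
      have "\<exists>t s'. exec (If (EVar (n + 1)) c1 c2) s2 (ecost (EVar (n + 1)) s2 + t + 1) s' \<and>
        s' n = (if P (s n) then f (s n) else g (s n)) \<and> (\<forall>i<n. s' i = s2 i) \<and>
        t \<le> poly p (dsize (s n)) + poly q (dsize (s n))"
      proof (cases "P (s n)")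
        case True
        obtain t s' where "exec c1 s2 t s'" "s' n = f (s2 n)" "\<And>i. i < n \<Longrightarrow> s' i = s2 i"
          "t \<le> poly p (dsize (s2 n))" using runsE[OF c1] by blast
        then show ?thesis using True s2 by (intro exI[of _ t] exI[of _ s'] conjI exec_IfTrue) auto
      next
        case False
        obtain t s' where "exec c2 s2 t s'" "s' n = g (s2 n)" "\<And>i. i < n \<Longrightarrow> s' i = s2 i"
          "t \<le> poly q (dsize (s2 n))" using runsE[OF c2] by blast
        then show ?thesis using False s2 by (intro exI[of _ t] exI[of _ s'] conjI exec_IfFalse) auto
      qed
      then obtain t s' where 3: "exec (If (EVar (n + 1)) c1 c2) s2 (ecost (EVar (n + 1)) s2 + t + 1) s'"
        "s' n = (if P (s n) then f (s n) else g (s n))" "\<forall>i<n. s' i = s2 i"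
        "t \<le> poly p (dsize (s n)) + poly q (dsize (s n))" by blast
      have "ecost (EVar (n + 1)) s2 \<le> 3" using s2 by (simp add: dbool_def)
      then have le: "(ecost (EVar n) s + 1) + (t2 + (ecost (EVar (n + 1)) s2 + t + 1) + 1) + 1 \<le> poly ?r (dsize (s n))"
        using 2(4) 3(4) by simp
      have ex: "exec ?c s ((ecost (EVar n) s + 1) + (t2 + (ecost (EVar (n + 1)) s2 + t + 1) + 1) + 1) s'"
        using exec_Assign[of "n + 1" "EVar n" s] 2(1) 3(1) by (intro exec_Seq) simp_all
      show "\<exists>t s'. exec ?c s t s' \<and> s' n = (if P (s n) then f (s n) else g (s n)) \<and>
        (\<forall>i<n. s' i = s i) \<and> t \<le> poly ?r (dsize (s n))"
        by (rule runs_witness[OF ex _ _ le]) (use 2(3) 3(2,3) in auto)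
    qed
  qed
qed

lemma ptime_not [pt]: "ptime (\<lambda>x. dbool (P x)) \<Longrightarrow> ptime (\<lambda>x. dbool (\<not> P x))"
proof -
  assume "ptime (\<lambda>x. dbool (P x))"
  moreover have "(\<lambda>x. dbool (\<not> P x)) = (\<lambda>x. if P x then dbool False else dbool True)" by auto
  ultimately show ?thesis using ptime_If ptime_const by simp
qed

lemma ptime_conj [pt]:
  assumes "ptime (\<lambda>x. dbool (P x))" "ptime (\<lambda>x. dbool (Q x))"
  shows "ptime (\<lambda>x. dbool (P x \<and> Q x))"
proof -
  have "(\<lambda>x. dbool (P x \<and> Q x)) = (\<lambda>x. if P x then dbool (Q x) else dbool False)" by auto
  then show ?thesis using ptime_If[OF assms ptime_const] by simp
qed

lemma ptime_disj [pt]: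
  assumes "ptime (\<lambda>x. dbool (P x))" "ptime (\<lambda>x. dbool (Q x))"
  shows "ptime (\<lambda>x. dbool (P x \<or> Q x))"
proof -
  have "(\<lambda>x. dbool (P x \<or> Q x)) = (\<lambda>x. if P x then dbool True else dbool (Q x))" by auto
  then show ?thesis using ptime_If[OF assms(1) ptime_const assms(2)] by simp
qed

text \<open>Register n holds the parameter, n + 1 the rest of the list, n + 2 the accumulator, and n
  + 3 the argument and result of the body. The bound M is imposed on the accumulators after all
  prefixes because the cost of each round depends on the current one.\<close>

lemma while_fold:
  assumes c: "runs (n + 3) c (\<lambda>y. g (dfst y) (dfst (dsnd y)) (dsnd (dsnd y))) p"
    and x: "s n = x" "dsize x \<le> M" and ys: "s (n + 1) = ys" "dsize ys \<le> M"
    and acc: "\<And>zs zs'. dlist ys = zs @ zs' \<Longrightarrow> dsize (fold (g x) zs (s (n + 2))) \<le> M"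
  shows "\<exists>t s'. exec (While (EVar (n + 1)) (Seq
      (Assign (n + 3) (EPair (EVar n) (EPair (EFst (EVar (n + 1))) (EVar (n + 2))))) (Seq c (Seq
      (Assign (n + 2) (EVar (n + 3))) (Assign (n + 1) (ESnd (EVar (n + 1)))))))) s t s' \<and>
    s' (n + 2) = fold (g x) (dlist ys) (s (n + 2)) \<and> (\<forall>i\<le>n. s' i = s i) \<and>
    t \<le> (length (dlist ys) + 1) * (poly p (3 * M + 2) + 20 * M + 20)"
    (is "\<exists>t s'. exec (While ?b ?c) s t s' \<and> _ \<and> _ \<and> t \<le> _ * ?T")
  using x ys acc
proof (induction ys arbitrary: s)
  case Atom
  then have "exec (While ?b ?c) s (ecost ?b s + 1) s" by (intro exec_WhileFalse) simp
  then show ?case using Atom by (intro exI[of _ "ecost ?b s + 1"] exI[of _ s]) simp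
next
  case (Pair a ys)
  let ?e = "EPair (EVar n) (EPair (EFst (EVar (n + 1))) (EVar (n + 2)))"
  let ?acc = "s (n + 2)"
  let ?s1 = "s(n + 3 := eval ?e s)"
  have accM: "dsize ?acc \<le> M" using Pair.prems(5)[of "[]"] by simp
  have gM: "dsize (g x a ?acc) \<le> M" using Pair.prems(5)[of "[a]"] by simp
  have s1: "?s1 (n + 3) = Pair x (Pair a ?acc)" using Pair.prems by simp
  obtain t2 s2 where 2: "exec c ?s1 t2 s2" "s2 (n + 3) = g x a ?acc"
    "\<And>i. i < n + 3 \<Longrightarrow> s2 i = ?s1 i" "t2 \<le> poly p (dsize (?s1 (n + 3)))"
    using runsE[OF c, of ?s1] s1 by auto
  have s2: "s2 n = x" "s2 (n + 1) = Pair a ys" "s2 (n + 2) = ?acc" using 2(3) Pair.prems by simp_all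
  let ?s3 = "s2(n + 2 := eval (EVar (n + 3)) s2)"
  let ?s4 = "?s3(n + 1 := eval (ESnd (EVar (n + 1))) ?s3)"
  have s4: "?s4 n = x" "?s4 (n + 1) = ys" "?s4 (n + 2) = g x a ?acc" "\<And>i. i \<le> n \<Longrightarrow> ?s4 i = s i"
    using 2 s2 by auto
  have "dsize (fold (g x) zs (?s4 (n + 2))) \<le> M" if "dlist ys = zs @ zs'" for zs zs'
    using Pair.prems(5)[of "a # zs" zs'] that s4 by simp
  moreover have "dsize ys \<le> M" using Pair.prems by simp
  ultimately obtain t s' where IH: "exec (While ?b ?c) ?s4 t s'"
    "s' (n + 2) = fold (g x) (dlist ys) (g x a ?acc)" "\<forall>i\<le>n. s' i = ?s4 i"
    "t \<le> (length (dlist ys) + 1) * ?T"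
    using Pair.IH[of ?s4] s4 Pair.prems(2) by metis
  let ?t = "(ecost ?e s + 1) + (t2 + ((ecost (EVar (n + 3)) s2 + 1) + (ecost (ESnd (EVar (n + 1))) ?s3 + 1) + 1) + 1) + 1"
  have body: "exec ?c s ?t ?s4"
    by (rule exec_Seq[OF exec_Assign exec_Seq[OF 2(1) exec_Seq[OF exec_Assign exec_Assign]]])
  have ex: "exec (While ?b ?c) s (ecost ?b s + ?t + t + 1) s'"
    by (rule exec_WhileTrue[OF _ body IH(1)]) (use Pair.prems in simp)
  have "t2 \<le> poly p (3 * M + 2)"
  proof -
    have "dsize (?s1 (n + 3)) \<le> 3 * M + 2"
      unfolding s1 using accM Pair.prems by simp
    then show ?thesis using 2(4) poly_nat_mono le_trans by blast
  qed
  moreover have "ecost ?b s \<le> M" "ecost ?e s \<le> 10 * M + 4" "ecost (EVar (n + 3)) s2 \<le> M"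
    "ecost (ESnd (EVar (n + 1))) ?s3 \<le> 2 * M"
    using Pair.prems accM gM 2(2) s2 by simp_all
  ultimately have "ecost ?b s + ?t + 1 \<le> ?T" by linarith
  then have "ecost ?b s + ?t + t + 1 \<le> (length (dlist (Pair a ys)) + 1) * ?T"
    using IH(4) by simp
  then show ?case using ex IH(2,3) s4 by (intro exI[of _ "ecost ?b s + ?t + t + 1"] exI[of _ s']) auto
qed

text \<open>A polynomial loop body is not enough, since an accumulator that doubles in each round
  grows exponentially; hence the hypothesis on all intermediate values. Here and below, several
  arguments reach a program as nested pairs, which explains the chains of \<open>dfst\<close> and
  \<open>dsnd\<close>.\<close>

lemma ptime_fold:
  fixes q :: "nat poly"
  assumes g: "ptime (\<lambda>y. g (dfst y) (dfst (dsnd y)) (dsnd (dsnd y)))"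
    and l: "ptime l" and i: "ptime i"
    and bound: "\<And>x zs zs'. dlist (l x) = zs @ zs' \<Longrightarrow> dsize (fold (g x) zs (i x)) \<le> poly q (dsize x)"
  shows "ptime (\<lambda>x. fold (g x) (dlist (l x)) (i x))"
proof -
  obtain p where p: "\<And>n. \<exists>c. runs n c (\<lambda>y. g (dfst y) (dfst (dsnd y)) (dsnd (dsnd y))) p"
    using g unfolding ptime_def by blast
  obtain pl where pl: "\<And>n. \<exists>c. runs n c l pl" using l unfolding ptime_def by blast
  obtain pi where pi: "\<And>n. \<exists>c. runs n c i pi" using i unfolding ptime_def by blast
  obtain ql where ql: "\<And>x. dsize (l x) \<le> poly ql (dsize x)" using ptime_dsize_le[OF l] by blast
  let ?M = "[:0, 1:] + ql + q"
  let ?T = "pcompose p (smult 3 ?M + 2) + smult 20 ?M + 20"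
  let ?r = "pl + pi + (ql + 1) * ?T + q + [:20, 2:]"
  show ?thesis
  proof (rule ptimeI[where p = ?r])
    fix n
    obtain c where c: "runs (n + 3) c (\<lambda>y. g (dfst y) (dfst (dsnd y)) (dsnd (dsnd y))) p" using p by blast
    obtain c1 c2 where c1: "runs (n + 1) c1 l pl" and c2: "runs (n + 2) c2 i pi" using pl pi by metis
    let ?w = "While (EVar (n + 1)) (Seq
      (Assign (n + 3) (EPair (EVar n) (EPair (EFst (EVar (n + 1))) (EVar (n + 2))))) (Seq c (Seq
      (Assign (n + 2) (EVar (n + 3))) (Assign (n + 1) (ESnd (EVar (n + 1)))))))"
    let ?c = "Seq (Assign (n + 1) (EVar n)) (Seq c1 (Seq (Assign (n + 2) (EVar n)) (Seq c2
      (Seq ?w (Assign n (EVar (n + 2)))))))"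
    show "\<exists>c. \<forall>s. \<exists>t s'. exec c s t s' \<and> s' n = fold (g (s n)) (dlist (l (s n))) (i (s n)) \<and>
      (\<forall>i<n. s' i = s i) \<and> t \<le> poly ?r (dsize (s n))"
    proof (intro exI[of _ ?c] allI)
      fix s :: store
      let ?x = "s n"
      let ?m = "poly ?M (dsize ?x)"
      let ?s1 = "s(n + 1 := s n)"
      obtain t2 s2 where 2: "exec c1 ?s1 t2 s2" "s2 (n + 1) = l (?s1 (n + 1))"
        "\<And>i. i < n + 1 \<Longrightarrow> s2 i = ?s1 i" "t2 \<le> poly pl (dsize (?s1 (n + 1)))" using runsE[OF c1] by blast
      let ?s3 = "s2(n + 2 := s2 n)"
      obtain t4 s4 where 4: "exec c2 ?s3 t4 s4" "s4 (n + 2) = i (?s3 (n + 2))"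
        "\<And>i. i < n + 2 \<Longrightarrow> s4 i = ?s3 i" "t4 \<le> poly pi (dsize (?s3 (n + 2)))" using runsE[OF c2] by blast
      have s2: "s2 n = ?x" using 2(3)[of n] by simp
      have s4: "s4 n = ?x" "s4 (n + 1) = l ?x" "s4 (n + 2) = i ?x" "\<And>i. i < n \<Longrightarrow> s4 i = s i"
        using 2 4 s2 by auto
      have lm: "dsize (l ?x) \<le> ?m" "dsize ?x \<le> ?m" using ql[of ?x] by simp_all
      have fold_le: "dsize (fold (g ?x) zs (s4 (n + 2))) \<le> ?m" if "dlist (l ?x) = zs @ zs'" for zs zs'
        using bound[OF that] s4 by simp
      obtain t5 s5 where 5: "exec ?w s4 t5 s5"
        "s5 (n + 2) = fold (g ?x) (dlist (l ?x)) (s4 (n + 2))" "\<forall>i\<le>n. s5 i = s4 i"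
        "t5 \<le> (length (dlist (l ?x)) + 1) * (poly p (3 * ?m + 2) + 20 * ?m + 20)"
        using while_fold[OF c s4(1) lm(2) s4(2) lm(1)] fold_le by blast
      let ?s6 = "s5(n := eval (EVar (n + 2)) s5)"
      let ?t = "ecost (EVar n) s + 1 + (t2 + (ecost (EVar n) s2 + 1 + (t4 + (t5 + (ecost (EVar (n + 2)) s5 + 1) + 1) + 1) + 1) + 1) + 1"
      have "exec (Assign (n + 1) (EVar n)) s (ecost (EVar n) s + 1) ?s1"
        "exec (Assign (n + 2) (EVar n)) s2 (ecost (EVar n) s2 + 1) ?s3"
        using exec_Assign[of "n + 1" "EVar n" s] exec_Assign[of "n + 2" "EVar n" s2] by simp_all
      then have ex: "exec ?c s ?t ?s6"
        by (intro exec_Seq[OF _ exec_Seq[OF 2(1) exec_Seq[OF _ exec_Seq[OF 4(1) exec_Seq[OF 5(1) exec_Assign]]]]])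
      have "t5 \<le> (poly ql (dsize ?x) + 1) * (poly p (3 * ?m + 2) + 20 * ?m + 20)"
        using 5(4) length_dlist_le[of "l ?x"] ql[of ?x]
        by (meson add_le_mono1 le_trans mult_le_mono1)
      also have "\<dots> = poly ((ql + 1) * ?T) (dsize ?x)"
        by (simp add: poly_pcompose)
      finally have t5: "t5 \<le> poly ((ql + 1) * ?T) (dsize ?x)" .
      have "ecost (EVar (n + 2)) s5 \<le> poly q (dsize ?x)"
        using 5(2) s4(3) bound[of ?x "dlist (l ?x)" "[]"] by simp
      moreover have "poly ?r (dsize ?x) = poly pl (dsize ?x) + poly pi (dsize ?x) + poly ((ql + 1) * ?T) (dsize ?x)
        + poly q (dsize ?x) + 20 + 2 * dsize ?x"
        by (simp only: poly_add) simp
      moreover have "t2 \<le> poly pl (dsize ?x)" "t4 \<le> poly pi (dsize ?x)"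
        "ecost (EVar n) s = dsize ?x" "ecost (EVar n) s2 = dsize ?x"
        using 2(4) 4(4) s2 by simp_all
      ultimately have le: "?t \<le> poly ?r (dsize ?x)" using t5 by linarith
      show "\<exists>t s'. exec ?c s t s' \<and> s' n = fold (g ?x) (dlist (l ?x)) (i ?x) \<and>
        (\<forall>i<n. s' i = s i) \<and> t \<le> poly ?r (dsize ?x)"
        by (rule runs_witness[OF ex _ _ le]) (use 5 s4 in auto)
    qed
  qed
qed

text \<open>Growth by an amount that depends on the input alone, and not on the accumulator, adds up
  to a polynomial over the rounds. All loops of the decomposition program are of this kind.\<close>

lemma ptime_fold_add:
  fixes r :: "nat poly"
  assumes g: "ptime (\<lambda>y. g (dfst y) (dfst (dsnd y)) (dsnd (dsnd y)))"
    and l: "ptime l" and i: "ptime i"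
    and incr: "\<And>x a acc. a \<in> set (dlist (l x)) \<Longrightarrow> dsize (g x a acc) \<le> dsize acc + poly r (dsize x)"
  shows "ptime (\<lambda>x. fold (g x) (dlist (l x)) (i x))"
proof -
  obtain ql where ql: "\<And>x. dsize (l x) \<le> poly ql (dsize x)" using ptime_dsize_le[OF l] by blast
  obtain qi where qi: "\<And>x. dsize (i x) \<le> poly qi (dsize x)" using ptime_dsize_le[OF i] by blast
  have fold_le: "dsize (fold (g x) zs acc) \<le> dsize acc + length zs * poly r (dsize x)"
    if "set zs \<subseteq> set (dlist (l x))" for x zs acc
    using that
  proof (induction zs arbitrary: acc)
    case (Cons a zs)
    then have "dsize (fold (g x) (a # zs) acc) \<le> dsize (g x a acc) + length zs * poly r (dsize x)" by simp
    moreover have "dsize (g x a acc) \<le> dsize acc + poly r (dsize x)" using Cons.prems incr by simp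
    ultimately show ?case by simp
  qed simp
  show ?thesis
  proof (rule ptime_fold[OF g l i, where q = "qi + ql * r"])
    fix x zs zs' assume eq: "dlist (l x) = zs @ zs'"
    then have "length zs \<le> poly ql (dsize x)"
      using length_dlist_le[of "l x"] ql[of x] by simp
    then have "length zs * poly r (dsize x) \<le> poly ql (dsize x) * poly r (dsize x)" by (rule mult_le_mono1)
    moreover have "set zs \<subseteq> set (dlist (l x))" using eq by simp
    from fold_le[OF this] have "dsize (fold (g x) zs (i x)) \<le> dsize (i x) + length zs * poly r (dsize x)" .
    ultimately show "dsize (fold (g x) zs (i x)) \<le> poly (qi + ql * r) (dsize x)"
      unfolding poly_add poly_mult using qi[of x] by linarith
  qed
qed

section \<open>List operations in polynomial time\<close>

definition dmap :: "(data \<Rightarrow> data) \<Rightarrow> data \<Rightarrow> data" where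
  "dmap f l = enc_list (map f (dlist l))"

definition dfilter :: "(data \<Rightarrow> bool) \<Rightarrow> data \<Rightarrow> data" where
  "dfilter P l = enc_list (filter P (dlist l))"

definition dappend :: "data \<Rightarrow> data \<Rightarrow> data" where
  "dappend l l' = enc_list (dlist l @ dlist l')"

definition dconcat :: "data \<Rightarrow> data" where
  "dconcat l = enc_list (concat (map dlist (dlist l)))"

abbreviation dset :: "data \<Rightarrow> data set" where
  "dset l \<equiv> set (dlist l)"

lemma dlist_simps [simp]:
  "dlist (dmap f l) = map f (dlist l)"
  "dlist (dfilter P l) = filter P (dlist l)"
  "dlist (dappend l l') = dlist l @ dlist l'"
  "dlist (dconcat l) = concat (map dlist (dlist l))"
  by (simp_all add: dmap_def dfilter_def dappend_def dconcat_def)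

lemma dlist_inj: "dlist x = dlist y \<longleftrightarrow> x = y"
  by (metis enc_list_dlist)

lemma dlist_fold_Pair: "dlist (fold (\<lambda>a acc. Pair (f a) acc) xs acc) = rev (map f xs) @ dlist acc"
  by (induction xs arbitrary: acc) auto

lemma elem_size_bound:
  assumes f: "ptime (\<lambda>y. f (dfst y) (dsnd y))" and l: "ptime l"
  obtains r :: "nat poly" where "\<And>x a. a \<in> dset (l x) \<Longrightarrow> dsize (f x a) \<le> poly r (dsize x)"
proof -
  obtain q where q: "\<And>y. dsize (f (dfst y) (dsnd y)) \<le> poly q (dsize y)" using ptime_dsize_le[OF f] by blast
  obtain ql where ql: "\<And>x. dsize (l x) \<le> poly ql (dsize x)" using ptime_dsize_le[OF l] by blast
  have "dsize (f x a) \<le> poly (pcompose q ([:1, 1:] + ql)) (dsize x)" if "a \<in> dset (l x)" for x a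
  proof -
    have "dsize a \<le> poly ql (dsize x)" using that dsize_elem_le ql le_trans by blast
    then have "dsize (Pair x a) \<le> poly ([:1, 1:] + ql) (dsize x)" by simp
    then have "poly q (dsize (Pair x a)) \<le> poly q (poly ([:1, 1:] + ql) (dsize x))" by (rule poly_nat_mono)
    moreover have "dsize (f x a) \<le> poly q (dsize (Pair x a))" using q[of "Pair x a"] by simp
    ultimately show ?thesis by (simp add: poly_pcompose)
  qed
  then show ?thesis using that by blast
qed

lemma ptime_uncurry3:
  assumes "ptime (\<lambda>y. f (dfst y) (dsnd y))"
  shows "ptime (\<lambda>y. f (dfst y) (dfst (dsnd y)))"
proof -
  have "ptime (\<lambda>y. Pair (dfst y) (dfst (dsnd y)))" by (intro pt)
  from ptime_comp[OF this assms] show ?thesis by simp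
qed

text \<open>Consing in a left-to-right loop reverses the list, so the reversal is made part of the
  statement. One loop then serves for reversing, appending and, after a second reversal,
  mapping.\<close>

lemma ptime_rev_map:
  assumes f: "ptime (\<lambda>y. f (dfst y) (dsnd y))" and l: "ptime l" and i: "ptime i"
  shows "ptime (\<lambda>x. enc_list (rev (map (f x) (dlist (l x))) @ dlist (i x)))"
proof -
  obtain r where r: "\<And>x a. a \<in> dset (l x) \<Longrightarrow> dsize (f x a) \<le> poly r (dsize x)"
    using elem_size_bound[OF f l] by blast
  have "ptime (\<lambda>x. fold (\<lambda>a acc. Pair (f x a) acc) (dlist (l x)) (i x))"
  proof (rule ptime_fold_add[OF _ l i, where r = "r + 1"])
    show "ptime (\<lambda>y. Pair (f (dfst y) (dfst (dsnd y))) (dsnd (dsnd y)))"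
      by (intro pt ptime_uncurry3 f)
  qed (use r in simp)
  moreover have "fold (\<lambda>a acc. Pair (f x a) acc) (dlist (l x)) (i x) =
      enc_list (rev (map (f x) (dlist (l x))) @ dlist (i x))" for x
    by (simp add: dlist_inj[symmetric] dlist_fold_Pair)
  ultimately show ?thesis by simp
qed

lemma ptime_rev: "ptime l \<Longrightarrow> ptime (\<lambda>x. enc_list (rev (dlist (l x))))"
  using ptime_rev_map[of "\<lambda>x a. a" l "\<lambda>_. Atom"] by (simp add: ptime_dsnd ptime_id ptime_const)

lemma ptime_dappend [pt]:
  assumes "ptime l" "ptime l'"
  shows "ptime (\<lambda>x. dappend (l x) (l' x))"
  using ptime_rev_map[of "\<lambda>x a. a", OF _ ptime_rev[OF assms(1)] assms(2)]
  by (simp add: ptime_dsnd ptime_id dappend_def)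

lemma ptime_dmap [pt]:
  assumes "ptime (\<lambda>y. f (dfst y) (dsnd y))" "ptime l"
  shows "ptime (\<lambda>x. dmap (\<lambda>a. f x a) (l x))"
  using ptime_rev_map[OF assms(1) ptime_rev[OF assms(2)] ptime_const[of Atom]]
  by (simp add: rev_map dmap_def)

lemma ptime_dconcat [pt]:
  assumes l: "ptime l"
  shows "ptime (\<lambda>x. dconcat (l x))"
proof -
  obtain ql where ql: "\<And>x. dsize (l x) \<le> poly ql (dsize x)" using ptime_dsize_le[OF l] by blast
  have "ptime (\<lambda>x. fold (\<lambda>a acc. dappend a acc) (dlist (enc_list (rev (dlist (l x))))) Atom)"
  proof (rule ptime_fold_add[where r = ql])
    show "ptime (\<lambda>x. enc_list (rev (dlist (l x))))" by (rule ptime_rev[OF l])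
    fix x a acc assume "a \<in> dset (enc_list (rev (dlist (l x))))"
    then have "dsize a \<le> poly ql (dsize x)" using dsize_elem_le[of a "l x"] ql[of x] by simp
    moreover have "dsize (dappend a acc) \<le> dsize acc + dsize a"
      by (simp add: dsize_dlist[of "dappend a acc"] dsize_dlist[of a] dsize_dlist[of acc])
    ultimately show "dsize (dappend a acc) \<le> dsize acc + poly ql (dsize x)" by linarith
  qed (intro pt)+
  moreover have "dlist (fold (\<lambda>a acc. dappend a acc) xs acc) = concat (map dlist (rev xs)) @ dlist acc" for xs acc
    by (induction xs arbitrary: acc) auto
  then have "fold (\<lambda>a acc. dappend a acc) (rev (dlist (l x))) Atom = dconcat (l x)" for x
    by (simp add: dlist_inj[symmetric])
  ultimately show ?thesis by simp
qed

lemma ptime_dfilter [pt]: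
  assumes P: "ptime (\<lambda>y. dbool (P (dfst y) (dsnd y)))" and l: "ptime l"
  shows "ptime (\<lambda>x. dfilter (\<lambda>a. P x a) (l x))"
proof -
  have "ptime (\<lambda>x. dconcat (dmap (\<lambda>a. if P x a then Pair a Atom else Atom) (l x)))"
    by (intro pt P l)
  moreover have "concat (map (\<lambda>a. dlist (if P a then Pair a Atom else Atom)) xs) = filter P xs"
    for P :: "data \<Rightarrow> bool" and xs
    by (induction xs) auto
  then have "dconcat (dmap (\<lambda>a. if P x a then Pair a Atom else Atom) (l x)) = dfilter (\<lambda>a. P x a) (l x)" for x
    by (simp add: dlist_inj[symmetric] o_def)
  ultimately show ?thesis by simp
qed

lemma ptime_Bex [pt]:
  assumes P: "ptime (\<lambda>y. dbool (P (dfst y) (dsnd y)))" and l: "ptime l"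
  shows "ptime (\<lambda>x. dbool (\<exists>a\<in>dset (l x). P x a))"
proof -
  have "ptime (\<lambda>x. dbool (dfilter (\<lambda>a. P x a) (l x) \<noteq> Atom))"
    by (intro pt P l)
  moreover have "dfilter (\<lambda>a. P x a) (l x) \<noteq> Atom \<longleftrightarrow> (\<exists>a\<in>dset (l x). P x a)" for x
    unfolding dlist_eq_Nil_iff[symmetric] by (simp add: filter_empty_conv)
  ultimately show ?thesis by simp
qed

lemma ptime_Ball [pt]:
  assumes P: "ptime (\<lambda>y. dbool (P (dfst y) (dsnd y)))" and l: "ptime l"
  shows "ptime (\<lambda>x. dbool (\<forall>a\<in>dset (l x). P x a))"
proof -
  have "ptime (\<lambda>x. dbool (\<not> (\<exists>a\<in>dset (l x). \<not> P x a)))" by (intro pt P l)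
  then show ?thesis by simp
qed

lemma ptime_member [pt]:
  assumes "ptime f" "ptime l"
  shows "ptime (\<lambda>x. dbool (f x \<in> dset (l x)))"
proof -
  have "ptime (\<lambda>x. dbool (\<exists>a\<in>dset (l x). a = f x))"
    by (rule ptime_Bex[OF _ assms(2)]) (intro pt ptime_comp[OF _ assms(1)])
  then show ?thesis by simp
qed

text \<open>The number n is a parameter of the program and not an input, so taking n tails decides
  the comparison without arithmetic.\<close>

lemma ptime_length_le [pt]:
  assumes "ptime l"
  shows "ptime (\<lambda>x. dbool (length (dlist (l x)) \<le> n))"
  using assms
proof (induction n arbitrary: l)
  case 0
  have "ptime (\<lambda>x. dbool (l x = Atom))" by (intro pt 0)
  then show ?case by simp
next
  case (Suc n)
  have "ptime (\<lambda>x. dbool (length (dlist (dsnd (l x))) \<le> n))" by (intro Suc.IH pt Suc.prems)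
  moreover have "length (dlist (dsnd y)) \<le> n \<longleftrightarrow> length (dlist y) \<le> Suc n" for y
    by (cases y) auto
  ultimately show ?case by simp
qed

section \<open>The decomposition program\<close>

lemma ptime_Let [pt]:
  assumes "ptime f" "ptime (\<lambda>y. g (dfst y) (dsnd y))"
  shows "ptime (\<lambda>x. let a = f x in g x a)"
  using ptime_comp[OF ptime_Pair[OF ptime_id assms(1)] assms(2)] by simp

definition meets :: "data \<Rightarrow> data \<Rightarrow> bool" where
  "meets a b \<longleftrightarrow> (\<exists>v\<in>dset a. v \<in> dset b)"

definition in_union :: "data \<Rightarrow> data \<Rightarrow> bool" where
  "in_union v S \<longleftrightarrow> (\<exists>e\<in>dset S. v \<in> dset e)"

text \<open>If no block meets e, the new block is empty; it is disjoint from all others and produces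
  no subtask.\<close>

definition merge_blocks :: "data \<Rightarrow> data \<Rightarrow> data" where
  "merge_blocks e P = Pair (dconcat (dfilter (\<lambda>Z. meets e Z) P)) (dfilter (\<lambda>Z. \<not> meets e Z) P)"

text \<open>One pass over the edges is enough: the vertices of an edge share a block once the edge
  has been processed, and blocks are only ever joined.\<close>

definition components :: "data \<Rightarrow> data \<Rightarrow> data \<Rightarrow> data" where
  "components V E S = fold merge_blocks (dlist E)
     (dmap (\<lambda>v. Pair v Atom) (dfilter (\<lambda>v. \<not> in_union v S) V))"

text \<open>The space of the exhaustive search, with repetitions and all orders. It has (|E| + 1)^n
  entries, a polynomial number because n is fixed; the recursion on n is unrolled into the
  program.\<close>

primrec tuples :: "nat \<Rightarrow> data \<Rightarrow> data" where
  "tuples 0 E = Pair Atom Atom"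
| "tuples (Suc n) E = dappend (tuples n E) (dconcat (dmap (\<lambda>e. dmap (\<lambda>t. Pair e t) (tuples n E)) E))"

definition balanced :: "nat \<Rightarrow> data \<Rightarrow> data \<Rightarrow> data \<Rightarrow> data \<Rightarrow> bool" where
  "balanced K V E W S \<longleftrightarrow>
     (\<forall>Z\<in>dset (components V E S). length (dlist (dfilter (\<lambda>w. meets w Z) W)) \<le> K)"

text \<open>If no candidate is balanced, \<open>dfst\<close> returns \<open>Atom\<close>, the empty
  set of edges, which keeps the program total outside the promise.\<close>

definition separator :: "nat \<Rightarrow> data \<Rightarrow> data \<Rightarrow> data \<Rightarrow> data" where
  "separator K V E W = dfst (dfilter (\<lambda>S. balanced K V E W S) (tuples K E))"

definition boundary_bag :: "data \<Rightarrow> data \<Rightarrow> data \<Rightarrow> data \<Rightarrow> data" where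
  "boundary_bag V E C L = dfilter (\<lambda>v. in_union v L \<and> (\<exists>e\<in>dset E. v \<in> dset e \<and> meets e C)) V"

definition subtasks :: "data \<Rightarrow> data \<Rightarrow> data \<Rightarrow> data \<Rightarrow> data \<Rightarrow> data \<Rightarrow> data \<Rightarrow> data" where
  "subtasks V E v C W S B = dfilter (\<lambda>t. dfst (dsnd t) \<noteq> Atom) (dmap (\<lambda>Z.
     Pair v (Pair (dfilter (\<lambda>u. u \<in> dset C \<and> u \<in> dset Z \<and> u \<notin> dset B) V)
       (dfilter (\<lambda>e. e \<in> dset S \<or> e \<in> dset W \<and> meets e Z) E))) (components V E S))"

text \<open>The edge added to W is one that contains v. It forces v into the bag, so each step makes
  progress and v can serve as the name of the node.\<close>

definition process_task :: "nat \<Rightarrow> data \<Rightarrow> data \<Rightarrow> data \<Rightarrow> data \<Rightarrow> data \<Rightarrow> data \<Rightarrow> data \<Rightarrow> data" where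
  "process_task K V E p C W ts rs =
     (let v = dfst (dfilter (\<lambda>v. v \<in> dset C) V);
          W' = dfilter (\<lambda>e. e \<in> dset W \<or> e = dfst (dfilter (\<lambda>e. v \<in> dset e) E)) E;
          S = separator K V E W';
          L = dfilter (\<lambda>e. e \<in> dset W' \<or> e \<in> dset S) E;
          B = boundary_bag V E C L
      in Pair (dappend (subtasks V E v C W' S B) ts) (Pair (Pair p (Pair v (Pair B L))) rs))"

text \<open>A task is a triple of the parent node, the set of vertices still to be decomposed below it,
  and edges covering the boundary of that set; a state is a pair of the pending tasks and of the
  finished nodes, each with its parent, bag and cover. A node is named after a vertex.\<close>

definition decompose_step :: "nat \<Rightarrow> data \<Rightarrow> data \<Rightarrow> data \<Rightarrow> data" where
  "decompose_step K V E s =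
     (if dfst s = Atom then s
      else process_task K V E (dfst (dfst (dfst s))) (dfst (dsnd (dfst (dfst s))))
        (dsnd (dsnd (dfst (dfst s)))) (dsnd (dfst s)) (dsnd s))"

text \<open>The vertex list with one extra entry acts as a clock: one round creates the root and the
  others process subtasks, idling when none is left. The initial task names the first vertex as its
  parent, which is also the vertex that this task selects.\<close>

definition decompose :: "nat \<Rightarrow> data \<Rightarrow> data" where
  "decompose K x = fold (\<lambda>_ s. decompose_step K (dfst x) (dsnd x) s) (dlist (Pair Atom (dfst x)))
     (Pair (Pair (Pair (dfst (dfst x)) (Pair (dfst x) Atom)) Atom) Atom)"

text \<open>The root is the first vertex of the input list; the filter removes the loop by which it
  is recorded as its own parent.\<close>

definition output_nodes :: "data \<Rightarrow> data \<Rightarrow> data" where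
  "output_nodes x rs = enc_list
     [dmap (\<lambda>r. dfst (dsnd r)) rs,
      dfst (dfst x),
      dmap (\<lambda>r. Pair (dfst r) (dfst (dsnd r))) (dfilter (\<lambda>r. dfst r \<noteq> dfst (dsnd r)) rs),
      dmap (\<lambda>r. Pair (dfst (dsnd r)) (dfst (dsnd (dsnd r)))) rs,
      dmap (\<lambda>r. Pair (dfst (dsnd r)) (dmap (\<lambda>e. Pair e
        (if e \<in> dset (dsnd (dsnd (dsnd r))) then Pair (enc_nat 1) (enc_nat 1)
         else Pair (enc_nat 0) (enc_nat 1))) (dsnd x))) rs]"

definition fhd_algorithm :: "nat \<Rightarrow> data \<Rightarrow> data" where
  "fhd_algorithm K x = output_nodes x (dsnd (decompose K x))"

section \<open>The running time of the program\<close>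

lemma ptime_meets [pt]:
  assumes "ptime f" "ptime g"
  shows "ptime (\<lambda>x. dbool (meets (f x) (g x)))"
  unfolding meets_def by (intro pt ptime_comp[OF _ assms(1)] ptime_comp[OF _ assms(2)])

lemma ptime_in_union [pt]:
  assumes "ptime f" "ptime g"
  shows "ptime (\<lambda>x. dbool (in_union (f x) (g x)))"
  unfolding in_union_def by (intro pt ptime_comp[OF _ assms(1)] ptime_comp[OF _ assms(2)])

lemma dsize_dfilter_add: "dsize (dfilter P l) + dsize (dfilter (\<lambda>a. \<not> P a) l) = Suc (dsize l)"
proof -
  have "(\<Sum>a\<leftarrow>filter P xs. Suc (dsize a)) + (\<Sum>a\<leftarrow>filter (\<lambda>a. \<not> P a) xs. Suc (dsize a)) =
    (\<Sum>a\<leftarrow>xs. Suc (dsize a))" for xs :: "data list"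
    by (induction xs) auto
  from this[of "dlist l"] show ?thesis
    by (simp add: dsize_dlist[of "dfilter _ l"] dsize_dlist[of l])
qed

lemma dsize_dfilter_le: "dsize (dfilter P l) \<le> dsize l"
  using dsize_dfilter_add[of P l] dsize_pos[of "dfilter (\<lambda>a. \<not> P a) l"] by linarith

lemma dsize_dconcat_le: "dsize (dconcat l) \<le> dsize l"
proof -
  have "(\<Sum>a\<leftarrow>concat (map dlist xs). Suc (dsize a)) \<le> (\<Sum>a\<leftarrow>xs. Suc (dsize a))" for xs
  proof (induction xs)
    case (Cons a xs)
    then show ?case using dsize_dlist[of a] by simp
  qed simp
  from this[of "dlist l"] show ?thesis by (simp add: dsize_dlist[of "dconcat l"] dsize_dlist[of l])
qed

lemma dsize_dappend_le: "dsize (dappend a b) \<le> dsize a + dsize b"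
  by (simp add: dsize_dlist[of "dappend a b"] dsize_dlist[of a] dsize_dlist[of b])

lemma dsize_dmap_le:
  assumes "\<And>a. a \<in> dset l \<Longrightarrow> dsize (f a) \<le> b"
  shows "dsize (dmap f l) \<le> 1 + dsize l * (b + 1)"
proof -
  have "(\<Sum>a\<leftarrow>xs. Suc (dsize (f a))) \<le> length xs * (b + 1)" if "set xs \<subseteq> dset l" for xs
    using that
  proof (induction xs)
    case (Cons a xs)
    then show ?case using assms[of a] by simp
  qed simp
  from this[of "dlist l"] have "dsize (dmap f l) \<le> 1 + length (dlist l) * (b + 1)"
    by (simp add: dsize_dlist[of "dmap f l"] o_def)
  also have "\<dots> \<le> 1 + dsize l * (b + 1)" using length_dlist_le[of l] by (intro add_mono mult_le_mono1) auto
  finally show ?thesis .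
qed

text \<open>Merging only regroups entries. The constant pays for the end of the second list and for
  the cell that holds the new block, so the growth does not depend on the partition.\<close>

lemma dsize_merge_blocks_le: "dsize (merge_blocks e P) \<le> dsize P + 2"
  using dsize_dfilter_add[of "meets e" P] dsize_dconcat_le[of "dfilter (meets e) P"]
  unfolding merge_blocks_def by simp

lemma dsize_components_le: "dsize (components V E S) \<le> 1 + dsize V * (dsize V + 3) + 2 * dsize E"
proof -
  let ?B = "dmap (\<lambda>v. Pair v Atom) (dfilter (\<lambda>v. \<not> in_union v S) V)"
  have "dsize (fold merge_blocks xs P) \<le> dsize P + 2 * length xs" for xs P
  proof (induction xs arbitrary: P)
    case (Cons a xs)
    from Cons.IH[of "merge_blocks a P"] dsize_merge_blocks_le[of a P] show ?case by simp
  qed simp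
  then have "dsize (components V E S) \<le> dsize ?B + 2 * length (dlist E)"
    unfolding components_def by blast
  moreover have "dsize ?B \<le> 1 + dsize (dfilter (\<lambda>v. \<not> in_union v S) V) * ((dsize V + 2) + 1)"
    by (intro dsize_dmap_le) (use dsize_elem_le[of _ V] in force)
  moreover have "dsize (dfilter (\<lambda>v. \<not> in_union v S) V) * ((dsize V + 2) + 1) \<le> dsize V * ((dsize V + 2) + 1)"
    by (intro mult_le_mono1 dsize_dfilter_le)
  ultimately show ?thesis using length_dlist_le[of E] by (simp add: algebra_simps)
qed

lemma ptime_components [pt]:
  assumes V: "ptime V" and E: "ptime E" and S: "ptime S"
  shows "ptime (\<lambda>x. components (V x) (E x) (S x))"
  unfolding components_def
proof (rule ptime_fold_add[where r = 2, OF _ E])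
  show "ptime (\<lambda>y. merge_blocks (dfst (dsnd y)) (dsnd (dsnd y)))"
    unfolding merge_blocks_def by (intro pt)
  show "ptime (\<lambda>x. dmap (\<lambda>v. Pair v Atom) (dfilter (\<lambda>v. \<not> in_union v (S x)) (V x)))"
    by (intro pt ptime_comp[OF _ V] ptime_comp[OF _ S])
  show "dsize (merge_blocks a acc) \<le> dsize acc + poly 2 (dsize x)" for x a acc
    using dsize_merge_blocks_le[of a acc] by simp
qed

lemma ptime_tuples [pt]:
  assumes "ptime E"
  shows "ptime (\<lambda>x. tuples n (E x))"
proof (induction n)
  case 0
  show ?case unfolding tuples.simps by (intro pt)
next
  case (Suc n)
  show ?case unfolding tuples.simps
    by (intro pt ptime_comp[OF _ Suc.IH] ptime_comp[OF _ assms])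
qed

lemma ptime_separator [pt]:
  assumes "ptime V" "ptime E" "ptime W"
  shows "ptime (\<lambda>x. separator K (V x) (E x) (W x))"
  unfolding separator_def balanced_def
  by (intro pt ptime_comp[OF _ assms(1)] ptime_comp[OF _ assms(2)] ptime_comp[OF _ assms(3)])

lemma ptime_boundary_bag [pt]:
  assumes "ptime V" "ptime E" "ptime C" "ptime L"
  shows "ptime (\<lambda>x. boundary_bag (V x) (E x) (C x) (L x))"
  unfolding boundary_bag_def
  by (intro pt ptime_comp[OF _ assms(1)] ptime_comp[OF _ assms(2)] ptime_comp[OF _ assms(3)]
    ptime_comp[OF _ assms(4)])

lemma ptime_subtasks [pt]:
  assumes "ptime V" "ptime E" "ptime v" "ptime C" "ptime W" "ptime S" "ptime B"
  shows "ptime (\<lambda>x. subtasks (V x) (E x) (v x) (C x) (W x) (S x) (B x))"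
  unfolding subtasks_def
  by (intro pt ptime_comp[OF _ assms(1)] ptime_comp[OF _ assms(2)] ptime_comp[OF _ assms(3)]
    ptime_comp[OF _ assms(4)] ptime_comp[OF _ assms(5)] ptime_comp[OF _ assms(6)]
    ptime_comp[OF _ assms(7)])

lemma ptime_process_task [pt]:
  assumes "ptime V" "ptime E" "ptime p" "ptime C" "ptime W" "ptime ts" "ptime rs"
  shows "ptime (\<lambda>x. process_task K (V x) (E x) (p x) (C x) (W x) (ts x) (rs x))"
  unfolding process_task_def
  by (intro pt ptime_comp[OF _ assms(1)] ptime_comp[OF _ assms(2)] ptime_comp[OF _ assms(3)]
    ptime_comp[OF _ assms(4)] ptime_comp[OF _ assms(5)] ptime_comp[OF _ assms(6)]
    ptime_comp[OF _ assms(7)])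

lemma dsize_subtasks_le:
  assumes "dsize v \<le> n" "dsize V \<le> n" "dsize E \<le> n"
  shows "dsize (subtasks V E v C W S B) \<le> 1 + (1 + n * (n + 3) + 2 * n) * (3 * n + 3)"
proof -
  have "dsize (subtasks V E v C W S B) \<le> 1 + dsize (components V E S) * ((3 * n + 2) + 1)"
    unfolding subtasks_def
  proof (intro order_trans[OF dsize_dfilter_le] dsize_dmap_le)
    fix Z
    have "dsize (dfilter (\<lambda>u. u \<in> dset C \<and> u \<in> dset Z \<and> u \<notin> dset B) V) \<le> n"
      by (rule order_trans[OF dsize_dfilter_le assms(2)])
    moreover have "dsize (dfilter (\<lambda>e. e \<in> dset S \<or> e \<in> dset W \<and> meets e Z) E) \<le> n"
      by (rule order_trans[OF dsize_dfilter_le assms(3)])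
    ultimately show "dsize (Pair v (Pair (dfilter (\<lambda>u. u \<in> dset C \<and> u \<in> dset Z \<and> u \<notin> dset B) V)
        (dfilter (\<lambda>e. e \<in> dset S \<or> e \<in> dset W \<and> meets e Z) E))) \<le> 3 * n + 2"
      using assms by simp
  qed
  moreover have "dsize V * (dsize V + 3) \<le> n * (n + 3)"
    using assms by (intro mult_le_mono) auto
  then have "dsize (components V E S) \<le> 1 + n * (n + 3) + 2 * n"
    using dsize_components_le[of V E S] assms by linarith
  then have "dsize (components V E S) * ((3 * n + 2) + 1) \<le> (1 + n * (n + 3) + 2 * n) * (3 * n + 3)"
    by (intro mult_le_mono) auto
  ultimately show ?thesis by linarith
qed

text \<open>The selections from \<open>V\<close> and \<open>E\<close> keep the growth of the state independent of its size, also
  on inputs that do not represent a hypergraph.\<close>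

lemma dsize_decompose_step_le:
  assumes "dsize V \<le> n" "dsize E \<le> n"
  shows "dsize (decompose_step K V E s) \<le> dsize s + (1 + (1 + n * (n + 3) + 2 * n) * (3 * n + 3) + 3 * n + 6)"
proof (cases "dfst s = Atom")
  case True
  then show ?thesis by (simp add: decompose_step_def)
next
  case False
  then obtain t ts rs where s: "s = Pair (Pair t ts) rs" by (cases s; cases "dfst s") auto
  let ?C = "dfst (dsnd t)"
  define v where "v = dfst (dfilter (\<lambda>v. v \<in> dset ?C) V)"
  define W where "W = dfilter (\<lambda>e. e \<in> dset (dsnd (dsnd t)) \<or> e = dfst (dfilter (\<lambda>e. v \<in> dset e) E)) E"
  define S where "S = separator K V E W"
  define L where "L = dfilter (\<lambda>e. e \<in> dset W \<or> e \<in> dset S) E"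
  define B where "B = boundary_bag V E ?C L"
  have eq: "decompose_step K V E s =
    Pair (dappend (subtasks V E v ?C W S B) ts) (Pair (Pair (dfst t) (Pair v (Pair B L))) rs)"
    unfolding decompose_step_def process_task_def s Let_def v_def W_def S_def L_def B_def by simp
  have v: "dsize v \<le> n"
    unfolding v_def by (rule order_trans[OF dsize_dfst_le order_trans[OF dsize_dfilter_le assms(1)]])
  have L: "dsize L \<le> n" unfolding L_def by (rule order_trans[OF dsize_dfilter_le assms(2)])
  have B: "dsize B \<le> n"
    unfolding B_def boundary_bag_def by (rule order_trans[OF dsize_dfilter_le assms(1)])
  show ?thesis
    unfolding eq using v L B dsize_dfst_le[of t] dsize_subtasks_le[OF v assms, of ?C W S B]
      dsize_dappend_le[of "subtasks V E v ?C W S B" ts]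
    by (simp add: s)
qed

lemma ptime_decompose [pt]: "ptime (decompose K)"
proof -
  \<comment> \<open>The increment from \<open>dsize_decompose_step_le\<close> as a polynomial in n,
    the size of the input.\<close>
  define q :: "nat poly" where
    "q = 1 + (1 + [:0, 1:] * [:3, 1:] + smult 2 [:0, 1:]) * [:3, 3:] + smult 3 [:0, 1:] + [:6:]"
  have "ptime (\<lambda>x. fold (\<lambda>_ s. decompose_step K (dfst x) (dsnd x) s) (dlist (Pair Atom (dfst x)))
     (Pair (Pair (Pair (dfst (dfst x)) (Pair (dfst x) Atom)) Atom) Atom))"
  proof (rule ptime_fold_add[where r = q])
    show "ptime (\<lambda>y. decompose_step K (dfst (dfst y)) (dsnd (dfst y)) (dsnd (dsnd y)))"
      unfolding decompose_step_def by (intro pt)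
    show "dsize (decompose_step K (dfst x) (dsnd x) s) \<le> dsize s + poly q (dsize x)" for x s
      using dsize_decompose_step_le[OF dsize_dfst_le[of x] dsize_dsnd_le[of x], of K s]
      by (simp add: q_def algebra_simps)
  qed (intro pt)+
  then show ?thesis unfolding decompose_def[abs_def] .
qed

lemma ptime_fhd_algorithm: "ptime (fhd_algorithm K)"
proof -
  have "ptime (\<lambda>x. fhd_algorithm K x)"
    unfolding fhd_algorithm_def output_nodes_def enc_list.simps
    by (intro pt ptime_comp[OF _ ptime_decompose])
  then show ?thesis by simp
qed

section \<open>Correctness of the program\<close>

lemma inj_enc_nat: "inj enc_nat"
proof (rule injI)
  fix m n :: nat
  show "enc_nat m = enc_nat n \<Longrightarrow> m = n"
  proof (induction m arbitrary: n rule: less_induct)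
    case (less m)
    show ?case
    proof (cases "m = 0 \<or> n = 0")
      case True
      then show ?thesis using less.prems by (auto simp: enc_nat.simps split: if_splits)
    next
      case False
      then have eq: "dbool (odd m) = dbool (odd n)" "enc_nat (m div 2) = enc_nat (n div 2)"
        using less.prems by (simp_all add: enc_nat.simps[of m] enc_nat.simps[of n])
      have "m div 2 = n div 2" using less.IH[OF _ eq(2)] False by simp
      moreover have "odd m = odd n" using eq(1) by (metis dbool_eq_Atom_iff)
      ultimately show ?thesis by (metis div_mult_mod_eq parity_cases)
    qed
  qed
qed

lemma enc_nat_eq_iff [simp]: "enc_nat m = enc_nat n \<longleftrightarrow> m = n"
  using inj_enc_nat by (auto dest: injD)

text \<open>The set denoted by a list of numerals. Order is forgotten and entries that are not
  numerals are dropped, so it is defined for arbitrary data.\<close>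

definition den :: "data \<Rightarrow> nat set" where
  "den a = {n. enc_nat n \<in> dset a}"

lemma mem_den_iff [simp]: "n \<in> den a \<longleftrightarrow> enc_nat n \<in> dset a"
  by (simp add: den_def)

lemma den_dfilter: "den (dfilter P l) = {n \<in> den l. P (enc_nat n)}"
  by (auto simp: den_def)

text \<open>A common entry that is not a numeral would be invisible to \<open>den\<close>; it is
  excluded as soon as one side consists of numerals.\<close>

lemma meets_iff:
  assumes "dset a \<subseteq> range enc_nat \<or> dset b \<subseteq> range enc_nat"
  shows "meets a b \<longleftrightarrow> den a \<inter> den b \<noteq> {}"
proof
  assume "meets a b"
  then obtain v where v: "v \<in> dset a" "v \<in> dset b" unfolding meets_def by blast
  then have "v \<in> range enc_nat" using assms by (auto dest: subsetD)
  then obtain n where "v = enc_nat n" by (rule rangeE)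
  then have "n \<in> den a \<inter> den b" using v by simp
  then show "den a \<inter> den b \<noteq> {}" by blast
next
  assume "den a \<inter> den b \<noteq> {}"
  then obtain n where "n \<in> den a" "n \<in> den b" by blast
  then show "meets a b" unfolding meets_def by auto
qed

lemma in_union_iff: "in_union (enc_nat n) S \<longleftrightarrow> n \<in> \<Union>(den ` dset S)"
  unfolding in_union_def by simp

lemma den_eq_empty_iff:
  assumes "dset a \<subseteq> range enc_nat"
  shows "den a = {} \<longleftrightarrow> a = Atom"
proof
  assume d: "den a = {}"
  show "a = Atom"
  proof (cases a)
    case (Pair b c)
    then have b: "b \<in> dset a" by simp
    then obtain n where "b = enc_nat n" using assms by auto
    then have "n \<in> den a" using b by simp
    then show ?thesis using d by simp
  qed
qed (simp add: den_def)

section \<open>Partitions into blocks under merging\<close>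

abbreviation block_elems :: "data \<Rightarrow> data list" where
  "block_elems P \<equiv> concat (map dlist (dlist P))"

lemma mset_concat_filter:
  "mset (concat (map f (filter Q xs))) + mset (concat (map f (filter (\<lambda>x. \<not> Q x) xs))) = mset (concat (map f xs))"
  by (induction xs) auto

text \<open>Tracking the multiset instead of the set preserves two facts at once: no vertex is lost,
  and distinctness of the concatenation keeps the blocks disjoint.\<close>

lemma mset_merge_blocks: "mset (block_elems (merge_blocks e P)) = mset (block_elems P)"
  using mset_concat_filter[of dlist "meets e" "dlist P"] by (simp add: merge_blocks_def)

lemma set_merge_blocks: "set (block_elems (merge_blocks e P)) = set (block_elems P)"
  using mset_merge_blocks by (metis set_mset_mset)

lemma mset_fold_merge_blocks: "mset (block_elems (fold merge_blocks es P)) = mset (block_elems P)"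
  by (induction es arbitrary: P) (auto simp: mset_merge_blocks)

lemma merge_blocks_mono:
  assumes "Z \<in> dset P" "X \<subseteq> dset Z"
  shows "\<exists>Z'\<in>dset (merge_blocks e P). X \<subseteq> dset Z'"
proof (cases "meets e Z")
  case True
  then have "X \<subseteq> dset (dconcat (dfilter (meets e) P))" using assms by auto
  then show ?thesis unfolding merge_blocks_def by simp
next
  case False
  then show ?thesis unfolding merge_blocks_def using assms by auto
qed

lemma fold_merge_blocks_mono:
  assumes "Z \<in> dset P" "X \<subseteq> dset Z"
  shows "\<exists>Z'\<in>dset (fold merge_blocks es P). X \<subseteq> dset Z'"
  using assms
proof (induction es arbitrary: P Z)
  case (Cons e es)
  obtain Z' where "Z' \<in> dset (merge_blocks e P)" "X \<subseteq> dset Z'"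
    using merge_blocks_mono[OF Cons.prems] by blast
  then show ?case using Cons.IH by simp
qed auto

text \<open>When e is processed, all blocks that meet it become one block, and later merges never
  separate its vertices again.\<close>

lemma fold_merge_blocks_edge:
  assumes "e \<in> set es"
  shows "\<exists>Z\<in>dset (fold merge_blocks es P). dset e \<inter> set (block_elems P) \<subseteq> dset Z"
  using assms
proof (induction es arbitrary: P)
  case (Cons a es)
  show ?case
  proof (cases "e = a")
    case True
    let ?Z = "dconcat (dfilter (meets a) P)"
    have 1: "?Z \<in> dset (merge_blocks a P)" unfolding merge_blocks_def by simp
    have 2: "dset e \<inter> set (block_elems P) \<subseteq> dset ?Z" unfolding True by (auto simp: meets_def)
    show ?thesis using fold_merge_blocks_mono[OF 1 2] by simp
  next
    case False
    then show ?thesis using Cons.IH[of "merge_blocks a P"] Cons.prems by (simp add: set_merge_blocks del: set_concat)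
  qed
qed simp

lemma sorted_wrt_den_disjoint:
  assumes "distinct (concat (map dlist zs))"
  shows "sorted_wrt (\<lambda>Z Z'. den Z \<inter> den Z' = {}) zs"
  using assms by (induction zs) (auto simp: den_def)

lemma map_filter_map:
  assumes "\<And>z. z \<in> set zs \<Longrightarrow> f (g z) = h z" "\<And>z. z \<in> set zs \<Longrightarrow> P (g z) \<longleftrightarrow> Q (h z)"
  shows "map f (filter P (map g zs)) = filter Q (map h zs)"
  using assms by (induction zs) auto

lemma fold_const: "fold (\<lambda>_ s. f s) xs s = (f ^^ length xs) s"
  by (induction xs arbitrary: s) (auto simp: funpow_swap1)

lemma dfst_in_dset: "dlist l \<noteq> [] \<Longrightarrow> dfst l \<in> dset l"
  by (cases l) auto

lemma dfst_dfilter: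
  assumes "a \<in> dset l" "P a"
  shows "dfst (dfilter P l) \<in> dset l" "P (dfst (dfilter P l))"
proof -
  have "dlist (dfilter P l) \<noteq> []" using assms by (auto simp: filter_empty_conv)
  then have "dfst (dfilter P l) \<in> dset (dfilter P l)" by (rule dfst_in_dset)
  then show "dfst (dfilter P l) \<in> dset l" "P (dfst (dfilter P l))" by auto
qed

lemma dset_tuples: "t \<in> dset (tuples n E) \<longleftrightarrow> dset t \<subseteq> dset E \<and> length (dlist t) \<le> n"
proof (induction n arbitrary: t)
  case 0
  then show ?case by (cases t) auto
next
  case (Suc n)
  show ?case
  proof (cases t)
    case Atom
    then show ?thesis using Suc.IH[of Atom] by simp
  next
    case (Pair e t')
    then show ?thesis using Suc.IH[of t] Suc.IH[of t'] by auto
  qed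
qed

lemma repr_setI:
  assumes "distinct (map f xs)" "\<And>x. x \<in> set xs \<Longrightarrow> R (f x) (g x)"
  shows "repr_set R (set (map f xs)) (enc_list (map g xs))"
  unfolding repr_set_def using assms
  by (intro exI[of _ "map f xs"] exI[of _ "map g xs"]) (simp add: list_all2_conv_all_nth)

text \<open>The abstraction function of the simulation, from data to the tasks of the mathematical
  invariant.\<close>

definition abs_task :: "data \<Rightarrow> nat task" where
  "abs_task t = (inv enc_nat (dfst t), den (dfst (dsnd t)), den ` dset (dsnd (dsnd t)))"

lemma inv_enc_nat [simp]: "inv enc_nat (enc_nat n) = n"
  by (rule inv_f_f[OF inj_enc_nat])

text \<open>A set has several representations, but each edge is listed by one of them only. This is
  \<open>E_inj\<close>; it makes lengths of duplicate-free edge lists agree with numbers of edges,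
  and membership of data with membership of edges.\<close>

locale encoded_hypergraph =
  fixes H :: "nat hypergraph" and V E :: data and K :: nat
  assumes H: "hypergraph H"
    and V_distinct: "distinct (dlist V)" and V: "dset V = enc_nat ` verts H"
    and E_distinct: "distinct (dlist E)" and E: "den ` dset E = edges H"
    and E_inj: "inj_on den (dset E)" and E_enc: "\<And>e. e \<in> dset E \<Longrightarrow> dset e \<subseteq> range enc_nat"
    and E_elem_distinct: "\<And>e. e \<in> dset E \<Longrightarrow> distinct (dlist e)"
begin

lemma V_enc: "dset V \<subseteq> range enc_nat"
  unfolding V by blast

lemma den_V: "den V = verts H"
  unfolding den_def V by auto

lemma card_den_image: "dset W \<subseteq> dset E \<Longrightarrow> card (den ` dset W) = card (dset W)"
  using E_inj by (intro card_image) (rule inj_on_subset)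

lemma mem_den_image:
  assumes "e \<in> dset E" "dset W \<subseteq> dset E"
  shows "den e \<in> den ` dset W \<longleftrightarrow> e \<in> dset W"
  using inj_on_image_mem_iff[OF E_inj assms] .

lemma den_meets_image:
  assumes "dset W \<subseteq> dset E"
  shows "den ` {w \<in> dset W. meets w Z} = {w \<in> den ` dset W. w \<inter> den Z \<noteq> {}}"
proof -
  have "meets w Z \<longleftrightarrow> den w \<inter> den Z \<noteq> {}" if "w \<in> dset W" for w
    using that assms E_enc by (intro meets_iff) auto
  then show ?thesis by blast
qed

abbreviation comps :: "data \<Rightarrow> data" where
  "comps S \<equiv> components V E S"

abbreviation rest :: "data \<Rightarrow> nat set" where
  "rest S \<equiv> verts H - \<Union>(den ` dset S)"

lemma mset_components: "mset (block_elems (comps S)) = mset (filter (\<lambda>v. \<not> in_union v S) (dlist V))"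
proof -
  have "concat (map dlist (map (\<lambda>v. Pair v Atom) xs)) = xs" for xs by (induction xs) auto
  then show ?thesis unfolding components_def mset_fold_merge_blocks by simp
qed

lemma set_components: "set (block_elems (comps S)) = enc_nat ` rest S"
proof -
  have "set (block_elems (comps S)) = {v \<in> dset V. \<not> in_union v S}"
    using arg_cong[OF mset_components, of set_mset S] by (simp del: set_concat)
  also have "\<dots> = enc_nat ` rest S" unfolding V using in_union_iff by (auto simp del: UN_iff)
  finally show ?thesis .
qed

lemma block_subset:
  assumes "Z \<in> dset (comps S)"
  shows "dset Z \<subseteq> enc_nat ` rest S"
  unfolding set_components[symmetric] using assms by auto

lemma distinct_components: "distinct (block_elems (comps S))"
proof -
  have "distinct (filter (\<lambda>v. \<not> in_union v S) (dlist V))" using V_distinct by simp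
  then show ?thesis using mset_components[of S] mset_eq_imp_distinct_iff by blast
qed

text \<open>Blocks are never coarser than components. For a fixed set A that no edge leaves within
  the rest, the invariant is that each block lies inside A or avoids A; singletons satisfy it, and
  merging along an edge preserves it.\<close>

lemma components_unsplit:
  assumes "Z \<in> dset (comps S)"
  shows "unsplit H (rest S) (den Z)"
  unfolding unsplit_def
proof (intro allI impI)
  fix A assume A: "A \<subseteq> rest S" and cl: "\<forall>e\<in>edges H. e \<inter> rest S \<subseteq> A \<or> e \<inter> A = {}"
  define ok where "ok P \<longleftrightarrow> (\<forall>Z\<in>dset P. den Z \<subseteq> rest S \<and> (den Z \<subseteq> A \<or> den Z \<inter> A = {}))" for P
  have merge: "ok (merge_blocks e P)" if e: "e \<in> dset E" and "ok P" for e P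
    unfolding ok_def
  proof
    have P: "den Z \<subseteq> rest S \<and> (den Z \<subseteq> A \<or> den Z \<inter> A = {})" if "Z \<in> dset P" for Z
      using \<open>ok P\<close> that unfolding ok_def by simp
    fix Z assume "Z \<in> dset (merge_blocks e P)"
    then consider "Z = dconcat (dfilter (meets e) P)" | "Z \<in> dset P"
      unfolding merge_blocks_def by auto
    then show "den Z \<subseteq> rest S \<and> (den Z \<subseteq> A \<or> den Z \<inter> A = {})"
    proof cases
      case 1
      have in_Z: "\<exists>Y\<in>dset P. meets e Y \<and> n \<in> den Y" if "n \<in> den Z" for n
        using that unfolding 1 den_def by auto
      have sub: "den Z \<subseteq> rest S" using in_Z P by (meson subset_eq)
      have eH: "den e \<in> edges H" using e E by blast
      have hit: "den e \<inter> den Y \<noteq> {}" if "meets e Y" for Y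
        using that meets_iff E_enc[OF e] by blast
      \<comment> \<open>Every merged block shares with e a vertex of \<open>rest S\<close>. In the
        first case this vertex is in A and pulls its block into A; in the second it is outside A and
        keeps its block off A.\<close>
      consider "den e \<inter> rest S \<subseteq> A" | "den e \<inter> A = {}" using cl eH by blast
      then have "den Z \<subseteq> A \<or> den Z \<inter> A = {}"
      proof cases
        case 1
        have "n \<in> A" if n: "n \<in> den Z" for n
        proof -
          obtain Y where Y: "Y \<in> dset P" "meets e Y" "n \<in> den Y" using in_Z[OF n] by blast
          obtain y where "y \<in> den e" "y \<in> den Y" using hit[OF Y(2)] by blast
          moreover from this have "y \<in> rest S" using P[OF Y(1)] by blast
          ultimately have "den Y \<inter> A \<noteq> {}" using 1 by blast
          then show ?thesis using P[OF Y(1)] Y(3) by blast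
        qed
        then show ?thesis by blast
      next
        case 2
        have "n \<notin> A" if n: "n \<in> den Z" for n
        proof -
          obtain Y where Y: "Y \<in> dset P" "meets e Y" "n \<in> den Y" using in_Z[OF n] by blast
          then have "\<not> den Y \<subseteq> A" using hit[OF Y(2)] 2 by blast
          then show ?thesis using P[OF Y(1)] Y(3) by blast
        qed
        then show ?thesis by blast
      qed
      then show ?thesis using sub by blast
    next
      case 2
      then show ?thesis using P by blast
    qed
  qed
  have "ok (fold merge_blocks es P)" if "set es \<subseteq> dset E" "ok P" for es P
    using that
  proof (induction es arbitrary: P)
    case (Cons e es)
    then have "ok (merge_blocks e P)" using merge by simp
    then show ?case using Cons by simp
  qed simp
  moreover have "ok (dmap (\<lambda>v. Pair v Atom) (dfilter (\<lambda>v. \<not> in_union v S) V))"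
    unfolding ok_def
  proof
    fix Z assume "Z \<in> dset (dmap (\<lambda>v. Pair v Atom) (dfilter (\<lambda>v. \<not> in_union v S) V))"
    then obtain n where n: "Z = Pair (enc_nat n) Atom" "n \<in> verts H" "\<not> in_union (enc_nat n) S"
      unfolding dlist_simps using V by auto
    have Z: "den Z = {n}" unfolding n(1) den_def by simp
    have "n \<in> rest S" using n(2,3) unfolding in_union_iff by simp
    then show "den Z \<subseteq> rest S \<and> (den Z \<subseteq> A \<or> den Z \<inter> A = {})"
      unfolding Z by (cases "n \<in> A") simp_all
  qed
  ultimately have "ok (comps S)" unfolding components_def by simp
  then show "den Z \<subseteq> A \<or> den Z \<inter> A = {}" using assms unfolding ok_def by simp
qed

lemma balanced_split_components:
  assumes S: "dset S \<subseteq> dset E" "length (dlist S) \<le> K" and W: "dset W \<subseteq> dset E"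
    and bal: "balanced K V E W S"
  shows "balanced_split H K (den ` dset W) (den ` dset S) (map den (dlist (comps S)))"
  unfolding balanced_split_def
proof (intro conjI ballI)
  show "den ` dset S \<subseteq> edges H" using S(1) E by blast
  have "card (den ` dset S) \<le> card (dset S)" by (rule card_image_le) simp
  then show "card (den ` dset S) \<le> K" using S(2) card_length[of "dlist S"] by linarith
  show "rest S \<subseteq> \<Union>(set (map den (dlist (comps S))))"
  proof
    fix n assume "n \<in> rest S"
    then have "enc_nat n \<in> set (block_elems (comps S))" unfolding set_components by blast
    then show "n \<in> \<Union>(set (map den (dlist (comps S))))" by auto
  qed
  show "sorted_wrt (\<lambda>Z Z'. Z \<inter> Z' = {}) (map den (dlist (comps S)))"
    unfolding sorted_wrt_map by (rule sorted_wrt_den_disjoint[OF distinct_components])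
next
  fix h assume h: "h \<in> edges H"
  then have "h \<in> den ` dset E" unfolding E .
  then obtain e where e: "e \<in> dset E" "den e = h" by auto
  let ?P = "dmap (\<lambda>v. Pair v Atom) (dfilter (\<lambda>v. \<not> in_union v S) V)"
  have "\<exists>Z\<in>dset (comps S). dset e \<inter> set (block_elems ?P) \<subseteq> dset Z"
    unfolding components_def by (rule fold_merge_blocks_edge[OF e(1)])
  then obtain Z where Z: "Z \<in> dset (comps S)" "dset e \<inter> set (block_elems ?P) \<subseteq> dset Z"
    by (rule bexE)
  have "set (block_elems ?P) = set (block_elems (comps S))"
    unfolding components_def using mset_fold_merge_blocks by (metis set_mset_mset)
  then have blk: "set (block_elems ?P) = enc_nat ` rest S" unfolding set_components .
  have "h - \<Union>(den ` dset S) \<subseteq> den Z"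
  proof
    fix n assume n: "n \<in> h - \<Union>(den ` dset S)"
    have "h \<subseteq> verts H" using H h unfolding hypergraph_def by simp
    then have "enc_nat n \<in> enc_nat ` rest S" using n by (intro imageI) auto
    moreover have "n \<in> den e" using n e(2) by simp
    then have "enc_nat n \<in> dset e" by simp
    ultimately have "enc_nat n \<in> dset Z" using subsetD[OF Z(2)] unfolding blk by simp
    then show "n \<in> den Z" by simp
  qed
  then show "\<exists>Z\<in>set (map den (dlist (comps S))). h - \<Union>(den ` dset S) \<subseteq> Z" using Z(1) by auto
next
  fix Z' assume "Z' \<in> set (map den (dlist (comps S)))"
  then obtain Z where Z: "Z \<in> dset (comps S)" "Z' = den Z" by auto
  have "{w \<in> den ` dset W. w \<inter> den Z \<noteq> {}} = den ` set (filter (\<lambda>w. meets w Z) (dlist W))"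
    using den_meets_image[OF W] by simp
  then have "card {w \<in> den ` dset W. w \<inter> den Z \<noteq> {}} \<le> card (set (filter (\<lambda>w. meets w Z) (dlist W)))"
    by (metis card_image_le List.finite_set)
  also have "\<dots> \<le> length (filter (\<lambda>w. meets w Z) (dlist W))" by (rule card_length)
  also have "\<dots> \<le> K" using bal Z(1) unfolding balanced_def by simp
  finally show "card {w \<in> den ` dset W. w \<inter> Z' \<noteq> {}} \<le> K" unfolding Z(2) .
qed

end

lemma repr_set_den:
  assumes "distinct (dlist a)" "dset a \<subseteq> range enc_nat"
  shows "repr_set repr_nat (den a) a"
proof -
  have eq: "map enc_nat (map (inv enc_nat) (dlist a)) = dlist a"
    using assms(2) by (induction "dlist a") (auto simp: map_idI f_inv_into_f o_def subset_iff)
  have "distinct (map (inv enc_nat) (dlist a))"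
    using assms by (simp add: distinct_map inj_on_inv_into)
  then have "repr_set repr_nat (set (map (\<lambda>n. n) (map (inv enc_nat) (dlist a))))
      (enc_list (map enc_nat (map (inv enc_nat) (dlist a))))"
    by (intro repr_setI) (simp_all add: repr_nat_def)
  moreover have "set (map (\<lambda>n. n) (map (inv enc_nat) (dlist a))) = den a"
    using assms(2) unfolding den_def by (auto simp: f_inv_into_f image_iff subset_iff) (metis inv_enc_nat)
  ultimately show ?thesis unfolding eq by simp
qed

context encoded_hypergraph
begin

text \<open>The decomposition D is only a witness that the search succeeds: the edges covering its
  centroid bag occur among the candidates and are balanced. The program may return another
  candidate, of which nothing but balance and size is known.\<close>

lemma separator_works:
  assumes D: "tree_decomposition H D"
    and cov: "\<And>u. u \<in> nodes D \<Longrightarrow> \<exists>S. S \<subseteq> edges H \<and> card S \<le> K \<and> bag D u \<subseteq> \<Union>S"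
    and W: "dset W \<subseteq> dset E" "distinct (dlist W)" "length (dlist W) \<le> 2 * K + 1"
  shows "dset (separator K V E W) \<subseteq> dset E" "length (dlist (separator K V E W)) \<le> K"
    "balanced K V E W (separator K V E W)"
proof -
  have cW: "card (den ` dset W) \<le> 2 * K + 1"
    using W card_den_image[OF W(1)] distinct_card[OF W(2)] by simp
  have WH: "den ` dset W \<subseteq> edges H" unfolding E[symmetric] by (rule image_mono[OF W(1)])
  obtain u where u: "u \<in> nodes D" "\<And>Z R. R \<subseteq> verts H \<Longrightarrow> R \<inter> bag D u = {} \<Longrightarrow> Z \<subseteq> R \<Longrightarrow>
      unsplit H R Z \<Longrightarrow> card {w \<in> den ` dset W. w \<inter> Z \<noteq> {}} \<le> K"
    using balanced_separator[OF H D _ WH cW] by auto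
  obtain S0 where S0: "S0 \<subseteq> edges H" "card S0 \<le> K" "bag D u \<subseteq> \<Union>S0" using cov[OF u(1)] by blast
  have "S0 \<subseteq> den ` dset E" unfolding E by (rule S0(1))
  then obtain T where T: "T \<subseteq> dset E" "S0 = den ` T" by (rule subset_imageE)
  have "finite T" using T(1) finite_subset by blast
  then obtain es where es: "set es = T" "distinct es" using finite_distinct_list by blast
  have "card T = card S0" unfolding T(2) using E_inj T(1) by (intro card_image[symmetric]) (rule inj_on_subset)
  then have len: "length es \<le> K" using S0(2) es distinct_card by metis
  let ?S = "enc_list es"
  have dS: "den ` dset ?S = S0" using es T by simp
  have mem: "?S \<in> dset (tuples K E)" unfolding dset_tuples using es(1) T(1) len by simp
  have bal: "balanced K V E W ?S" unfolding balanced_def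
  proof
    fix Z assume Z: "Z \<in> dset (components V E ?S)"
    have "rest ?S \<inter> bag D u = {}" using S0(3) unfolding dS by auto
    moreover have "den Z \<subseteq> rest ?S"
    proof
      fix n assume "n \<in> den Z"
      then have "enc_nat n \<in> enc_nat ` rest ?S" using block_subset[OF Z] by auto
      then show "n \<in> rest ?S" by (auto simp del: UN_iff)
    qed
    ultimately have "card {w \<in> den ` dset W. w \<inter> den Z \<noteq> {}} \<le> K"
      by (intro u(2)[OF _ _ _ components_unsplit[OF Z]]) auto
    then have "card (den ` {w \<in> dset W. meets w Z}) \<le> K" unfolding den_meets_image[OF W(1)] .
    moreover have "inj_on den {w \<in> dset W. meets w Z}"
      using E_inj by (rule inj_on_subset) (use W(1) in auto)
    ultimately have "card {w \<in> dset W. meets w Z} \<le> K" by (simp add: card_image)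
    moreover have "card (set (filter (\<lambda>w. meets w Z) (dlist W))) = length (filter (\<lambda>w. meets w Z) (dlist W))"
      using W(2) by (intro distinct_card) simp
    ultimately show "length (dlist (dfilter (\<lambda>w. meets w Z) W)) \<le> K" by simp
  qed
  from dfst_dfilter[of ?S "tuples K E" "\<lambda>S. balanced K V E W S", OF mem bal]
  show "dset (separator K V E W) \<subseteq> dset E" "length (dlist (separator K V E W)) \<le> K"
    "balanced K V E W (separator K V E W)"
    unfolding separator_def dset_tuples by auto
qed

definition valid_task :: "data \<Rightarrow> bool" where
  "valid_task t \<longleftrightarrow> (\<exists>p C W. t = Pair (enc_nat p) (Pair C W) \<and> dset C \<subseteq> dset V \<and> dset W \<subseteq> dset E)"

lemma den_boundary_bag:
  assumes C: "dset C \<subseteq> dset V"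
  shows "den (boundary_bag V E C L) = nbhd H (den C) \<inter> \<Union>(den ` dset L)"
proof -
  have CE: "dset C \<subseteq> range enc_nat" using C V_enc by (rule subset_trans)
  have cl: "(\<exists>e\<in>dset E. enc_nat n \<in> dset e \<and> meets e C) \<longleftrightarrow> n \<in> nbhd H (den C)" for n
  proof -
    have "n \<in> nbhd H (den C) \<longleftrightarrow> (\<exists>h\<in>edges H. h \<inter> den C \<noteq> {} \<and> n \<in> h)" unfolding nbhd_def by auto
    also have "\<dots> \<longleftrightarrow> (\<exists>e\<in>dset E. den e \<inter> den C \<noteq> {} \<and> n \<in> den e)" unfolding E[symmetric] by simp
    also have "\<dots> \<longleftrightarrow> (\<exists>e\<in>dset E. enc_nat n \<in> dset e \<and> meets e C)"
      using meets_iff[of _ C] CE by auto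
    finally show ?thesis by simp
  qed
  have "nbhd H (den C) \<subseteq> verts H" using H unfolding nbhd_def hypergraph_def by auto
  then show ?thesis
    unfolding boundary_bag_def den_dfilter den_V in_union_iff cl by auto
qed

lemma subtasks_simulation:
  assumes C: "dset C \<subseteq> dset V" and W: "dset W \<subseteq> dset E" and S: "dset S \<subseteq> dset E"
  shows "map abs_task (dlist (subtasks V E (enc_nat v) C W S B)) =
      subtask_list v (den C) (den ` dset W) (den ` dset S) (den B) (map den (dlist (comps S)))"
    and "t \<in> dset (subtasks V E (enc_nat v) C W S B) \<Longrightarrow> valid_task t"
proof -
  let ?C = "\<lambda>Z. dfilter (\<lambda>u. u \<in> dset C \<and> u \<in> dset Z \<and> u \<notin> dset B) V"
  let ?W = "\<lambda>Z. dfilter (\<lambda>e. e \<in> dset S \<or> e \<in> dset W \<and> meets e Z) E"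
  have dC: "den (?C Z) = den C \<inter> den Z - den B" for Z
  proof -
    have "den C \<subseteq> verts H" using C unfolding den_V[symmetric] den_def by auto
    then show ?thesis unfolding den_dfilter den_V by auto
  qed
  have dW: "den ` dset (?W Z) = den ` dset S \<union> {w \<in> den ` dset W. w \<inter> den Z \<noteq> {}}" for Z
  proof -
    have "dset (?W Z) = dset S \<union> {w \<in> dset W. meets w Z}" using S W by auto
    then show ?thesis unfolding den_meets_image[OF W, symmetric] by (simp add: image_Un)
  qed
  show "map abs_task (dlist (subtasks V E (enc_nat v) C W S B)) =
      subtask_list v (den C) (den ` dset W) (den ` dset S) (den B) (map den (dlist (comps S)))"
    unfolding subtasks_def subtask_list_def dlist_simps map_map
  proof (rule map_filter_map)
    fix Z
    show eq: "abs_task (Pair (enc_nat v) (Pair (?C Z) (?W Z))) =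
      (subtask_sets v (den C) (den ` dset W) (den ` dset S) (den B) \<circ> den) Z"
      unfolding abs_task_def subtask_sets_def dfst.simps dsnd.simps inv_enc_nat dC dW o_def ..
    have "dset (?C Z) \<subseteq> range enc_nat" using V_enc by auto
    from den_eq_empty_iff[OF this]
    show "dfst (dsnd (Pair (enc_nat v) (Pair (?C Z) (?W Z)))) \<noteq> Atom \<longleftrightarrow>
      task_verts ((subtask_sets v (den C) (den ` dset W) (den ` dset S) (den B) \<circ> den) Z) \<noteq> {}"
      unfolding eq[symmetric] abs_task_def dfst.simps dsnd.simps fst_conv snd_conv by blast
  qed
  assume "t \<in> dset (subtasks V E (enc_nat v) C W S B)"
  then obtain Z where "t = Pair (enc_nat v) (Pair (?C Z) (?W Z))" unfolding subtasks_def by auto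
  then show "valid_task t" unfolding valid_task_def by auto
qed

text \<open>The parent and the two lists are arbitrary data here, so that the same lemma covers the
  first step, where no node exists yet.\<close>

lemma process_task_simulation:
  assumes D: "tree_decomposition H D"
    and cov: "\<And>u. u \<in> nodes D \<Longrightarrow> \<exists>S. S \<subseteq> edges H \<and> card S \<le> K \<and> bag D u \<subseteq> \<Union>S"
    and C: "dset C \<subseteq> dset V" "den C \<noteq> {}" and W: "dset W \<subseteq> dset E" "card (den ` dset W) \<le> 2 * K"
  obtains v e0 S L B Zs ch where
    "process_task K V E p C W ts rs = Pair (dappend ch ts) (Pair (Pair p (Pair (enc_nat v) (Pair B L))) rs)"
    "enc_nat v = dfst (dfilter (\<lambda>v. v \<in> dset C) V)"
    "v \<in> den C" "e0 \<in> edges H" "v \<in> e0"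
    "balanced_split H K (insert e0 (den ` dset W)) S Zs"
    "den ` dset L = insert e0 (den ` dset W) \<union> S" "den B = nbhd H (den C) \<inter> \<Union>(den ` dset L)"
    "map abs_task (dlist ch) = subtask_list v (den C) (insert e0 (den ` dset W)) S (den B) Zs"
    "\<forall>t\<in>dset ch. valid_task t"
    "dset L \<subseteq> dset E" "distinct (dlist B)" "dset B \<subseteq> range enc_nat"
proof -
  define v' where "v' = dfst (dfilter (\<lambda>v. v \<in> dset C) V)"
  obtain n where n: "n \<in> den C" using C(2) by blast
  have nV: "enc_nat n \<in> dset V" using n C(1) by auto
  have v': "v' \<in> dset V" "v' \<in> dset C"
    unfolding v'_def by (rule dfst_dfilter[OF nV]; use n in simp)+
  then obtain v where v: "v' = enc_nat v" "v \<in> verts H" unfolding V by auto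
  define e' where "e' = dfst (dfilter (\<lambda>e. v' \<in> dset e) E)"
  obtain h where h: "h \<in> edges H" "v \<in> h" using v(2) H unfolding hypergraph_def by blast
  have "h \<in> den ` dset E" unfolding E by (rule h(1))
  then obtain e1 where e1: "e1 \<in> dset E" "h = den e1" by (rule imageE)
  have "v' \<in> dset e1" using h(2) unfolding e1(2) v(1) by simp
  from dfst_dfilter[of e1 E "\<lambda>e. v' \<in> dset e", OF e1(1) this]
  have e': "e' \<in> dset E" "v' \<in> dset e'" unfolding e'_def by auto
  define W' where "W' = dfilter (\<lambda>e. e \<in> dset W \<or> e = e') E"
  have dW': "dset W' = insert e' (dset W)" unfolding W'_def using W(1) e'(1) by auto
  have W'E: "dset W' \<subseteq> dset E" unfolding W'_def by auto
  have distW: "distinct (dlist W')" unfolding W'_def using E_distinct by simp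
  have "length (dlist W') = card (dset W')" using distinct_card[OF distW] by simp
  also have "\<dots> \<le> Suc (card (dset W))" unfolding dW' by (rule card_insert_le_m1) auto
  finally have lenW: "length (dlist W') \<le> 2 * K + 1" using W(2) unfolding card_den_image[OF W(1)] by simp
  define S where "S = separator K V E W'"
  note sep = separator_works[OF D cov W'E distW lenW, folded S_def]
  define L where "L = dfilter (\<lambda>e. e \<in> dset W' \<or> e \<in> dset S) E"
  have dL: "dset L = dset W' \<union> dset S" unfolding L_def using W'E sep(1) by auto
  define B where "B = boundary_bag V E C L"
  have eq: "process_task K V E p C W ts rs =
      Pair (dappend (subtasks V E (enc_nat v) C W' S B) ts) (Pair (Pair p (Pair (enc_nat v) (Pair B L))) rs)"
    unfolding process_task_def Let_def v(1)[symmetric] v'_def[symmetric] e'_def[symmetric] W'_def[symmetric]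
      S_def[symmetric] L_def[symmetric] B_def[symmetric] ..
  have ins: "insert (den e') (den ` dset W) = den ` dset W'" unfolding dW' by simp
  show ?thesis
  proof (rule that[of "subtasks V E (enc_nat v) C W' S B" v B L "den e'" "den ` dset S" "map den (dlist (comps S))"])
    show "enc_nat v = dfst (dfilter (\<lambda>v. v \<in> dset C) V)" using v(1) unfolding v'_def by simp
    show "v \<in> den C" using v'(2) v(1) by simp
    show "den e' \<in> edges H" unfolding E[symmetric] using e'(1) by (rule imageI)
    show "v \<in> den e'" using e'(2) v(1) by simp
    show "balanced_split H K (insert (den e') (den ` dset W)) (den ` dset S) (map den (dlist (comps S)))"
      unfolding ins by (rule balanced_split_components[OF sep(1,2) W'E sep(3)])
    show "den ` dset L = insert (den e') (den ` dset W) \<union> den ` dset S"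
      unfolding dL ins by (rule image_Un)
    show "den B = nbhd H (den C) \<inter> \<Union>(den ` dset L)" unfolding B_def by (rule den_boundary_bag[OF C(1)])
    show "map abs_task (dlist (subtasks V E (enc_nat v) C W' S B)) =
      subtask_list v (den C) (insert (den e') (den ` dset W)) (den ` dset S) (den B) (map den (dlist (comps S)))"
      unfolding ins by (rule subtasks_simulation(1)[OF C(1) W'E sep(1)])
    show "\<forall>t\<in>dset (subtasks V E (enc_nat v) C W' S B). valid_task t"
      using subtasks_simulation(2)[OF C(1) W'E sep(1)] by blast
    show "dset L \<subseteq> dset E" unfolding L_def by auto
    show "distinct (dlist B)" unfolding B_def boundary_bag_def using V_distinct by simp
    show "dset B \<subseteq> range enc_nat" unfolding B_def boundary_bag_def using V_enc by auto
  qed (rule eq)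
qed

section \<open>Simulation of the invariant by the states of the program\<close>

definition enc_rec :: "nat \<times> nat \<times> data \<times> data \<Rightarrow> data" where
  "enc_rec = (\<lambda>(p, u, B, L). Pair (enc_nat p) (Pair (enc_nat u) (Pair B L)))"

abbreviation rec_node :: "nat \<times> nat \<times> data \<times> data \<Rightarrow> nat" where
  "rec_node r \<equiv> fst (snd r)"

text \<open>The root is recorded as its own parent.\<close>

definition rec_inv :: "data \<Rightarrow> nat decomp \<Rightarrow> bool" where
  "rec_inv rs D \<longleftrightarrow> (\<exists>recs. dlist rs = map enc_rec recs \<and> distinct (map rec_node recs) \<and>
     nodes D = rec_node ` set recs \<and>
     arcs D = {(p, u). p \<noteq> u \<and> (\<exists>B L. (p, u, B, L) \<in> set recs)} \<and>
     enc_nat (root D) = dfst V \<and>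
     (\<forall>p u B L. (p, u, B, L) \<in> set recs \<longrightarrow> bag D u = den B \<and> cover D u = edge_indicator (den ` dset L) \<and>
        dset L \<subseteq> dset E \<and> distinct (dlist B) \<and> dset B \<subseteq> range enc_nat))"

definition state_inv :: "data \<Rightarrow> nat decomp \<Rightarrow> bool" where
  "state_inv s D \<longleftrightarrow> (\<exists>ts rs. s = Pair ts rs \<and> (\<forall>t\<in>dset ts. valid_task t) \<and>
     decomp_inv H K (map abs_task (dlist ts)) D \<and> rec_inv rs D)"

abbreviation uncovered :: "nat decomp \<Rightarrow> nat set" where
  "uncovered D \<equiv> verts H - \<Union>(bag D ` nodes D)"

lemma rec_invE:
  assumes "rec_inv rs D"
  obtains recs where "dlist rs = map enc_rec recs" "distinct (map rec_node recs)"
     "nodes D = rec_node ` set recs" "arcs D = {(p, u). p \<noteq> u \<and> (\<exists>B L. (p, u, B, L) \<in> set recs)}"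
     "enc_nat (root D) = dfst V"
     "\<forall>p u B L. (p, u, B, L) \<in> set recs \<longrightarrow> bag D u = den B \<and> cover D u = edge_indicator (den ` dset L) \<and>
        dset L \<subseteq> dset E \<and> distinct (dlist B) \<and> dset B \<subseteq> range enc_nat"
  using assms unfolding rec_inv_def by (elim exE conjE) (rule that)

lemma rec_inv_extend:
  assumes rs: "rec_inv rs D" and v: "v \<notin> nodes D" "p \<noteq> v"
    and L: "dset L \<subseteq> dset E" and B: "distinct (dlist B)" "dset B \<subseteq> range enc_nat"
  shows "rec_inv (Pair (Pair (enc_nat p) (Pair (enc_nat v) (Pair B L))) rs) (extend D p v (den B) (den ` dset L))"
proof -
  obtain recs where recs: "dlist rs = map enc_rec recs" "distinct (map rec_node recs)"
     "nodes D = rec_node ` set recs" "arcs D = {(p, u). p \<noteq> u \<and> (\<exists>B L. (p, u, B, L) \<in> set recs)}"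
     "enc_nat (root D) = dfst V"
     "\<forall>p u B L. (p, u, B, L) \<in> set recs \<longrightarrow> bag D u = den B \<and> cover D u = edge_indicator (den ` dset L) \<and>
        dset L \<subseteq> dset E \<and> distinct (dlist B) \<and> dset B \<subseteq> range enc_nat"
    using rs by (rule rec_invE)
  have new: "u \<noteq> v" if "(p, u, B, L) \<in> set recs" for p u B L
    using that v(1) unfolding recs(3) by force
  show ?thesis unfolding rec_inv_def
  proof (intro exI[of _ "(p, v, B, L) # recs"] conjI)
    show "dlist (Pair (Pair (enc_nat p) (Pair (enc_nat v) (Pair B L))) rs) = map enc_rec ((p, v, B, L) # recs)"
      using recs(1) by (simp add: enc_rec_def)
    show "distinct (map rec_node ((p, v, B, L) # recs))" using recs(2) v(1) unfolding recs(3) by simp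
    show "nodes (extend D p v (den B) (den ` dset L)) = rec_node ` set ((p, v, B, L) # recs)"
      unfolding extend_def using recs(3) by simp
    show "arcs (extend D p v (den B) (den ` dset L)) =
      {(p', u). p' \<noteq> u \<and> (\<exists>B' L'. (p', u, B', L') \<in> set ((p, v, B, L) # recs))}"
      unfolding extend_def using recs(4) v(2) by auto
    show "enc_nat (root (extend D p v (den B) (den ` dset L))) = dfst V"
      unfolding extend_def using recs(5) by simp
    show "\<forall>p' u B' L'. (p', u, B', L') \<in> set ((p, v, B, L) # recs) \<longrightarrow>
      bag (extend D p v (den B) (den ` dset L)) u = den B' \<and>
      cover (extend D p v (den B) (den ` dset L)) u = edge_indicator (den ` dset L') \<and>
      dset L' \<subseteq> dset E \<and> distinct (dlist B') \<and> dset B' \<subseteq> range enc_nat"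
      using recs(6) new L B unfolding extend_def by auto
  qed
qed

lemma decompose_step_simulation:
  assumes D0: "tree_decomposition H D0"
    and cov: "\<And>u. u \<in> nodes D0 \<Longrightarrow> \<exists>S. S \<subseteq> edges H \<and> card S \<le> K \<and> bag D0 u \<subseteq> \<Union>S"
    and s: "state_inv s D" "dfst s \<noteq> Atom"
  shows "\<exists>D'. state_inv (decompose_step K V E s) D' \<and> card (uncovered D') < card (uncovered D)"
proof -
  obtain ts rs where ts: "s = Pair ts rs" "\<And>t. t \<in> dset ts \<Longrightarrow> valid_task t"
    "decomp_inv H K (map abs_task (dlist ts)) D" "rec_inv rs D"
    using s(1) unfolding state_inv_def by auto
  obtain t ts' where t: "ts = Pair t ts'" using s(2) ts(1) by (cases ts) auto
  have "valid_task t" using ts(2) t by simp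
  then obtain p C W where pCW: "t = Pair (enc_nat p) (Pair C W)" "dset C \<subseteq> dset V" "dset W \<subseteq> dset E"
    unfolding valid_task_def by auto
  have step: "decompose_step K V E s = process_task K V E (enc_nat p) C W ts' rs"
    unfolding decompose_step_def ts(1) t pCW(1) by simp
  have inv: "decomp_inv H K ((p, den C, den ` dset W) # map abs_task (dlist ts')) D"
    using ts(3) unfolding t pCW(1) by (simp add: abs_task_def)
  then have "pending H K D (p, den C, den ` dset W)" unfolding decomp_inv_def by simp
  then have pend: "den C \<noteq> {}" "card (den ` dset W) \<le> 2 * K" by auto
  obtain v e0 S L B Zs ch where sim:
    "process_task K V E (enc_nat p) C W ts' rs =
      Pair (dappend ch ts') (Pair (Pair (enc_nat p) (Pair (enc_nat v) (Pair B L))) rs)"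
    "enc_nat v = dfst (dfilter (\<lambda>v. v \<in> dset C) V)"
    "v \<in> den C" "e0 \<in> edges H" "v \<in> e0"
    "balanced_split H K (insert e0 (den ` dset W)) S Zs"
    "den ` dset L = insert e0 (den ` dset W) \<union> S" "den B = nbhd H (den C) \<inter> \<Union>(den ` dset L)"
    "map abs_task (dlist ch) = subtask_list v (den C) (insert e0 (den ` dset W)) S (den B) Zs"
    "\<forall>t\<in>dset ch. valid_task t"
    "dset L \<subseteq> dset E" "distinct (dlist B)" "dset B \<subseteq> range enc_nat"
    by (rule process_task_simulation[OF D0 cov pCW(2) pend(1) pCW(3) pend(2),
      where p = "enc_nat p" and ts = ts' and rs = rs])
  note ext = decomp_inv_extend[OF inv H sim(4,5,3) refl sim(6,7,8)]
  let ?D = "extend D p v (den B) (den ` dset L)"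
  have "state_inv (decompose_step K V E s) ?D" unfolding state_inv_def step sim(1)
  proof (intro exI conjI ballI)
    show "valid_task t" if "t \<in> dset (dappend ch ts')" for t
      using that sim(10) ts(2) unfolding t by auto
    show "decomp_inv H K (map abs_task (dlist (dappend ch ts'))) ?D"
      using ext(1) unfolding dlist_simps map_append sim(9) .
    show "rec_inv (Pair (Pair (enc_nat p) (Pair (enc_nat v) (Pair B L))) rs) ?D"
      by (rule rec_inv_extend[OF ts(4) ext(3,4) sim(11,12,13)])
  qed (rule refl)
  moreover have "finite (uncovered D)" using H unfolding hypergraph_def by simp
  then have "card (uncovered ?D) < card (uncovered D)" using ext(2) by (rule psubset_card_mono)
  ultimately show ?thesis by blast
qed

lemma initial_step_simulation:
  assumes D0: "tree_decomposition H D0"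
    and cov: "\<And>u. u \<in> nodes D0 \<Longrightarrow> \<exists>S. S \<subseteq> edges H \<and> card S \<le> K \<and> bag D0 u \<subseteq> \<Union>S"
    and ne: "verts H \<noteq> {}"
  shows "\<exists>D. state_inv (decompose_step K V E (Pair (Pair (Pair (dfst V) (Pair V Atom)) Atom) Atom)) D \<and>
    card (uncovered D) < card (verts H)"
proof -
  have pend: "den V \<noteq> {}" "card (den ` dset Atom) \<le> 2 * K" "dset Atom \<subseteq> dset E"
    using ne unfolding den_V by auto
  obtain v e0 S L B Zs ch where sim:
    "process_task K V E (dfst V) V Atom Atom Atom =
      Pair (dappend ch Atom) (Pair (Pair (dfst V) (Pair (enc_nat v) (Pair B L))) Atom)"
    "enc_nat v = dfst (dfilter (\<lambda>v. v \<in> dset V) V)"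
    "v \<in> den V" "e0 \<in> edges H" "v \<in> e0"
    "balanced_split H K (insert e0 (den ` dset Atom)) S Zs"
    "den ` dset L = insert e0 (den ` dset Atom) \<union> S" "den B = nbhd H (den V) \<inter> \<Union>(den ` dset L)"
    "map abs_task (dlist ch) = subtask_list v (den V) (insert e0 (den ` dset Atom)) S (den B) Zs"
    "\<forall>t\<in>dset ch. valid_task t"
    "dset L \<subseteq> dset E" "distinct (dlist B)" "dset B \<subseteq> range enc_nat"
    by (rule process_task_simulation[OF D0 cov subset_refl pend(1) pend(3) pend(2),
      where p = "dfst V" and ts = Atom and rs = Atom])
  let ?D = "\<lparr>nodes = {v}, root = v, arcs = {}, bag = \<lambda>_. den B, cover = \<lambda>_. edge_indicator (den ` dset L)\<rparr>"
  \<comment> \<open>The initial task selects the very first vertex, which is therefore its own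
    recorded parent and the root.\<close>
  have "dfilter (\<lambda>v. v \<in> dset V) V = V" by (simp add: dlist_inj[symmetric])
  then have root: "dfst V = enc_nat v" using sim(2) by simp
  have eq: "insert e0 (den ` dset Atom) = {e0}" by simp
  have vV: "v \<in> verts H" using sim(3) unfolding den_V .
  note ini = decomp_inv_init[OF H sim(4,5) vV refl sim(6)[unfolded eq] sim(7)[unfolded eq]
    sim(8)[unfolded den_V], of ?D]
  have "state_inv (process_task K V E (dfst V) V Atom Atom Atom) ?D"
    unfolding state_inv_def sim(1)
  proof (intro exI conjI ballI)
    show "valid_task t" if "t \<in> dset (dappend ch Atom)" for t
      using that sim(10) by simp
    show "decomp_inv H K (map abs_task (dlist (dappend ch Atom))) ?D"
      using ini(1) sim(9) unfolding eq den_V by simp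
    show "rec_inv (Pair (Pair (dfst V) (Pair (enc_nat v) (Pair B L))) Atom) ?D"
      unfolding rec_inv_def root
      by (intro exI[of _ "[(v, v, B, L)]"]) (use sim(11-13) in \<open>auto simp: enc_rec_def\<close>)
  qed (rule refl)
  moreover have "card (uncovered ?D) < card (verts H)" using ini(2) by simp
  moreover have "decompose_step K V E (Pair (Pair (Pair (dfst V) (Pair V Atom)) Atom) Atom) =
    process_task K V E (dfst V) V Atom Atom Atom" unfolding decompose_step_def by simp
  ultimately show ?thesis by metis
qed

text \<open>The number of vertices in no bag drops with every step that has a task. When it is 0, a
  pending task would force it below 0, so the task list is empty; any further rounds are
  idle.\<close>

lemma iterate_decompose_step:
  assumes D0: "tree_decomposition H D0"
    and cov: "\<And>u. u \<in> nodes D0 \<Longrightarrow> \<exists>S. S \<subseteq> edges H \<and> card S \<le> K \<and> bag D0 u \<subseteq> \<Union>S"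
    and s: "state_inv s D" "card (uncovered D) \<le> n"
  shows "\<exists>D' rs. (decompose_step K V E ^^ n) s = Pair Atom rs \<and> state_inv (Pair Atom rs) D'"
  using s
proof (induction n arbitrary: s D)
  case 0
  have "dfst s = Atom"
  proof (rule ccontr)
    assume "dfst s \<noteq> Atom"
    from decompose_step_simulation[OF D0 cov 0(1) this] show False using 0(2) by auto
  qed
  moreover obtain ts rs where "s = Pair ts rs" using 0(1) unfolding state_inv_def by auto
  ultimately show ?case using 0(1) by auto
next
  case (Suc n)
  show ?case
  proof (cases "dfst s = Atom")
    case True
    then have "decompose_step K V E s = s" unfolding decompose_step_def by simp
    then have fixp: "(decompose_step K V E ^^ m) s = s" for m by (induction m) auto
    obtain ts rs where "s = Pair ts rs" using Suc.prems(1) unfolding state_inv_def by auto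
    then show ?thesis unfolding fixp using Suc.prems(1) True by auto
  next
    case False
    obtain D' where D': "state_inv (decompose_step K V E s) D'" "card (uncovered D') < card (uncovered D)"
      using decompose_step_simulation[OF D0 cov Suc.prems(1) False] by blast
    then have "card (uncovered D') \<le> n" using Suc.prems(2) by linarith
    from Suc.IH[OF D'(1) this] show ?thesis unfolding funpow_Suc_right o_def .
  qed
qed

lemma decompose_correct:
  assumes D0: "tree_decomposition H D0"
    and cov: "\<And>u. u \<in> nodes D0 \<Longrightarrow> \<exists>S. S \<subseteq> edges H \<and> card S \<le> K \<and> bag D0 u \<subseteq> \<Union>S"
    and ne: "verts H \<noteq> {}"
  shows "\<exists>D rs. decompose K (Pair V E) = Pair Atom rs \<and> rec_inv rs D \<and> decomp_inv H K [] D"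
proof -
  let ?s = "decompose_step K V E (Pair (Pair (Pair (dfst V) (Pair V Atom)) Atom) Atom)"
  obtain D where D: "state_inv ?s D" "card (uncovered D) < card (verts H)"
    using initial_step_simulation[OF D0 cov ne] by blast
  have "length (dlist V) = card (verts H)"
    using distinct_card[OF V_distinct] unfolding V by (simp add: card_image inj_on_def)
  then have "decompose K (Pair V E) = (decompose_step K V E ^^ card (verts H)) ?s"
    unfolding decompose_def dfst.simps dsnd.simps dlist.simps fold_Cons o_apply by (simp add: fold_const)
  moreover obtain D' rs where "(decompose_step K V E ^^ card (verts H)) ?s = Pair Atom rs"
    "state_inv (Pair Atom rs) D'"
    using iterate_decompose_step[OF D0 cov D(1)] D(2) by (meson less_imp_le)
  ultimately show ?thesis unfolding state_inv_def by auto
qed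

section \<open>The output and its correctness\<close>

lemma repr_output_nodes:
  assumes "rec_inv rs D"
  shows "repr_decomp H D (output_nodes (Pair V E) rs)"
proof -
  obtain recs where recs: "dlist rs = map enc_rec recs" "distinct (map rec_node recs)"
     "nodes D = rec_node ` set recs" "arcs D = {(p, u). p \<noteq> u \<and> (\<exists>B L. (p, u, B, L) \<in> set recs)}"
     "enc_nat (root D) = dfst V"
     "\<forall>p u B L. (p, u, B, L) \<in> set recs \<longrightarrow> bag D u = den B \<and> cover D u = edge_indicator (den ` dset L) \<and>
        dset L \<subseteq> dset E \<and> distinct (dlist B) \<and> dset B \<subseteq> range enc_nat"
    using assms by (rule rec_invE)
  have nodes: "nodes D = set (map rec_node recs)" unfolding recs(3) by simp
  have rs: "rs = enc_list (map enc_rec recs)" using recs(1) by (metis enc_list_dlist)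
  have fields: "dfst (enc_rec r) = enc_nat (fst r)" "dfst (dsnd (enc_rec r)) = enc_nat (rec_node r)"
    "dfst (dsnd (dsnd (enc_rec r))) = fst (snd (snd r))" "dsnd (dsnd (dsnd (enc_rec r))) = snd (snd (snd r))" for r
    unfolding enc_rec_def by (simp_all split: prod.split)
  have mem: "bag D (rec_node r) = den (fst (snd (snd r)))"
    "cover D (rec_node r) = edge_indicator (den ` dset (snd (snd (snd r))))"
    "dset (snd (snd (snd r))) \<subseteq> dset E" "distinct (dlist (fst (snd (snd r))))"
    "dset (fst (snd (snd r))) \<subseteq> range enc_nat" if "r \<in> set recs" for r
    using recs(6)[rule_format, of "fst r" "rec_node r" "fst (snd (snd r))" "snd (snd (snd r))"] that by simp_all
  have 1: "repr_set repr_nat (nodes D) (enc_list (map (\<lambda>r. enc_nat (rec_node r)) recs))"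
    unfolding nodes by (rule repr_setI[OF recs(2)]) (simp add: repr_nat_def)
  have 2: "repr_set (repr_pair repr_nat repr_nat) (arcs D)
    (enc_list (map (\<lambda>r. Pair (enc_nat (fst r)) (enc_nat (rec_node r))) (filter (\<lambda>r. fst r \<noteq> rec_node r) recs)))"
  proof -
    let ?f = "\<lambda>r :: nat \<times> nat \<times> data \<times> data. (fst r, rec_node r)" and ?rs = "filter (\<lambda>r. fst r \<noteq> rec_node r) recs"
    have arcs: "arcs D = set (map ?f ?rs)" unfolding recs(4) by force
    \<comment> \<open>The arcs are distinct because their children are: each node has a single
      record.\<close>
    have "distinct (map rec_node ?rs)" using recs(2) by (rule distinct_map_filter)
    moreover have "map snd (map ?f ?rs) = map rec_node ?rs" by simp
    ultimately have "distinct (map snd (map ?f ?rs))" by (simp only:)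
    then have "distinct (map ?f ?rs)" using distinct_map by blast
    then show ?thesis unfolding arcs by (rule repr_setI) (simp add: repr_pair_def repr_nat_def)
  qed
  have 3: "repr_map repr_nat (repr_set repr_nat) (nodes D) (bag D)
    (enc_list (map (\<lambda>r. Pair (enc_nat (rec_node r)) (fst (snd (snd r)))) recs))"
    unfolding repr_map_def nodes
  proof (rule repr_setI[OF recs(2)])
    fix r assume "r \<in> set recs"
    then show "repr_pair repr_nat (repr_set repr_nat) (rec_node r, bag D (rec_node r))
      (Pair (enc_nat (rec_node r)) (fst (snd (snd r))))"
      using mem[of r] repr_set_den unfolding repr_pair_def repr_nat_def by simp
  qed
  define wt where "wt L e = (if e \<in> dset L then Pair (enc_nat 1) (enc_nat 1) else Pair (enc_nat 0) (enc_nat 1))"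
    for L e :: data
  have 4: "repr_map repr_nat (repr_map (repr_set repr_nat) repr_fraction (edges H)) (nodes D) (cover D)
    (enc_list (map (\<lambda>r. Pair (enc_nat (rec_node r)) (dmap (\<lambda>e. Pair e (wt (snd (snd (snd r))) e)) E)) recs))"
    unfolding repr_map_def[of repr_nat] nodes
  proof (rule repr_setI[OF recs(2)])
    fix r assume r: "r \<in> set recs"
    let ?L = "snd (snd (snd r))"
    have edges: "edges H = set (map den (dlist E))" unfolding E[symmetric] by simp
    have "distinct (map den (dlist E))" using E_distinct E_inj by (simp add: distinct_map)
    then have "repr_map (repr_set repr_nat) repr_fraction (edges H) (cover D (rec_node r))
      (dmap (\<lambda>e. Pair e (wt ?L e)) E)"
      unfolding repr_map_def edges dmap_def
    proof (rule repr_setI)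
      fix e assume e: "e \<in> set (dlist E)"
      have "repr_set repr_nat (den e) e"
        by (rule repr_set_den[OF E_elem_distinct[OF e] E_enc[OF e]])
      moreover have "cover D (rec_node r) (den e) = (if e \<in> dset ?L then 1 else 0)"
        unfolding mem(2)[OF r] edge_indicator_def mem_den_image[OF e mem(3)[OF r]] ..
      then have "repr_fraction (cover D (rec_node r) (den e)) (wt ?L e)"
        unfolding repr_fraction_def wt_def repr_pair_def repr_nat_def
        by (cases "e \<in> dset ?L"; intro exI[of _ "if e \<in> dset ?L then 1 else 0"] exI[of _ 1]) auto
      ultimately show "repr_pair (repr_set repr_nat) repr_fraction
        (den e, cover D (rec_node r) (den e)) (Pair e (wt ?L e))"
        unfolding repr_pair_def by simp
    qed
    then show "repr_pair repr_nat (repr_map (repr_set repr_nat) repr_fraction (edges H))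
      (rec_node r, cover D (rec_node r)) (Pair (enc_nat (rec_node r)) (dmap (\<lambda>e. Pair e (wt ?L e)) E))"
      unfolding repr_pair_def repr_nat_def by simp
  qed
  have out: "output_nodes (Pair V E) rs = enc_list
     [enc_list (map (\<lambda>r. enc_nat (rec_node r)) recs), dfst V,
      enc_list (map (\<lambda>r. Pair (enc_nat (fst r)) (enc_nat (rec_node r))) (filter (\<lambda>r. fst r \<noteq> rec_node r) recs)),
      enc_list (map (\<lambda>r. Pair (enc_nat (rec_node r)) (fst (snd (snd r)))) recs),
      enc_list (map (\<lambda>r. Pair (enc_nat (rec_node r)) (dmap (\<lambda>e. Pair e (wt (snd (snd (snd r))) e)) E)) recs)]"
    unfolding output_nodes_def wt_def rs dmap_def[of _ "enc_list (map enc_rec recs)"]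
    by (simp add: dmap_def dfilter_def filter_map o_def fields)
  have root: "repr_nat (root D) (dfst V)" using recs(5) unfolding repr_nat_def by simp
  show ?thesis unfolding repr_decomp_def
    by (intro exI conjI, rule out, rule 1, rule root, rule 2, rule 3, rule 4)
qed

lemma fhd_algorithm_correct_nonempty:
  assumes D0: "tree_decomposition H D0"
    and cov: "\<And>u. u \<in> nodes D0 \<Longrightarrow> \<exists>S. S \<subseteq> edges H \<and> card S \<le> K \<and> bag D0 u \<subseteq> \<Union>S"
    and ne: "verts H \<noteq> {}"
  shows "\<exists>D. fhd H D \<and> width H D \<le> 3 * real K + 1 \<and> repr_decomp H D (fhd_algorithm K (Pair V E))"
proof -
  obtain D rs where D: "decompose K (Pair V E) = Pair Atom rs" "rec_inv rs D" "decomp_inv H K [] D"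
    using decompose_correct[OF D0 cov ne] by blast
  have "repr_decomp H D (fhd_algorithm K (Pair V E))"
    unfolding fhd_algorithm_def D(1) dsnd.simps by (rule repr_output_nodes[OF D(2)])
  then show ?thesis using decomp_inv_final[OF D(3) hypergraph_finite_edges[OF H]] by blast
qed

text \<open>Without vertices there is none to name the root after. The defaults of
  \<open>dfst\<close> turn everything into \<open>Atom\<close>, which is also the numeral 0, so the
  program outputs the one-node tree on node 0 with an empty bag.\<close>

lemma fhd_algorithm_correct_empty:
  assumes empty: "verts H = {}"
  shows "\<exists>D. fhd H D \<and> width H D \<le> 3 * real K + 1 \<and> repr_decomp H D (fhd_algorithm K (Pair V E))"
proof -
  have edges: "edges H = {}" using H empty unfolding hypergraph_def by auto
  then have dE: "dset E = {}" using E by simp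
  have VE: "V = Atom" "E = Atom" using V empty dE by simp_all
  let ?D = "\<lparr>nodes = {0}, root = 0, arcs = {}, bag = \<lambda>_. {}, cover = \<lambda>_. edge_indicator {}\<rparr> :: nat decomp"
  have [simp]: "dmap f Atom = Atom" "dfilter P Atom = Atom" "dappend Atom Atom = Atom" for f P
    by (simp_all add: dmap_def dfilter_def dappend_def)
  have dec: "decompose K (Pair Atom Atom) = Pair Atom (Pair (Pair Atom (Pair Atom (Pair Atom Atom))) Atom)"
    by (simp add: decompose_def decompose_step_def process_task_def subtasks_def components_def
      boundary_bag_def Let_def)
  have e0: "enc_nat 0 = Atom" by (simp add: enc_nat.simps)
  have "rec_inv (Pair (Pair Atom (Pair Atom (Pair Atom Atom))) Atom) ?D"
    unfolding rec_inv_def unfolding VE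
    by (intro exI[of _ "[(0, 0, Atom, Atom)]"]) (auto simp: enc_rec_def e0 den_def)
  then have "repr_decomp H ?D (fhd_algorithm K (Pair V E))"
    unfolding fhd_algorithm_def using repr_output_nodes dec VE by simp
  moreover have "fhd H ?D"
    unfolding fhd_def tree_decomposition_def rooted_tree_def connected_in_def by (simp add: edges empty)
  moreover have "width H ?D \<le> 3 * real K + 1"
    unfolding width_def weight_def by (simp add: edges)
  ultimately show ?thesis by blast
qed

end

section \<open>From representations of hypergraphs to the final theorem\<close>

lemma repr_set_natD:
  assumes "repr_set repr_nat h e"
  shows "den e = h" "dset e \<subseteq> range enc_nat" "distinct (dlist e)"
proof -
  obtain xs ys where xs: "distinct xs" "set xs = h" "list_all2 repr_nat xs ys" "e = enc_list ys"
    using assms unfolding repr_set_def by blast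
  have ys: "ys = map enc_nat xs" using xs(3) by (induction rule: list_all2_induct) (auto simp: repr_nat_def)
  show "den e = h" "dset e \<subseteq> range enc_nat" "distinct (dlist e)"
    using xs ys unfolding den_def by (auto simp: distinct_map inj_on_def)
qed

lemma encoded_hypergraph_of_repr:
  assumes H: "hypergraph H" and x: "repr_hypergraph H x"
  obtains V E where "x = Pair V E" "encoded_hypergraph H V E"
proof -
  obtain V E where VE: "x = Pair V E" "repr_set repr_nat (verts H) V" "repr_set (repr_set repr_nat) (edges H) E"
    using x unfolding repr_hypergraph_def repr_pair_def by auto
  obtain hs es where hs: "distinct hs" "set hs = edges H" "list_all2 (repr_set repr_nat) hs es" "E = enc_list es"
    using VE(3) unfolding repr_set_def[of "repr_set repr_nat"] by blast
  have es: "hs = map den es \<and> (\<forall>e\<in>set es. dset e \<subseteq> range enc_nat \<and> distinct (dlist e))"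
    using hs(3) by (induction rule: list_all2_induct) (auto simp: repr_set_natD)
  have "encoded_hypergraph H V E"
  proof
    show "hypergraph H" by (rule H)
    show "distinct (dlist V)" by (rule repr_set_natD(3)[OF VE(2)])
    have "dset V = enc_nat ` den V" using repr_set_natD(2)[OF VE(2)] unfolding den_def by auto
    then show "dset V = enc_nat ` verts H" unfolding repr_set_natD(1)[OF VE(2)] .
    show "distinct (dlist E)" "den ` dset E = edges H" "inj_on den (dset E)"
      using hs es by (auto simp: distinct_map)
    show "dset e \<subseteq> range enc_nat" "distinct (dlist e)" if "e \<in> dset E" for e using that hs(4) es by auto
  qed
  then show ?thesis using that VE(1) by blast
qed

theorem theorem7p8:
  fixes d :: nat
  shows "\<exists>g :: real \<Rightarrow> real. g \<in> O(\<lambda>k. k * ln k) \<and>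
    (\<forall>C :: nat hypergraph set. (\<forall>H\<in>C. hypergraph H \<and> vc_dim H \<le> d) \<longrightarrow>
      (\<forall>k\<ge>1. \<exists>A :: data \<Rightarrow> data. polytime A \<and>
        (\<forall>H\<in>C. fhw H \<le> k \<longrightarrow>
          (\<forall>x. repr_hypergraph H x \<longrightarrow>
            (\<exists>D. fhd H D \<and> width H D \<le> g k \<and> repr_decomp H D (A x))))))"
proof -
  \<comment> \<open>The constant c depends on d alone, hence so does the width bound; k enters the
    program only through the number \<open>net_size c k\<close>.\<close>
  obtain c where c: "0 < c" "\<And>k. 1 \<le> k \<Longrightarrow> 6 * (k + 1) \<le> real (net_size c k)"
    "\<And>k. 1 \<le> k \<Longrightarrow> 2 * (2 * real (net_size c k) + 1) ^ (2 ^ Suc d) < 2 powr (real (net_size c k) / (2 * (k + 1)))"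
    using net_size_sufficient[of "2 ^ Suc d"] by blast
  show ?thesis
  proof (intro exI[of _ "\<lambda>k. 3 * real (net_size c k) + 1"] conjI allI impI)
    show "(\<lambda>k. 3 * real (net_size c k) + 1) \<in> O(\<lambda>k. k * ln k)" by (rule net_size_bigo[OF c(1)])
    fix C :: "nat hypergraph set" and k :: real
    assume C: "\<forall>H\<in>C. hypergraph H \<and> vc_dim H \<le> d" and k: "1 \<le> k"
    let ?A = "fhd_algorithm (net_size c k)"
    show "\<exists>A. polytime A \<and> (\<forall>H\<in>C. fhw H \<le> k \<longrightarrow> (\<forall>x. repr_hypergraph H x \<longrightarrow>
      (\<exists>D. fhd H D \<and> width H D \<le> 3 * real (net_size c k) + 1 \<and> repr_decomp H D (A x))))"
    proof (intro exI[of _ ?A] conjI ballI allI impI)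
      show "polytime ?A" by (rule ptime_imp_polytime[OF ptime_fhd_algorithm])
      fix H x assume H: "H \<in> C" and fhw: "fhw H \<le> k" and x: "repr_hypergraph H x"
      have hyp: "hypergraph H" "vc_dim H \<le> d" using C H by auto
      obtain V E where VE: "x = Pair V E" "encoded_hypergraph H V E"
        using encoded_hypergraph_of_repr[OF hyp(1) x] by blast
      interpret encoded_hypergraph H V E "net_size c k" by (rule VE(2))
      obtain D0 where D0: "tree_decomposition H D0"
        "\<And>u. u \<in> nodes D0 \<Longrightarrow> \<exists>S. S \<subseteq> edges H \<and> card S \<le> net_size c k \<and> bag D0 u \<subseteq> \<Union>S"
        using tree_decomposition_with_small_covers[OF hyp fhw c(2)[OF k] c(3)[OF k]] by blast
      show "\<exists>D. fhd H D \<and> width H D \<le> 3 * real (net_size c k) + 1 \<and> repr_decomp H D (?A x)"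
        unfolding VE(1)
        by (cases "verts H = {}")
          (fact fhd_algorithm_correct_empty, rule fhd_algorithm_correct_nonempty[OF D0])
    qed
  qed
qed

end
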